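(* If $G$ is a planar graph, then $\mathsf{c_A}(G)\leq 4$.
   Context: All graphs are finite, simple, undirected and connected. $\mathsf{c_A}(G)$ is the minimum number of cops that guarantees capture in the following game: cops are placed first, then the robber; players alternate, starting with the cops; in each cop turn every cop must move to an adjacent vertex (active cops), while in each robber turn the robber may move to an adjacent vertex or stay (flexible robber); the cops win if a cop occupies the robber's vertex. *)

theory Defs
  imports "HOL-Analysis.Analysis" "Graph_Theory.Graph_Theory"
begin

section \<open>Planar graphs\<close>

text \<open>
  The plane is the type of complex numbers. Graphs are symmetric sets of pairs, so a drawing
  is indexed by the unordered pair of endpoints: both orientations of an edge are drawn as
  one arc, whose direction is irrelevant.
\<close>

definition plane_drawing ::
    "'a pair_pre_digraph \<Rightarrow> ('a \<Rightarrow> complex) \<Rightarrow> ('a set \<Rightarrow> real \<Rightarrow> complex) \<Rightarrow> bool" where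
  "plane_drawing G p \<gamma> \<longleftrightarrow>
     inj_on p (pverts G) \<and>
     (\<forall>(u, v) \<in> parcs G.
        arc (\<gamma> {u, v}) \<and>
        {pathstart (\<gamma> {u, v}), pathfinish (\<gamma> {u, v})} = {p u, p v} \<and>
        path_image (\<gamma> {u, v}) \<inter> p ` pverts G = {p u, p v}) \<and>
     (\<forall>(u, v) \<in> parcs G. \<forall>(x, y) \<in> parcs G. {u, v} \<noteq> {x, y} \<longrightarrow>
        path_image (\<gamma> {u, v}) \<inter> path_image (\<gamma> {x, y}) \<subseteq> p ` ({u, v} \<inter> {x, y}))"

definition planar :: "'a pair_pre_digraph \<Rightarrow> bool" where
  "planar G \<longleftrightarrow> (\<exists>p \<gamma>. plane_drawing G p \<gamma>)"


section \<open>The game with active cops and a flexible robber\<close>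

text \<open>
  The robber is at \<open>\<rho> 0\<close> after his placement and at \<open>\<rho> n\<close> after his \<open>n\<close>-th move. A strategy
  \<open>\<sigma>\<close> of the cops maps the list of all positions the robber has had so far to the positions
  of the cops numbered \<open>0, \<dots>, k - 1\<close>; its value at \<open>[]\<close> is the initial placement.
  Several cops may share a vertex.
\<close>

definition robber_trajectory :: "'a pair_pre_digraph \<Rightarrow> (nat \<Rightarrow> 'a) \<Rightarrow> bool" where
  "robber_trajectory G \<rho> \<longleftrightarrow>
     \<rho> 0 \<in> pverts G \<and> (\<forall>n. \<rho> (Suc n) = \<rho> n \<or> (\<rho> n, \<rho> (Suc n)) \<in> parcs G)"

definition cops_at :: "('a list \<Rightarrow> nat \<Rightarrow> 'a) \<Rightarrow> (nat \<Rightarrow> 'a) \<Rightarrow> nat \<Rightarrow> nat \<Rightarrow> 'a" where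
  "cops_at \<sigma> \<rho> n = \<sigma> (map \<rho> [0..<n])"

text \<open>
  Whether the game is over when the cops are about to make move number \<open>n + 1\<close>. The robber at
  \<open>\<rho> m\<close> faces first the cops at \<open>cops_at \<sigma> \<rho> m\<close> and then, after their next move,
  those at \<open>cops_at \<sigma> \<rho> (Suc m)\<close>.
\<close>

definition captured_by ::
    "nat \<Rightarrow> ('a list \<Rightarrow> nat \<Rightarrow> 'a) \<Rightarrow> (nat \<Rightarrow> 'a) \<Rightarrow> nat \<Rightarrow> bool" where
  "captured_by k \<sigma> \<rho> n \<longleftrightarrow>
     (\<exists>i<k. (\<exists>m\<le>n. cops_at \<sigma> \<rho> m i = \<rho> m) \<or> (\<exists>m<n. cops_at \<sigma> \<rho> (Suc m) i = \<rho> m))"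

text \<open>
  Moves have to be legal only while the game is running; on the one-vertex graph, where there
  are no moves, a single cop captures at the robber's placement.
\<close>

definition winning_cop_strategy ::
    "'a pair_pre_digraph \<Rightarrow> nat \<Rightarrow> ('a list \<Rightarrow> nat \<Rightarrow> 'a) \<Rightarrow> bool" where
  "winning_cop_strategy G k \<sigma> \<longleftrightarrow>
     (\<forall>i<k. \<sigma> [] i \<in> pverts G) \<and>
     (\<forall>\<rho>. robber_trajectory G \<rho> \<longrightarrow>
        (\<forall>n. \<not> captured_by k \<sigma> \<rho> n \<longrightarrow>
           (\<forall>i<k. (cops_at \<sigma> \<rho> n i, cops_at \<sigma> \<rho> (Suc n) i) \<in> parcs G)) \<and>
        (\<exists>n. captured_by k \<sigma> \<rho> n))"

definition active_cops_win :: "'a pair_pre_digraph \<Rightarrow> nat \<Rightarrow> bool" where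
  "active_cops_win G k \<longleftrightarrow> (\<exists>\<sigma>. winning_cop_strategy G k \<sigma>)"

definition active_cop_number :: "'a pair_pre_digraph \<Rightarrow> nat" where
  "active_cop_number G = (LEAST k. active_cops_win G k)"

text \<open>The minimum is attained on every finite graph: one cop on each vertex suffices.\<close>

lemma active_cops_win_card:
  assumes "finite (pverts G)"
  shows "active_cops_win G (card (pverts G))"
proof -
  obtain f where f: "bij_betw f {0..<card (pverts G)} (pverts G)"
    using ex_bij_betw_nat_finite[OF assms] by blast
  have captured: "captured_by (card (pverts G)) (\<lambda>_. f) \<rho> n" if "robber_trajectory G \<rho>" for \<rho> n
  proof -
    have "\<rho> 0 \<in> f ` {0..<card (pverts G)}"
      using that f by (simp add: robber_trajectory_def bij_betw_def)
    then obtain i where "i < card (pverts G)" "\<rho> 0 = f i"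
      by auto
    then have "\<exists>m\<le>n. cops_at (\<lambda>_. f) \<rho> m i = \<rho> m"
      by (intro exI[of _ 0]) (simp add: cops_at_def)
    then show ?thesis
      using \<open>i < card (pverts G)\<close> unfolding captured_by_def by blast
  qed
  have "f i \<in> pverts G" if "i < card (pverts G)" for i
    using f that by (auto simp: bij_betw_def)
  then have "winning_cop_strategy G (card (pverts G)) (\<lambda>_. f)"
    using captured by (simp add: winning_cop_strategy_def)
  then show ?thesis
    unfolding active_cops_win_def by blast
qed

lemma active_cops_win_active_cop_number:
  assumes "finite (pverts G)"
  shows "active_cops_win G (active_cop_number G)"
  unfolding active_cop_number_def
  using active_cops_win_card[OF assms] by (rule LeastI)

end

theory Submission
  imports Defs
begin

text \<open>
  Three cops suffice for the passive game on planar graphs because one cop can guard a shortest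
  path. An active cop cannot stand still, but a pair of cops of opposite parity, oscillating along a
  shortest path, still guards it. The territory \<open>R\<close> of the robber is bounded by two internally
  disjoint paths with common ends, each guarded by one cop (state A), or one of them by a
  pair (state B), or it hangs on a single edge (state E), and it is shrunk by induction.

  In state A the two spare cops take over a shortest path through \<open>R\<close> between points of the boundary.
  By planarity each component of the rest meets only one side, which leads to state B.
  In state B the paired path either can be guarded by one cop, or it is bypassed
  by a tie, a path through \<open>R\<close> of the same length. Choosing the tie innermost, the region between tie
  and path (the lens) is guarded by one cop on either side, which is state A; while the robber
  avoids the lens, a cop on the path and a cop on the tie together guard the path, so the pair can be
  moved over to the tie.
\<close>

text \<open>An active cop cannot wait, so on patrol he is at \<open>lev r\<close> or
  \<open>lev r - 1\<close>, and time decides which. A robber at \<open>r\<close> can threaten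
  positions \<open>lev r - 1\<close>, \<open>lev r\<close> and \<open>lev r + 1\<close> of a
  shortest path; a lone cop is sure to answer only the first two. A threat to
  \<open>lev r + 1\<close> is his one defect, and following decreasing levels from \<open>r\<close>
  turns it into a detour of equal length: this is where ties come from. A partner of opposite parity
  removes the defect. Parity classes never mix in a bipartite graph, so they are budgeted: two cops
  of each, told apart by the parity of their numbers. State B keeps three cops busy, so only one is
  spare and the pair cannot be moved to another path in one go. Topology enters through two facts:
  no face borders all three arcs of a theta curve (K33 in disguise), and of four arcs with common
  ends no three can be linked pairwise off the rest (K5 in disguise). Sides, lenses and territories
  are otherwise defined by components and neighbours alone. State E receives territories attached at
  a single vertex, which have no chord.\<close>

hide_const (open) Digraph_Component.connected

section \<open>Theta curves in the plane\<close>

text \<open>Both sides of a Jordan curve have the whole curve as frontier, and a connected set off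
  the curve lies on one of them; \<open>Z\<close> is the other one. The last property, that
  \<open>Z\<close> is a full component of the complement, is what a connection found by
  Janiszewski's theorem will contradict.\<close>

lemma theta_Jordan:
  fixes c1 c2 :: "real \<Rightarrow> complex"
  assumes "arc c1" "arc c2" "pathstart c1 = a" "pathstart c2 = a" "pathfinish c1 = b" "pathfinish c2 = b"
    and "path_image c1 \<inter> path_image c2 = {a, b}"
    and "connected C" "C \<inter> (path_image c1 \<union> path_image c2) = {}" "C \<noteq> {}"
  obtains Z where "connected Z" "Z \<noteq> {}" "Z \<inter> (path_image c1 \<union> path_image c2) = {}"
    "path_image c1 \<union> path_image c2 \<subseteq> closure Z" "Z \<inter> C = {}"
    "\<And>x y. y \<in> Z \<Longrightarrow> connected_component (- (path_image c1 \<union> path_image c2)) x y \<Longrightarrow> x \<in> Z"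
proof -
  define J where "J = path_image c1 \<union> path_image c2"
  let ?c = "c1 +++ reversepath c2"
  have sp: "simple_path ?c"
    using assms by (intro simple_path_join_loop) (auto simp: arc_reversepath)
  have cl: "pathfinish ?c = pathstart ?c"
    using assms by simp
  have J: "path_image ?c = J"
    using assms by (simp add: path_image_join J_def)
  note jio = Jordan_inside_outside[OF sp cl, unfolded J]
  have cover: "C \<subseteq> inside J \<union> outside J"
    using assms(9) jio by (auto simp: J_def)
  have sep: "connected S \<Longrightarrow> S \<inter> J = {} \<Longrightarrow> S \<inter> inside J \<noteq> {} \<Longrightarrow> S \<inter> outside J = {}" for S
    using connectedD[of S "inside J" "outside J"] jio by blast
  have comp: "x \<in> inside J" if "y \<in> inside J" "connected_component (- J) x y" for x y
    using that inside_same_component[of J y x] by (metis connected_component_sym)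
  have comp': "x \<in> outside J" if "y \<in> outside J" "connected_component (- J) x y" for x y
    using that outside_same_component[of J y x] by (metis connected_component_sym)
  show thesis
  proof (cases "C \<inter> inside J = {}")
    case True
    then show thesis
      using jio comp
      by (intro that[of "inside J"]) (auto simp: J_def[symmetric] frontier_def)
  next
    case False
    then have "C \<inter> outside J = {}"
      using sep[of C] assms by (auto simp: J_def)
    then show thesis
      using jio comp'
      by (intro that[of "outside J"]) (auto simp: J_def[symmetric] frontier_def)
  qed
qed

lemma arc_endless:
  fixes c :: "real \<Rightarrow> complex"
  assumes "arc c" "pathstart c = a" "pathfinish c = b"
  shows "connected (path_image c - {a, b})" "path_image c - {a, b} \<noteq> {}" "a \<in> path_image c" "b \<in> path_image c"
        "a \<noteq> b" "connected (path_image c)" "compact (path_image c)" "closed (path_image c)"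
proof -
  have s: "simple_path c" using assms arc_imp_simple_path by blast
  show "connected (path_image c - {a, b})" "path_image c - {a, b} \<noteq> {}"
    using connected_simple_path_endless[OF s] nonempty_simple_path_endless[OF s] assms by auto
  show "a \<in> path_image c" "b \<in> path_image c" using assms by auto
  show "a \<noteq> b" using assms arc_distinct_ends by blast
  show "connected (path_image c)" "compact (path_image c)" "closed (path_image c)"
    using arc_imp_path[OF assms(1)] compact_imp_closed[OF compact_path_image]
    by (simp_all add: connected_path_image compact_path_image)
qed

text \<open>No component of the complement of a theta curve has all three arcs on its boundary:
  the side of the Jordan curve \<open>c1 \<union> c2\<close> that avoids \<open>c3\<close> would by Janiszewski's theorem be
  joined to \<open>x\<close> in the complement of all three arcs.\<close>

lemma theta_curve_no_common_face:
  fixes c1 c2 c3 :: "real \<Rightarrow> complex"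
  assumes arcs: "arc c1" "arc c2" "arc c3"
    and st: "pathstart c1 = a" "pathstart c2 = a" "pathstart c3 = a"
    and fi: "pathfinish c1 = b" "pathfinish c2 = b" "pathfinish c3 = b"
    and int: "path_image c1 \<inter> path_image c2 = {a, b}" "path_image c1 \<inter> path_image c3 = {a, b}"
      "path_image c2 \<inter> path_image c3 = {a, b}"
    and con: "connected L1" "connected L2" "connected L3" and x: "x \<in> L1" "x \<in> L2" "x \<in> L3"
    and L1: "L1 \<inter> path_image c1 \<noteq> {}" "L1 \<inter> path_image c2 = {}" "L1 \<inter> path_image c3 = {}"
    and L2: "L2 \<inter> path_image c2 \<noteq> {}" "L2 \<inter> path_image c1 = {}" "L2 \<inter> path_image c3 = {}"
    and L3: "L3 \<inter> path_image c3 \<noteq> {}" "L3 \<inter> path_image c1 = {}" "L3 \<inter> path_image c2 = {}"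
  shows False
proof -
  let ?I1 = "path_image c1" and ?I2 = "path_image c2" and ?I3 = "path_image c3"
  note e1 = arc_endless[OF arcs(1) st(1) fi(1)] and e2 = arc_endless[OF arcs(2) st(2) fi(2)]
    and e3 = arc_endless[OF arcs(3) st(3) fi(3)]
  have C3: "connected (L3 \<union> (?I3 - {a, b}))"
    using con(3) e3(1) L3 e1 by (intro connected_Un) auto
  have C2: "connected (L2 \<union> (?I2 - {a, b}))"
    using con(2) e2(1) L2 e1 by (intro connected_Un) auto
  have C1: "connected (L1 \<union> (?I1 - {a, b}))"
    using con(1) e1(1) L1 e2 by (intro connected_Un) auto
  have d: "(L3 \<union> (?I3 - {a, b})) \<inter> (?I1 \<union> ?I2) = {}"
    using int(2,3) L3(2,3) by auto
  have n: "L3 \<union> (?I3 - {a, b}) \<noteq> {}"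
    using x(3) by auto
  obtain Z where Z: "connected Z" "Z \<noteq> {}" "Z \<inter> (?I1 \<union> ?I2) = {}" "?I1 \<union> ?I2 \<subseteq> closure Z"
      "Z \<inter> (L3 \<union> (?I3 - {a, b})) = {}"
      "\<And>x y. y \<in> Z \<Longrightarrow> connected_component (- (?I1 \<union> ?I2)) x y \<Longrightarrow> x \<in> Z"
    by (rule theta_Jordan[OF arcs(1,2) st(1,2) fi(1,2) int(1) C3 d n]) (rule that)
  obtain y where y: "y \<in> Z" using Z(2) by blast
  have xZ: "x \<notin> Z" using Z(5) x(3) by auto
  obtain q1 where q1: "q1 \<in> ?I1" "q1 \<noteq> a" "q1 \<noteq> b" using e1(2) by auto
  obtain q2 where q2: "q2 \<in> ?I2" "q2 \<noteq> a" "q2 \<noteq> b" using e2(2) by auto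
  have Z3: "Z \<inter> ?I3 = {}"
  proof -
    have "a \<notin> Z" "b \<notin> Z" using Z(3) e1(3,4) by auto
    moreover have "Z \<inter> (?I3 - {a, b}) = {}" using Z(5) by (simp add: Int_Un_distrib)
    ultimately show ?thesis by blast
  qed
  \<comment> \<open>Both arcs lie in the closure of \<open>Z\<close>, so one of their points can be
    added to \<open>Z\<close> without losing connectedness; it serves as a door from the arc into
    \<open>Z\<close>.\<close>
  have cq: "connected (insert q Z)" if "q \<in> ?I1 \<union> ?I2" for q
    using that Z(4) closure_subset[of Z] by (intro connected_intermediate_closure[OF Z(1)]) auto
  have a2: "(?I2 - {a, b}) \<inter> (?I1 \<union> ?I3) = {}"
    using int(1,3) by auto
  have a1: "(?I1 - {a, b}) \<inter> (?I2 \<union> ?I3) = {}"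
    using int(1,2) by auto
  have d2: "(L2 \<union> (?I2 - {a, b})) \<union> insert q2 Z \<subseteq> - (?I1 \<union> ?I3)"
    using L2(2,3) Z(3) Z3 q2 a2 by auto
  have d1: "(L1 \<union> (?I1 - {a, b})) \<union> insert q1 Z \<subseteq> - (?I2 \<union> ?I3)"
    using L1(2,3) Z(3) Z3 q1 a1 by auto
  \<comment> \<open>From \<open>x\<close> along \<open>L2\<close> to the second arc, along this arc
    to \<open>q2\<close> and on into \<open>Z\<close>: a connection that avoids the other two arcs.
    The same is done below with the first arc.\<close>
  have "connected ((L2 \<union> (?I2 - {a, b})) \<union> insert q2 Z)"
    using C2 cq[of q2] q2 by (intro connected_Un[of _ "insert q2 Z"]) auto
  then have "connected_component (- (?I1 \<union> ?I3)) x y"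
    unfolding connected_component_def
    using d2 x(2) y by blast
  moreover have "connected ((L1 \<union> (?I1 - {a, b})) \<union> insert q1 Z)"
    using C1 cq[of q1] q1 by (intro connected_Un[of _ "insert q1 Z"]) auto
  then have "connected_component (- (?I2 \<union> ?I3)) x y"
    unfolding connected_component_def
    using d1 x(1) y by blast
  \<comment> \<open>The two avoided sets meet exactly in the third arc, which is connected, as
    Janiszewski's theorem requires.\<close>
  moreover have "(?I1 \<union> ?I3) \<inter> (?I2 \<union> ?I3) = ?I3"
    using int by auto
  moreover have "compact (?I1 \<union> ?I3)" "closed (?I2 \<union> ?I3)"
    using e1(7) e2(8) e3(7,8) by (simp_all add: compact_Un closed_Un)
  ultimately have "connected_component (- ((?I1 \<union> ?I3) \<union> (?I2 \<union> ?I3))) x y"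
    using e3(6) Janiszewski[of "?I1 \<union> ?I3" "?I2 \<union> ?I3" x y] by simp
  then have "connected_component (- (?I1 \<union> ?I2)) x y"
    by (rule connected_component_of_subset) auto
  then show False
    using Z(6)[OF y] xZ by blast
qed

text \<open>If the face \<open>U\<close> around \<open>C\<close> had no frontier point on
  \<open>A\<close> besides \<open>a\<close> and \<open>b\<close>, it would be open and closed in the
  plane minus two points, which is connected, and would swallow \<open>A - {a, b}\<close>. So some
  other point \<open>q\<close> of \<open>A\<close> is in its closure, and \<open>F\<close> is
  \<open>U\<close> with \<open>q\<close> added.\<close>

lemma component_touches_arcs:
  fixes A :: "complex set"
  assumes "closed A" "connected C" "C \<noteq> {}" "C \<inter> A = {}" "a \<in> A" "b \<in> A" "A - {a, b} \<noteq> {}"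
  obtains F q where "connected F" "C \<subseteq> F" "q \<in> A - {a, b}" "q \<in> F" "F \<inter> A = {q}"
proof -
  obtain d where d: "d \<in> C" using assms by blast
  define U where "U = connected_component_set (- A) d"
  have "C \<subseteq> U"
    unfolding U_def using assms d by (intro connected_component_maximal) auto
  moreover have "open U" "connected U" "U \<inter> A = {}"
    using assms(1) connected_component_subset[of "- A" d] unfolding U_def
    by (simp_all add: open_connected_component open_Compl disjoint_eq_subset_Compl)
  ultimately have U: "open U" "connected U" "C \<subseteq> U" "U \<inter> A = {}"
    by simp_all
  have clU: "q \<in> U" if "q \<in> closure U" "q \<notin> A" for q
  proof -
    have "connected (insert q U)"
      using that(1) closure_subset[of U] by (intro connected_intermediate_closure[OF U(2)]) auto
    moreover have "insert q U \<subseteq> - A" using that(2) U(4) by auto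
    moreover have "d \<in> insert q U" using d U(3) by auto
    ultimately have "insert q U \<subseteq> connected_component_set (- A) d"
      by (intro connected_component_maximal)
    then show ?thesis
      by (auto simp: U_def)
  qed
  have "\<exists>q \<in> A - {a, b}. q \<in> closure U"
  proof (rule ccontr)
    assume "\<not> ?thesis"
    then have cl: "closure U \<subseteq> U \<union> {a, b}" using clU by blast
    have "countable {a, b}" by simp
    then have con: "connected (- {a, b} :: complex set)"
      by (intro path_connected_imp_connected path_connected_complement_countable) auto
    have "U \<inter> - closure U \<inter> - {a, b} = {}" using closure_subset[of U] by auto
    moreover have "- {a, b} \<subseteq> U \<union> - closure U" using cl by blast
    moreover have "U \<inter> - {a, b} \<noteq> {}" using U(3,4) d assms(5,6) by auto
    moreover have "open (- closure U)" by (simp add: open_Compl)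
    ultimately have "- closure U \<inter> - {a, b} = {}"
      using connectedD[OF con U(1), of "- closure U"] by simp
    then have "- {a, b} \<subseteq> U" using cl by auto
    then show False using assms(7) U(4) by auto
  qed
  then obtain q where q: "q \<in> A - {a, b}" "q \<in> closure U" by blast
  have "connected (insert q U)"
    using q(2) closure_subset[of U] by (intro connected_intermediate_closure[OF U(2)]) auto
  moreover have "insert q U \<inter> A = {q}" "C \<subseteq> insert q U"
    using q(1) U(3,4) by auto
  ultimately show thesis
    using q(1) by (intro that[of "insert q U" q]) simp_all
qed

text \<open>Read as a theta curve with arcs \<open>B\<close>, \<open>C\<close>, \<open>D\<close>:
  the open arc \<open>A\<close> is a hub off it that reaches \<open>B\<close> through
  \<open>LB\<close>, \<open>C\<close> through \<open>LC\<close> and \<open>D\<close> through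
  \<open>F\<close>, so all three arcs would border one face.\<close>

lemma four_arcs_aux:
  fixes A B C D :: "real \<Rightarrow> complex"
  assumes arcs: "arc A" "arc B" "arc C" "arc D"
    and st: "pathstart A = a" "pathstart B = a" "pathstart C = a" "pathstart D = a"
    and fi: "pathfinish A = b" "pathfinish B = b" "pathfinish C = b" "pathfinish D = b"
    and int: "path_image A \<inter> path_image B = {a, b}" "path_image A \<inter> path_image C = {a, b}"
      "path_image A \<inter> path_image D = {a, b}" "path_image B \<inter> path_image C = {a, b}"
      "path_image B \<inter> path_image D = {a, b}" "path_image C \<inter> path_image D = {a, b}"
    and F: "connected F" "path_image D - {a, b} \<subseteq> F" "q \<in> path_image A - {a, b}" "q \<in> F"
      "F \<inter> (path_image A \<union> path_image B \<union> path_image C) = {q}"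
    and con: "connected LB" "connected LC"
    and LB: "LB \<inter> path_image A \<noteq> {}" "LB \<inter> path_image B \<noteq> {}" "LB \<inter> path_image C = {}" "LB \<inter> path_image D = {}"
    and LC: "LC \<inter> path_image A \<noteq> {}" "LC \<inter> path_image C \<noteq> {}" "LC \<inter> path_image B = {}" "LC \<inter> path_image D = {}"
  shows False
proof -
  let ?A = "path_image A - {a, b}"
  note eA = arc_endless[OF arcs(1) st(1) fi(1)] and eB = arc_endless[OF arcs(2) st(2) fi(2)]
    and eC = arc_endless[OF arcs(3) st(3) fi(3)] and eD = arc_endless[OF arcs(4) st(4) fi(4)]
  have 1: "connected (?A \<union> LB)" "connected (?A \<union> LC)" "connected (?A \<union> F)"
  proof -
    have "?A \<inter> LB \<noteq> {}"
      using LB(1,3) eC(3,4) by auto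
    moreover have "?A \<inter> LC \<noteq> {}"
      using LC(1,3) eB(3,4) by auto
    moreover have "?A \<inter> F \<noteq> {}"
      using F(3,4) by auto
    ultimately show "connected (?A \<union> LB)" "connected (?A \<union> LC)" "connected (?A \<union> F)"
      using eA(1) con F(1) by (simp_all add: connected_Un)
  qed
  have "q \<notin> path_image B" "q \<notin> path_image C"
    using F(3) int(1,2) by auto
  then have F': "F \<inter> path_image B = {}" "F \<inter> path_image C = {}"
    using F(5) by auto
  have q: "q \<in> ?A \<union> LB" "q \<in> ?A \<union> LC" "q \<in> ?A \<union> F"
    using F(3) by auto
  have D: "(?A \<union> F) \<inter> path_image D \<noteq> {}"
    using F(2) eD(2) by auto
  have A: "?A \<inter> path_image B = {}" "?A \<inter> path_image C = {}" "?A \<inter> path_image D = {}"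
    using int by auto
  show False
    by (rule theta_curve_no_common_face[OF arcs(2,3,4) st(2,3,4) fi(2,3,4) int(4,5,6)
          1 q _ _ _ _ _ _ D])
      (use F' LB LC A in \<open>auto simp: Int_Un_distrib2\<close>)
qed

text \<open>This is the nonplanarity of the complete graph on five vertices: \<open>a\<close>,
  \<open>b\<close> and the open arcs \<open>A\<close>, \<open>B\<close>, \<open>C\<close>, with
  \<open>D\<close> as the edge from \<open>a\<close> to \<open>b\<close>. The links may meet one
  another, as they do where this is applied. The face of the first three arcs that contains
  \<open>D\<close> has a frontier point inside one of them, and that arc is then linked to both
  others and to \<open>D\<close>.\<close>

lemma four_arcs_not_linked:
  fixes A B C D :: "real \<Rightarrow> complex"
  assumes arcs: "arc A" "arc B" "arc C" "arc D"
    and st: "pathstart A = a" "pathstart B = a" "pathstart C = a" "pathstart D = a"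
    and fi: "pathfinish A = b" "pathfinish B = b" "pathfinish C = b" "pathfinish D = b"
    and int: "path_image A \<inter> path_image B = {a, b}" "path_image A \<inter> path_image C = {a, b}"
      "path_image A \<inter> path_image D = {a, b}" "path_image B \<inter> path_image C = {a, b}"
      "path_image B \<inter> path_image D = {a, b}" "path_image C \<inter> path_image D = {a, b}"
    and con: "connected LAB" "connected LAC" "connected LBC"
    and AB: "LAB \<inter> path_image A \<noteq> {}" "LAB \<inter> path_image B \<noteq> {}" "LAB \<inter> path_image C = {}" "LAB \<inter> path_image D = {}"
    and AC: "LAC \<inter> path_image A \<noteq> {}" "LAC \<inter> path_image C \<noteq> {}" "LAC \<inter> path_image B = {}" "LAC \<inter> path_image D = {}"
    and BC: "LBC \<inter> path_image B \<noteq> {}" "LBC \<inter> path_image C \<noteq> {}" "LBC \<inter> path_image A = {}" "LBC \<inter> path_image D = {}"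
  shows False
proof -
  let ?T = "path_image A \<union> path_image B \<union> path_image C"
  note eA = arc_endless[OF arcs(1) st(1) fi(1)] and eB = arc_endless[OF arcs(2) st(2) fi(2)]
    and eC = arc_endless[OF arcs(3) st(3) fi(3)] and eD = arc_endless[OF arcs(4) st(4) fi(4)]
  have "closed ?T" using eA(8) eB(8) eC(8) by (simp add: closed_Un)
  moreover have "(path_image D - {a, b}) \<inter> ?T = {}" using int(3,5,6) by auto
  moreover have "?T - {a, b} \<noteq> {}" using eA(2) by auto
  ultimately obtain F q where F: "connected F" "path_image D - {a, b} \<subseteq> F" "q \<in> ?T - {a, b}" "q \<in> F" "F \<inter> ?T = {q}"
    using component_touches_arcs[of ?T "path_image D - {a, b}" a b] eD(1,2) eA(3,4) by (metis UnI1)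
  consider "q \<in> path_image A - {a, b}" | "q \<in> path_image B - {a, b}" | "q \<in> path_image C - {a, b}"
    using F(3) by auto
  then show False
  proof cases
    case 1
    show ?thesis
      by (rule four_arcs_aux[OF arcs st fi int F(1,2) 1 F(4,5) con(1,2)]) (use AB AC in auto)
  next
    case 2
    have T: "F \<inter> (path_image B \<union> path_image A \<union> path_image C) = {q}"
      using F(5) by (simp add: Un_commute)
    show ?thesis
      by (rule four_arcs_aux[OF arcs(2,1,3,4) st(2,1,3,4) fi(2,1,3,4) _ int(4,5,2,3,6) F(1,2) 2 F(4) T con(1,3)])
        (use int(1) AB BC in \<open>simp_all add: Int_commute\<close>)
  next
    case 3
    have T: "F \<inter> (path_image C \<union> path_image A \<union> path_image B) = {q}"
      using F(5) by (simp add: Un_commute Un_left_commute)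
    show ?thesis
      by (rule four_arcs_aux[OF arcs(3,1,2,4) st(3,1,2,4) fi(3,1,2,4) _ _ int(6) int(1,3,5) F(1,2) 3 F(4) T con(2,3)])
        (use int(2,4) AC BC in \<open>simp_all add: Int_commute\<close>)
  qed
qed

section \<open>Connected vertex sets and paths\<close>

locale sgraph =
  fixes V :: "'a set" and adj :: "'a \<Rightarrow> 'a \<Rightarrow> bool"
  assumes finV: "finite V"
    and adjV: "adj u v \<Longrightarrow> u \<in> V"
    and adj_sym: "adj u v \<Longrightarrow> adj v u"
    and adj_irrefl: "\<not> adj u u"
begin

lemma adjV2: "adj u v \<Longrightarrow> v \<in> V"
  using adjV adj_sym by blast

lemma adj_commute: "adj u v \<longleftrightarrow> adj v u"
  using adj_sym by blast

text \<open>Reflexive at every vertex, in \<open>S\<close> or not; facts on components therefore ask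
  for a base point in \<open>S\<close>.\<close>

definition reach :: "'a set \<Rightarrow> 'a \<Rightarrow> 'a \<Rightarrow> bool" where
  "reach S = (\<lambda>u v. adj u v \<and> u \<in> S \<and> v \<in> S)\<^sup>*\<^sup>*"

definition con :: "'a set \<Rightarrow> bool" where
  "con S \<longleftrightarrow> (\<forall>x\<in>S. \<forall>y\<in>S. reach S x y)"

lemma reach_refl [simp]: "reach S x x"
  by (simp add: reach_def)

lemma reach_trans: "reach S x y \<Longrightarrow> reach S y z \<Longrightarrow> reach S x z"
  unfolding reach_def by (rule rtranclp_trans)

lemma reach_step: "adj x y \<Longrightarrow> x \<in> S \<Longrightarrow> y \<in> S \<Longrightarrow> reach S x y"
  unfolding reach_def by blast

lemma reach_sym: "reach S x y \<Longrightarrow> reach S y x"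
  unfolding reach_def
proof (induction rule: rtranclp_induct)
  case (step y z)
  then have "adj z y \<and> z \<in> S \<and> y \<in> S"
    by (simp add: adj_sym)
  then show ?case
    using step.IH by (rule converse_rtranclp_into_rtranclp)
qed simp

lemma reach_mono: "reach S x y \<Longrightarrow> S \<subseteq> T \<Longrightarrow> reach T x y"
  unfolding reach_def by (erule rtranclp_mono[THEN predicate2D, rotated]) blast

lemma reach_in: "reach S x y \<Longrightarrow> x \<in> S \<Longrightarrow> y \<in> S"
  unfolding reach_def by (induction rule: rtranclp_induct) auto

lemma con_Un:
  assumes "con S" "con T" "S \<inter> T \<noteq> {}"
  shows "con (S \<union> T)"
proof -
  obtain z where z: "z \<in> S" "z \<in> T" using assms by blast
  have "reach (S \<union> T) x z" if "x \<in> S \<union> T" for x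
    using that assms z unfolding con_def by (meson Un_iff Un_upper1 Un_upper2 reach_mono)
  then show ?thesis
    unfolding con_def by (meson reach_sym reach_trans)
qed

lemma con_Un_adj:
  assumes "con S" "con T" "x \<in> S" "y \<in> T" "adj x y"
  shows "con (S \<union> T)"
proof -
  have "con {x, y}"
    using assms(5) by (auto simp: con_def intro: reach_step adj_sym)
  then have "con (S \<union> {x, y})"
    using assms by (intro con_Un) auto
  then have "con ((S \<union> {x, y}) \<union> T)"
    using assms by (intro con_Un[of "S \<union> {x, y}"]) auto
  moreover have "(S \<union> {x, y}) \<union> T = S \<union> T"
    using assms by auto
  ultimately show ?thesis
    by (simp only:)
qed

lemma con_insert: "con S \<Longrightarrow> y \<in> S \<Longrightarrow> adj x y \<Longrightarrow> con (insert x S)"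
  using con_Un_adj[of "{x}" S x y] by (simp add: con_def)

definition comp_of :: "'a set \<Rightarrow> 'a \<Rightarrow> 'a set" where
  "comp_of S x = {y. reach S x y}"

lemma comp_sub: "x \<in> S \<Longrightarrow> comp_of S x \<subseteq> S"
  by (auto simp: comp_of_def reach_in)

lemma comp_self [simp]: "x \<in> comp_of S x"
  by (simp add: comp_of_def)

lemma comp_closed: "x \<in> S \<Longrightarrow> y \<in> comp_of S x \<Longrightarrow> adj y z \<Longrightarrow> z \<in> S \<Longrightarrow> z \<in> comp_of S x"
  unfolding comp_of_def mem_Collect_eq by (meson reach_in reach_step reach_trans)

lemma con_comp:
  assumes "x \<in> S"
  shows "con (comp_of S x)"
proof -
  have *: "reach (comp_of S x) x y" if "reach S x y" for y
    using that unfolding reach_def[of S]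
  proof (induction rule: rtranclp_induct)
    case (step y z)
    then have "reach S x y"
      unfolding reach_def by blast
    moreover have "reach S y z"
      using step.hyps(2) by (simp add: reach_step)
    ultimately have "reach S x y" "reach S x z"
      using reach_trans by blast+
    then show ?case
      using step by (intro reach_trans[OF step.IH reach_step]) (auto simp: comp_of_def)
  qed simp
  then show ?thesis
    unfolding con_def comp_of_def by (metis (lifting) comp_of_def mem_Collect_eq reach_sym reach_trans)
qed

lemma con_sub_comp:
  assumes "con T" "T \<subseteq> S" "x \<in> T"
  shows "T \<subseteq> comp_of S x"
  using assms unfolding con_def comp_of_def by (auto intro: reach_mono)

lemma comp_eq: "x \<in> S \<Longrightarrow> y \<in> comp_of S x \<Longrightarrow> comp_of S y = comp_of S x"
  unfolding comp_of_def using reach_sym reach_trans by blast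

lemma con_boundary:
  assumes "con R" "K \<subseteq> R" "K \<noteq> {}" "K \<noteq> R"
  obtains x y where "x \<in> K" "y \<in> R - K" "adj x y"
proof -
  obtain a b where ab: "a \<in> K" "b \<in> R - K" using assms by blast
  then have "reach R a b" using assms by (auto simp: con_def)
  then have "b \<in> K \<or> (\<exists>x\<in>K. \<exists>y\<in>R - K. adj x y)"
    unfolding reach_def by (induction rule: rtranclp_induct) (use ab in auto)
  then show thesis using ab that by blast
qed

definition vpath :: "'a \<Rightarrow> 'a \<Rightarrow> 'a list \<Rightarrow> bool" where
  "vpath s t vs \<longleftrightarrow> distinct vs \<and> successively adj vs \<and> vs \<noteq> [] \<and> hd vs = s \<and> last vs = t"

lemma vpath_rev: "vpath s t vs \<Longrightarrow> vpath t s (rev vs)"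
  unfolding vpath_def by (auto simp: successively_rev hd_rev last_rev adj_commute)

lemma vpath_append:
  assumes "vpath s t vs" "vpath t' u us" "adj t t'" "set vs \<inter> set us = {}"
  shows "vpath s u (vs @ us)"
  using assms unfolding vpath_def by (auto simp: successively_append_iff)

lemma vpath_ends: "vpath s t vs \<Longrightarrow> s \<in> set vs \<and> t \<in> set vs"
  unfolding vpath_def by auto

lemma con_vpath: "vpath s t vs \<Longrightarrow> con (set vs)"
proof (induction vs arbitrary: s)
  case (Cons x vs)
  show ?case
  proof (cases "vs = []")
    case True
    then show ?thesis by (simp add: con_def)
  next
    case False
    then have "vpath (hd vs) t vs" "adj x (hd vs)"
      using Cons.prems by (auto simp: vpath_def successively_Cons)
    then show ?thesis
      using Cons.IH[of "hd vs"] False con_insert[of "set vs" "hd vs" x] by simp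
  qed
qed (simp add: vpath_def)

fun pe :: "'a list \<Rightarrow> 'a set set" where
  "pe (x # y # zs) = insert {x, y} (pe (y # zs))"
| "pe _ = {}"

lemma pe_sub: "e \<in> pe vs \<Longrightarrow> e \<subseteq> set vs \<and> e \<noteq> {}"
  by (induction vs rule: pe.induct) auto

lemma pe_adj: "e \<in> pe vs \<Longrightarrow> successively adj vs \<Longrightarrow> \<exists>u v. e = {u, v} \<and> adj u v"
  by (induction vs rule: pe.induct) auto

lemma pe_Union: "2 \<le> length vs \<Longrightarrow> \<Union> (pe vs) = set vs"
proof (induction vs rule: pe.induct)
  case (1 x y zs)
  show ?case
    using 1 by (cases zs) auto
qed auto

text \<open>Vertices do not repeat, so the edge between the two ends is both the first and the last
  edge. This limits which edge two paths with common ends can share.\<close>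

lemma pe_short:
  assumes "vpath s t vs" "{s, t} \<in> pe vs"
  shows "vs = [s, t]"
proof -
  obtain y zs where vs: "vs = s # y # zs"
    using assms by (cases vs rule: pe.cases) (auto simp: vpath_def)
  have "{s, t} \<notin> pe (y # zs)"
    using assms(1) pe_sub[of "{s, t}" "y # zs"] by (auto simp: vpath_def vs)
  then have "t = y"
    using assms vs by (auto simp: doubleton_eq_iff vpath_def)
  then show ?thesis
    using assms(1) by (auto simp: vs vpath_def split: if_splits)
qed

end

section \<open>Drawn graphs\<close>

locale drawn_graph = sgraph +
  fixes p :: "'a \<Rightarrow> complex" and \<gamma> :: "'a set \<Rightarrow> real \<Rightarrow> complex"
  assumes inj_p: "inj_on p V"
    and arc_edge: "adj u v \<Longrightarrow> arc (\<gamma> {u, v})"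
    and ends_edge: "adj u v \<Longrightarrow> {pathstart (\<gamma> {u, v}), pathfinish (\<gamma> {u, v})} = {p u, p v}"
    and verts_edge: "adj u v \<Longrightarrow> path_image (\<gamma> {u, v}) \<inter> p ` V = {p u, p v}"
    and cross_edge: "adj u v \<Longrightarrow> adj x y \<Longrightarrow> {u, v} \<noteq> {x, y} \<Longrightarrow>
      path_image (\<gamma> {u, v}) \<inter> path_image (\<gamma> {x, y}) \<subseteq> p ` ({u, v} \<inter> {x, y})"
begin

definition edges :: "'a set set" where
  "edges = {{u, v} | u v. adj u v}"

lemma edgesE:
  assumes "e \<in> edges"
  obtains u v where "e = {u, v}" "adj u v"
  using assms unfolding edges_def by auto

definition dimg :: "'a set set \<Rightarrow> complex set" where
  "dimg E = (\<Union>e\<in>E. path_image (\<gamma> e))"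

lemma dimg_Int:
  assumes "E \<subseteq> edges" "F \<subseteq> edges" "E \<inter> F = {}"
  shows "dimg E \<inter> dimg F \<subseteq> p ` (\<Union>E \<inter> \<Union>F)"
proof
  fix z assume "z \<in> dimg E \<inter> dimg F"
  then obtain e f where ef: "e \<in> E" "f \<in> F" "z \<in> path_image (\<gamma> e)" "z \<in> path_image (\<gamma> f)"
    by (auto simp: dimg_def)
  then have "e \<in> edges" "f \<in> edges"
    using assms by auto
  then obtain u v x y where "e = {u, v}" "adj u v" "f = {x, y}" "adj x y"
    by (elim edgesE)
  moreover have "e \<noteq> f" using ef assms by auto
  ultimately have "z \<in> p ` (e \<inter> f)"
    using cross_edge[of u v x y] ef by auto
  then show "z \<in> p ` (\<Union>E \<inter> \<Union>F)"
    using ef by auto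
qed

lemma dimg_verts:
  assumes "E \<subseteq> edges" "v \<in> V"
  shows "p v \<in> dimg E \<longleftrightarrow> v \<in> \<Union>E"
proof -
  have "p v \<in> path_image (\<gamma> e) \<longleftrightarrow> v \<in> e" if "e \<in> E" for e
  proof -
    have "e \<in> edges" using assms(1) that by (rule subsetD)
    then obtain x y where e: "e = {x, y}" "adj x y"
      by (rule edgesE)
    then have "p v \<in> path_image (\<gamma> e) \<longleftrightarrow> p v \<in> {p x, p y}"
      using verts_edge[of x y] assms(2) by auto
    also have "\<dots> \<longleftrightarrow> v \<in> e"
      using e assms(2) adjV[of x y] adjV2[of x y] inj_p by (auto dest: inj_onD)
    finally show ?thesis .
  qed
  then show ?thesis
    by (auto simp: dimg_def)
qed

lemma pe_edges: "successively adj vs \<Longrightarrow> pe vs \<subseteq> edges"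
  using pe_adj unfolding edges_def by blast

lemma arc_between:
  assumes "adj u v"
  obtains c where "arc c" "pathstart c = p u" "pathfinish c = p v" "path_image c = path_image (\<gamma> {u, v})"
proof -
  consider "pathstart (\<gamma> {u, v}) = p u" "pathfinish (\<gamma> {u, v}) = p v"
    | "pathstart (\<gamma> {u, v}) = p v" "pathfinish (\<gamma> {u, v}) = p u"
    using ends_edge[OF assms] by (auto simp: doubleton_eq_iff)
  then show thesis
  proof cases
    case 1
    then show thesis using that[of "\<gamma> {u, v}"] arc_edge[OF assms] by simp
  next
    case 2
    then show thesis
      using that[of "reversepath (\<gamma> {u, v})"] arc_edge[OF assms] by (simp add: arc_reversepath)
  qed
qed

lemma set_vpath_V: "vpath s t vs \<Longrightarrow> s \<noteq> t \<Longrightarrow> set vs \<subseteq> V"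
proof -
  assume vs: "vpath s t vs" "s \<noteq> t"
  then have "2 \<le> length vs"
    by (cases vs rule: pe.cases) (auto simp: vpath_def)
  then have "set vs = \<Union> (pe vs)"
    using pe_Union by auto
  also have "\<dots> \<subseteq> V"
    using vs pe_adj adjV adjV2 unfolding vpath_def by blast
  finally show "set vs \<subseteq> V" .
qed

lemma arc_vpath:
  assumes "vpath s t vs" "s \<noteq> t"
  obtains c where "arc c" "pathstart c = p s" "pathfinish c = p t" "path_image c = dimg (pe vs)"
  using assms
proof (induction vs arbitrary: s thesis rule: pe.induct)
  case (1 x y zs)
  have s: "s = x" and xy: "adj x y"
    using 1(3,4) by (auto simp: vpath_def)
  obtain c1 where c1: "arc c1" "pathstart c1 = p x" "pathfinish c1 = p y" "path_image c1 = path_image (\<gamma> {x, y})"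
    using arc_between[OF xy] by blast
  show ?case
  proof (cases "zs = []")
    case True
    then have "t = y" using 1(3,4) by (auto simp: vpath_def)
    then show ?thesis
      using c1 s True 1(2)[of c1] by (simp add: dimg_def)
  next
    case False
    have yz: "vpath y t (y # zs)"
      using 1(3,4) by (auto simp: vpath_def)
    have yt: "y \<noteq> t"
      using 1(3) False by (auto simp: vpath_def)
    obtain c2 where c2: "arc c2" "pathstart c2 = p y" "pathfinish c2 = p t" "path_image c2 = dimg (pe (y # zs))"
      using 1(1)[OF _ yz yt] by blast
    have x: "x \<notin> set (y # zs)"
      using 1(3,4) by (auto simp: vpath_def)
    have "path_image c1 \<inter> path_image c2 = dimg {{x, y}} \<inter> dimg (pe (y # zs))"
      using c1 c2 by (simp add: dimg_def)
    also have "\<dots> \<subseteq> p ` (\<Union>{{x, y}} \<inter> \<Union> (pe (y # zs)))"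
    proof (rule dimg_Int)
      show "{{x, y}} \<subseteq> edges" using xy by (auto simp: edges_def)
      show "pe (y # zs) \<subseteq> edges" using yz by (intro pe_edges) (simp add: vpath_def)
      show "{{x, y}} \<inter> pe (y # zs) = {}" using x pe_sub[of _ "y # zs"] by blast
    qed
    also have "\<dots> \<subseteq> {p y}"
      using x pe_sub[of _ "y # zs"] by fastforce
    finally have "arc (c1 +++ c2)"
      using c1 c2 by (intro arc_join) auto
    then show ?thesis
      using c1 c2 s 1(2)[of "c1 +++ c2"] by (simp add: path_image_join dimg_def)
  qed
qed (auto simp: vpath_def)

text \<open>A common edge would have both ends in \<open>{s, t}\<close>, so both paths would be the
  single edge between \<open>s\<close> and \<open>t\<close>; \<open>ne\<close> rules that out. Paths
  without common edge are drawn disjoint apart from common vertices.\<close>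

lemma dimg_theta:
  assumes vs: "vpath s t vs" and us: "vpath s t us" and "s \<noteq> t"
    and int: "set vs \<inter> set us = {s, t}" and ne: "set vs \<noteq> {s, t} \<or> set us \<noteq> {s, t}"
  shows "dimg (pe vs) \<inter> dimg (pe us) = {p s, p t}"
proof -
  have l: "2 \<le> length vs" "2 \<le> length us"
    using vs us \<open>s \<noteq> t\<close> by (cases vs rule: pe.cases; auto simp: vpath_def; fail)
       (use us \<open>s \<noteq> t\<close> in \<open>cases us rule: pe.cases; auto simp: vpath_def\<close>)
  have E: "pe vs \<subseteq> edges" "pe us \<subseteq> edges"
    using vs us pe_edges by (simp_all add: vpath_def)
  have "e = {s, t}" if e: "e \<in> pe vs" "e \<in> pe us" for e
  proof -
    obtain x y where xy: "e = {x, y}" "adj x y"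
      using e(1) E unfolding edges_def by blast
    have "e \<subseteq> {s, t}"
      using e pe_sub int by blast
    then show ?thesis
      using xy adj_irrefl by (metis doubleton_eq_iff insert_absorb2 insert_subset singletonD insertE empty_subsetI)
  qed
  then have "pe vs \<inter> pe us = {}"
    using pe_short[OF vs] pe_short[OF us] ne by fastforce
  then have "dimg (pe vs) \<inter> dimg (pe us) \<subseteq> p ` (set vs \<inter> set us)"
    using dimg_Int[OF E] pe_Union l by auto
  moreover have "p s \<in> dimg (pe vs)" "p t \<in> dimg (pe vs)" "p s \<in> dimg (pe us)" "p t \<in> dimg (pe us)"
    using E l pe_Union vpath_ends[OF vs] vpath_ends[OF us] set_vpath_V[OF vs \<open>s \<noteq> t\<close>]
    by (auto simp: dimg_verts)
  ultimately show ?thesis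
    using int by auto
qed

text \<open>The picture of the subgraph induced on \<open>U\<close>. It turns a connected vertex set
  into a connected set in the plane, which is the form of a link in the topological lemmas.\<close>

definition draw :: "'a set \<Rightarrow> complex set" where
  "draw U = p ` U \<union> dimg {{u, v} | u v. u \<in> U \<and> v \<in> U \<and> adj u v}"

lemma connected_draw:
  assumes "con U"
  shows "connected (draw U)"
proof -
  have edge: "connected_component (draw U) (p u) z" if "u \<in> U" "v \<in> U" "adj u v" "z \<in> path_image (\<gamma> {u, v})" for u v z
  proof -
    have "path_image (\<gamma> {u, v}) \<subseteq> draw U"
      using that unfolding draw_def dimg_def by blast
    moreover have "connected (path_image (\<gamma> {u, v}))"
      using arc_edge[OF that(3)] by (simp add: arc_imp_path connected_path_image)
    moreover have "p u \<in> path_image (\<gamma> {u, v})"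
      using verts_edge[OF that(3)] by auto
    ultimately show ?thesis
      using that(4) unfolding connected_component_def by blast
  qed
  have step: "connected_component (draw U) (p u) (p v)" if "reach U u v" "u \<in> U" for u v
    using that unfolding reach_def
  proof (induction rule: rtranclp_induct)
    case base
    then show ?case by (simp add: draw_def)
  next
    case (step y z)
    have "p z \<in> path_image (\<gamma> {y, z})"
      using verts_edge[of y z] step by auto
    then show ?case
      using edge[of y z "p z"] step connected_component_trans by metis
  qed
  have "connected_component (draw U) (p u) z" if "u \<in> U" "z \<in> draw U" for u z
  proof -
    have "z \<in> p ` U \<or> (\<exists>x\<in>U. \<exists>y\<in>U. adj x y \<and> z \<in> path_image (\<gamma> {x, y}))"
      using that(2) by (auto simp: draw_def dimg_def)
    then consider v where "v \<in> U" "z = p v" | x y where "x \<in> U" "y \<in> U" "adj x y" "z \<in> path_image (\<gamma> {x, y})"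
      by blast
    then show ?thesis
    proof cases
      case 1
      then show ?thesis using step assms that by (auto simp: con_def)
    next
      case 2
      then show ?thesis
        using edge[of x y z] step[of u x] assms that connected_component_trans unfolding con_def by metis
    qed
  qed
  moreover have "\<exists>u. u \<in> U" if "z \<in> draw U" for z
    using that by (auto simp: draw_def dimg_def)
  ultimately show ?thesis
    unfolding connected_iff_connected_component by (metis connected_component_sym connected_component_trans)
qed

lemma draw_avoid:
  assumes "vpath s t vs" "s \<noteq> t" "U \<inter> set vs = {}" "U \<subseteq> V"
  shows "draw U \<inter> dimg (pe vs) = {}"
proof -
  let ?E = "{{u, v} | u v. u \<in> U \<and> v \<in> U \<and> adj u v}"
  have E: "?E \<subseteq> edges" "pe vs \<subseteq> edges"
    using assms(1) pe_edges by (auto simp: edges_def vpath_def)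
  have s: "\<Union> (pe vs) \<subseteq> set vs" "\<Union> ?E \<subseteq> U"
    using pe_sub by fastforce+
  have "?E \<inter> pe vs = {}"
  proof -
    have False if "u \<in> U" "{u, v} \<in> pe vs" for u v
      using that s assms(3) by blast
    then show ?thesis by blast
  qed
  from dimg_Int[OF E this] have "dimg ?E \<inter> dimg (pe vs) = {}"
    using s assms(3) by blast
  moreover have "p u \<notin> dimg (pe vs)" if "u \<in> U" for u
    using dimg_verts[OF E(2), of u] s assms that by blast
  ultimately show ?thesis
    unfolding draw_def by blast
qed

lemma draw_meet:
  assumes "vpath s t vs" "s \<noteq> t" "U \<inter> set vs \<noteq> {}"
  shows "draw U \<inter> dimg (pe vs) \<noteq> {}"
proof -
  obtain u where u: "u \<in> U" "u \<in> set vs" using assms by blast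
  have "2 \<le> length vs"
    using assms by (cases vs rule: pe.cases) (auto simp: vpath_def)
  then have "p u \<in> dimg (pe vs)"
    using dimg_verts[of "pe vs" u] pe_edges pe_Union u assms set_vpath_V[OF assms(1,2)]
    by (auto simp: vpath_def)
  then show ?thesis
    using u by (auto simp: draw_def)
qed

lemma theta_free:
  assumes vs: "vpath s t A" "vpath s t B" "vpath s t C" and st: "s \<noteq> t"
    and int: "set A \<inter> set B = {s, t}" "set A \<inter> set C = {s, t}" "set B \<inter> set C = {s, t}"
    and con: "con U1" "con U2" "con U3" and x: "x \<in> U1" "x \<in> U2" "x \<in> U3"
    and V: "U1 \<subseteq> V" "U2 \<subseteq> V" "U3 \<subseteq> V"
    and U1: "U1 \<inter> set A \<noteq> {}" "U1 \<inter> set B = {}" "U1 \<inter> set C = {}"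
    and U2: "U2 \<inter> set B \<noteq> {}" "U2 \<inter> set A = {}" "U2 \<inter> set C = {}"
    and U3: "U3 \<inter> set C \<noteq> {}" "U3 \<inter> set A = {}" "U3 \<inter> set B = {}"
  shows False
proof -
  obtain a where a: "arc a" "pathstart a = p s" "pathfinish a = p t" "path_image a = dimg (pe A)"
    using arc_vpath[OF vs(1) st] by blast
  obtain b where b: "arc b" "pathstart b = p s" "pathfinish b = p t" "path_image b = dimg (pe B)"
    using arc_vpath[OF vs(2) st] by blast
  obtain c where c: "arc c" "pathstart c = p s" "pathfinish c = p t" "path_image c = dimg (pe C)"
    using arc_vpath[OF vs(3) st] by blast
  note en = vpath_ends[OF vs(1)] vpath_ends[OF vs(2)] vpath_ends[OF vs(3)]
  \<comment> \<open>\<open>U1\<close> meets \<open>A\<close> but misses \<open>B\<close>, which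
    contains \<open>s\<close> and \<open>t\<close>; so it meets \<open>A\<close> in an inner vertex.
    Likewise for the other two.\<close>
  have ne: "set A \<noteq> {s, t}" "set B \<noteq> {s, t}" "set C \<noteq> {s, t}"
    using U1(1,2) U2(1,2) U3(1,2) en by auto
  note av = draw_avoid[OF _ st] and me = draw_meet[OF _ st]
  have px: "p x \<in> draw U1" "p x \<in> draw U2" "p x \<in> draw U3"
    using x by (simp_all add: draw_def)
  have d: "path_image a \<inter> path_image b = {p s, p t}" "path_image a \<inter> path_image c = {p s, p t}"
      "path_image b \<inter> path_image c = {p s, p t}"
    using dimg_theta[OF vs(1,2) st int(1)] dimg_theta[OF vs(1,3) st int(2)] dimg_theta[OF vs(2,3) st int(3)] ne
    by (simp_all only: a b c simp_thms)
  show False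
    by (rule theta_curve_no_common_face[OF a(1) b(1) c(1) a(2) b(2) c(2) a(3) b(3) c(3) d
          con[THEN connected_draw] px]; unfold a(4) b(4) c(4))
      (rule me[OF vs(1) U1(1)] av[OF vs(2) U1(2) V(1)] av[OF vs(3) U1(3) V(1)]
        me[OF vs(2) U2(1)] av[OF vs(1) U2(2) V(2)] av[OF vs(3) U2(3) V(2)]
        me[OF vs(3) U3(1)] av[OF vs(1) U3(2) V(3)] av[OF vs(2) U3(3) V(3)])+
qed

lemma four_paths_not_linked:
  assumes vs: "vpath s t A" "vpath s t B" "vpath s t C" "vpath s t D" and st: "s \<noteq> t"
    and int: "set A \<inter> set B = {s, t}" "set A \<inter> set C = {s, t}" "set A \<inter> set D = {s, t}"
      "set B \<inter> set C = {s, t}" "set B \<inter> set D = {s, t}" "set C \<inter> set D = {s, t}"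
    and con: "con AB" "con AC" "con BC"
    and V: "AB \<subseteq> V" "AC \<subseteq> V" "BC \<subseteq> V"
    and AB: "AB \<inter> set A \<noteq> {}" "AB \<inter> set B \<noteq> {}" "AB \<inter> set C = {}" "AB \<inter> set D = {}"
    and AC: "AC \<inter> set A \<noteq> {}" "AC \<inter> set C \<noteq> {}" "AC \<inter> set B = {}" "AC \<inter> set D = {}"
    and BC: "BC \<inter> set B \<noteq> {}" "BC \<inter> set C \<noteq> {}" "BC \<inter> set A = {}" "BC \<inter> set D = {}"
  shows False
proof -
  obtain a where a: "arc a" "pathstart a = p s" "pathfinish a = p t" "path_image a = dimg (pe A)"
    using arc_vpath[OF vs(1) st] by blast
  obtain b where b: "arc b" "pathstart b = p s" "pathfinish b = p t" "path_image b = dimg (pe B)"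
    using arc_vpath[OF vs(2) st] by blast
  obtain c where c: "arc c" "pathstart c = p s" "pathfinish c = p t" "path_image c = dimg (pe C)"
    using arc_vpath[OF vs(3) st] by blast
  obtain d where d: "arc d" "pathstart d = p s" "pathfinish d = p t" "path_image d = dimg (pe D)"
    using arc_vpath[OF vs(4) st] by blast
  note en = vpath_ends[OF vs(1)] vpath_ends[OF vs(2)] vpath_ends[OF vs(3)]
  have ne: "set A \<noteq> {s, t}" "set B \<noteq> {s, t}" "set C \<noteq> {s, t}"
    using AB(1,3) AB(2,3) AC(2,3) en by auto
  note av = draw_avoid[OF _ st] and me = draw_meet[OF _ st]
  have i: "path_image a \<inter> path_image b = {p s, p t}" "path_image a \<inter> path_image c = {p s, p t}"
      "path_image a \<inter> path_image d = {p s, p t}" "path_image b \<inter> path_image c = {p s, p t}"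
      "path_image b \<inter> path_image d = {p s, p t}" "path_image c \<inter> path_image d = {p s, p t}"
    using dimg_theta[OF vs(1,2) st int(1)] dimg_theta[OF vs(1,3) st int(2)] dimg_theta[OF vs(1,4) st int(3)]
      dimg_theta[OF vs(2,3) st int(4)] dimg_theta[OF vs(2,4) st int(5)] dimg_theta[OF vs(3,4) st int(6)] ne
    by (simp_all only: a b c d simp_thms)
  show False
    by (rule four_arcs_not_linked[OF a(1) b(1) c(1) d(1) a(2) b(2) c(2) d(2) a(3) b(3) c(3) d(3) i
          con[THEN connected_draw]]; unfold a(4) b(4) c(4) d(4))
      (rule me[OF vs(1) AB(1)] me[OF vs(2) AB(2)] av[OF vs(3) AB(3) V(1)] av[OF vs(4) AB(4) V(1)]
        me[OF vs(1) AC(1)] me[OF vs(3) AC(2)] av[OF vs(2) AC(3) V(2)] av[OF vs(4) AC(4) V(2)]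
        me[OF vs(2) BC(1)] me[OF vs(3) BC(2)] av[OF vs(1) BC(3) V(3)] av[OF vs(4) BC(4) V(3)])+
qed

end

section \<open>Four active cops with parity\<close>

locale cop_game = sgraph +
  fixes x0 :: 'a
  assumes x0: "x0 \<in> V" and conV: "con V" and nbr: "v \<in> V \<Longrightarrow> \<exists>u. adj v u"
begin

text \<open>In \<open>cops_win\<close> the cops are to move, in \<open>robber_loses\<close> the robber.\<close>

fun cops_win_in :: "nat \<Rightarrow> (nat \<Rightarrow> 'a) \<Rightarrow> 'a \<Rightarrow> bool" where
  "cops_win_in 0 cs r \<longleftrightarrow> (\<exists>i<4. cs i = r)"
| "cops_win_in (Suc n) cs r \<longleftrightarrow> (\<exists>i<4. cs i = r) \<or>
     (\<exists>cs'. (\<forall>i<4. adj (cs i) (cs' i)) \<and> ((\<exists>i<4. cs' i = r) \<or> (\<forall>r'. r' = r \<or> adj r r' \<longrightarrow> cops_win_in n cs' r')))"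

definition cops_win :: "(nat \<Rightarrow> 'a) \<Rightarrow> 'a \<Rightarrow> bool" where
  "cops_win cs r \<longleftrightarrow> (\<exists>n. cops_win_in n cs r)"

definition robber_loses :: "(nat \<Rightarrow> 'a) \<Rightarrow> 'a \<Rightarrow> bool" where
  "robber_loses cs r \<longleftrightarrow> (\<exists>i<4. cs i = r) \<or> (\<forall>r'. r' = r \<or> adj r r' \<longrightarrow> cops_win cs r')"

lemma cops_win_in_Suc: "cops_win_in n cs r \<Longrightarrow> cops_win_in (Suc n) cs r"
proof (induction n arbitrary: cs r)
  case (Suc n)
  then consider "\<exists>i<4. cs i = r" | cs' where "\<forall>i<4. adj (cs i) (cs' i)"
      "(\<exists>i<4. cs' i = r) \<or> (\<forall>r'. r' = r \<or> adj r r' \<longrightarrow> cops_win_in n cs' r')"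
    by (auto simp only: cops_win_in.simps)
  then show ?case
  proof cases
    case 2
    then have "(\<exists>i<4. cs' i = r) \<or> (\<forall>r'. r' = r \<or> adj r r' \<longrightarrow> cops_win_in (Suc n) cs' r')"
      using Suc.IH by blast
    then show ?thesis
      using 2(1) unfolding cops_win_in.simps(2)[of "Suc n"] by blast
  qed simp
qed simp

lemma cops_win_in_mono: "cops_win_in n cs r \<Longrightarrow> n \<le> m \<Longrightarrow> cops_win_in m cs r"
  by (induction m) (auto simp: le_Suc_eq simp del: cops_win_in.simps intro: cops_win_in_Suc)

lemma cops_win_caught: "i < 4 \<Longrightarrow> cs i = r \<Longrightarrow> cops_win cs r"
  unfolding cops_win_def by (rule exI[of _ 0]) auto

text \<open>The number of rounds needed depends on the robber's reply; he has finitely many replies,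
  so the maximum \<open>M\<close> serves for all.\<close>

lemma cops_win_step:
  assumes legal: "\<And>i. i < 4 \<Longrightarrow> adj (cs i) (cs' i)" and robber_loses: "robber_loses cs' r"
  shows "cops_win cs r"
proof (cases "\<exists>i<4. cs' i = r")
  case True
  then have "cops_win_in (Suc 0) cs r"
    unfolding cops_win_in.simps(2) using legal by blast
  then show ?thesis
    unfolding cops_win_def by blast
next
  case False
  then have "\<exists>n. cops_win_in n cs' r'" if "r' = r \<or> adj r r'" for r'
    using robber_loses that unfolding robber_loses_def cops_win_def by blast
  then obtain n where n: "r' = r \<or> adj r r' \<Longrightarrow> cops_win_in (n r') cs' r'" for r'
    by metis
  define M where "M = Max (n ` insert r V)"
  have "n r' \<le> M" if "r' = r \<or> adj r r'" for r'
    unfolding M_def using finV that adjV2[of r r'] by (intro Max_ge) auto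
  then have "cops_win_in M cs' r'" if "r' = r \<or> adj r r'" for r'
    using n cops_win_in_mono that by blast
  then have "cops_win_in (Suc M) cs r"
    unfolding cops_win_in.simps(2) using legal by blast
  then show ?thesis
    unfolding cops_win_def by blast
qed

text \<open>The capturing cop steps onto \<open>r\<close>, but the other three have to move as well;
  they can since every vertex has a neighbour.\<close>

lemma cops_win_nbr_caught:
  assumes "\<And>i. i < 4 \<Longrightarrow> cs i \<in> V" "\<exists>i<4. cs i = r \<or> adj (cs i) r"
  shows "cops_win cs r"
proof -
  obtain i where i: "i < 4" "cs i = r \<or> adj (cs i) r" using assms(2) by blast
  show ?thesis
  proof (cases "cs i = r")
    case False
    then have a: "adj (cs i) r" using i by blast
    have "\<exists>u. adj (cs j) u" if "j < 4" for j
      using nbr assms(1) that by blast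
    then obtain f where f: "j < 4 \<Longrightarrow> adj (cs j) (f j)" for j
      by metis
    have "robber_loses (f(i := r)) r"
      unfolding robber_loses_def using i(1) by (intro disjI1) auto
    then show ?thesis
      using f a by (intro cops_win_step[of cs "f(i := r)"]) auto
  qed (use i cops_win_caught in blast)
qed

text \<open>The cops numbered \<open>i\<close> have parity classes: at time \<open>\<tau>\<close> there is a walk from \<open>x0\<close> to
  cop \<open>i\<close> of the parity of \<open>\<tau> + i\<close>. In a bipartite graph the relative parity of two active
  cops never changes, so this is what tells which cops can be paired up on adjacent vertices.\<close>

definition parity_at :: "'a \<Rightarrow> nat \<Rightarrow> bool" where
  "parity_at x k \<longleftrightarrow> (\<exists>n. (adj ^^ n) x0 x \<and> even (n + k))"

definition parities_ok :: "nat \<Rightarrow> (nat \<Rightarrow> 'a) \<Rightarrow> bool" where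
  "parities_ok \<tau> cs \<longleftrightarrow> (\<forall>i<4. parity_at (cs i) (\<tau> + i))"

lemma parity_at_V: "parity_at x k \<Longrightarrow> x \<in> V"
  unfolding parity_at_def using x0 adjV2 by (metis relpowp_E relpowp_0_E)

lemma parity_at_step: "parity_at x k \<Longrightarrow> adj x y \<Longrightarrow> parity_at y (Suc k)"
  unfolding parity_at_def by (metis even_Suc add_Suc add_Suc_right relpowp_Suc_I)

lemma parity_at_ex:
  assumes "x \<in> V"
  obtains k where "parity_at x k"
proof -
  have "reach V x0 x"
    using conV x0 assms by (simp add: con_def)
  then have "adj\<^sup>*\<^sup>* x0 x"
    unfolding reach_def by (rule rtranclp_mono[THEN predicate2D, rotated]) blast
  then obtain n where "(adj ^^ n) x0 x"
    by (metis rtranclp_power)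
  then have "parity_at x n"
    unfolding parity_at_def by (intro exI[of _ n]) simp
  then show thesis by (rule that)
qed

lemma relpowp_sym: "(adj ^^ n) x y \<Longrightarrow> (adj ^^ n) y x"
proof (induction n arbitrary: y)
  case (Suc n)
  then obtain z where "(adj ^^ n) x z" "adj z y" by auto
  then show ?case
    using Suc.IH[of z] adj_sym by (metis relpowp_Suc_I2)
qed simp

end

section \<open>Patrol routes\<close>

text \<open>A patrol route for one cop: while the robber is at \<open>r\<close>, the cop is at position \<open>lev r\<close> or
  \<open>lev r - 1\<close> of the walk, whichever has the right parity. This is a legal strategy for an active
  cop because \<open>lev\<close> is 1-Lipschitz.\<close>

record 'a track =
  wlk :: "nat \<Rightarrow> 'a"
  len :: nat
  lev :: "'a \<Rightarrow> nat"
  phase :: nat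

context cop_game
begin

definition track_on :: "'a set \<Rightarrow> 'a track \<Rightarrow> bool" where
  "track_on X T \<longleftrightarrow> 1 \<le> len T \<and> (\<forall>c<len T. adj (wlk T c) (wlk T (Suc c))) \<and> parity_at (wlk T 0) (phase T) \<and>
     (\<forall>r\<in>X. 1 \<le> lev T r \<and> lev T r \<le> len T) \<and> (\<forall>r\<in>X. \<forall>r'\<in>X. adj r r' \<longrightarrow> lev T r' \<le> lev T r + 1)"

text \<open>The parity condition selects one of the two positions, so time and robber determine
  where a synchronised cop is. Position \<open>c\<close> of the walk has parity class
  \<open>c + phase T\<close>, since \<open>phase\<close> is the class of its start.\<close>

definition in_sync :: "nat \<Rightarrow> nat \<Rightarrow> 'a track \<Rightarrow> (nat \<Rightarrow> 'a) \<Rightarrow> 'a \<Rightarrow> bool" where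
  "in_sync \<tau> i T cs r \<longleftrightarrow> (\<exists>c. (c = lev T r \<or> Suc c = lev T r) \<and> cs i = wlk T c \<and> even (c + phase T + \<tau> + i))"

definition guarding :: "(nat \<rightharpoonup> 'a track) \<Rightarrow> 'a set \<Rightarrow> nat \<Rightarrow> (nat \<Rightarrow> 'a) \<Rightarrow> 'a \<Rightarrow> bool" where
  "guarding J X \<tau> cs r \<longleftrightarrow> r \<in> X \<and> parities_ok \<tau> cs \<and> (\<forall>i T. J i = Some T \<longrightarrow> i < 4 \<and> in_sync \<tau> i T cs r)"

text \<open>The robber is to move. All times, and all placements of the remaining cops in their
  parity classes, are allowed; this lets a statement about a small territory be used in the middle
  of play in a larger one.\<close>

definition wins :: "(nat \<rightharpoonup> 'a track) \<Rightarrow> 'a set \<Rightarrow> bool" where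
  "wins J X \<longleftrightarrow> (\<forall>\<tau> cs r. guarding J X \<tau> cs r \<longrightarrow> robber_loses cs r)"

definition tracks_on :: "'a set \<Rightarrow> (nat \<rightharpoonup> 'a track) \<Rightarrow> bool" where
  "tracks_on X J \<longleftrightarrow> (\<forall>i T. J i = Some T \<longrightarrow> i < 4 \<and> track_on X T)"

lemma track_on_mono: "track_on X T \<Longrightarrow> Y \<subseteq> X \<Longrightarrow> track_on Y T"
  unfolding track_on_def by blast

text \<open>Old and new position differ by at most 2, by the Lipschitz bound, and by an odd number,
  by parity. So they are consecutive on the walk: the cop always has a legal move and never needs to
  wait.\<close>

lemma in_sync_move:
  assumes T: "track_on X T" and r: "r \<in> X" "r' \<in> X" "r' = r \<or> adj r r'" and s: "in_sync \<tau> i T cs r"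
  shows "\<exists>v. adj (cs i) v \<and> (\<forall>cs'. cs' i = v \<longrightarrow> in_sync (Suc \<tau>) i T cs' r')"
proof -
  obtain c where c: "c = lev T r \<or> Suc c = lev T r" "cs i = wlk T c" "even (c + phase T + \<tau> + i)"
    using s unfolding in_sync_def by blast
  define c' where "c' = (if even (lev T r' + phase T + Suc \<tau> + i) then lev T r' else lev T r' - 1)"
  have l: "1 \<le> lev T r'" "lev T r' \<le> len T" "lev T r \<le> len T" "1 \<le> lev T r"
    using T r unfolding track_on_def by blast+
  have lip: "lev T r' \<le> lev T r + 1" "lev T r \<le> lev T r' + 1"
    using T r adj_sym[of r r'] unfolding track_on_def by auto
  have c': "c' = lev T r' \<or> Suc c' = lev T r'" "even (c' + phase T + Suc \<tau> + i)"
    using l unfolding c'_def by (auto split: if_splits)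
  have "odd (c + c')"
    using c(3) c'(2) by (auto simp: even_add)
  then have "c \<noteq> c'" "c \<noteq> c' + 2" "c' \<noteq> c + 2"
    by auto
  moreover have "c \<le> c' + 2" "c' \<le> c + 2"
    using c(1) c'(1) lip by linarith+
  ultimately have "c' = Suc c \<or> c = Suc c'"
    by linarith
  moreover have "c \<le> len T" "c' \<le> len T"
    using c(1) c'(1) l by auto
  ultimately have "adj (wlk T c) (wlk T c')"
    using T adj_sym unfolding track_on_def by (metis Suc_le_lessD)
  then show ?thesis
    using c c' unfolding in_sync_def by metis
qed

text \<open>One round: the robber moves, the cops on tracks follow theirs, the free cop
  \<open>k\<close> goes to \<open>f r'\<close> and the others move anyhow. If the robber leaves
  \<open>X\<close>, then \<open>safe\<close> provides a capture at once.\<close>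

lemma robber_loses_step:
  assumes J: "tracks_on X J" and k: "k < 4" "J k = None" and guarding: "guarding J X \<tau> cs r"
    and f: "\<And>r'. r' \<in> X \<Longrightarrow> r' = r \<or> adj r r' \<Longrightarrow> adj (cs k) (f r')"
    and safe: "\<And>r'. adj r r' \<Longrightarrow> r' \<notin> X \<Longrightarrow> \<exists>i<4. cs i = r' \<or> adj (cs i) r'"
    and win: "\<And>r' cs'. r' \<in> X \<Longrightarrow> r' = r \<or> adj r r' \<Longrightarrow> guarding J X (Suc \<tau>) cs' r' \<Longrightarrow> cs' k = f r' \<Longrightarrow> robber_loses cs' r'"
  shows "robber_loses cs r"
  unfolding robber_loses_def
proof (intro disjI2 allI impI)
  fix r' assume r': "r' = r \<or> adj r r'"
  have V: "cs i \<in> V" if "i < 4" for i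
    using guarding that parity_at_V unfolding guarding_def parities_ok_def by blast
  show "cops_win cs r'"
  proof (cases "r' \<in> X")
    case False
    then have "adj r r'" using r' guarding by (auto simp: guarding_def)
    then show ?thesis
      using cops_win_nbr_caught V safe False by blast
  next
    case True
    have "\<exists>v. adj (cs i) v \<and> (i = k \<longrightarrow> v = f r') \<and>
        (\<forall>T. J i = Some T \<longrightarrow> (\<forall>cs'. cs' i = v \<longrightarrow> in_sync (Suc \<tau>) i T cs' r'))" if "i < 4" for i
    proof (cases "J i")
      case None
      then show ?thesis
        using f[OF True r'] nbr[OF V[OF that]] by (cases "i = k") auto
    next
      case (Some T)
      then have "track_on X T" "in_sync \<tau> i T cs r" "r \<in> X"
        using J guarding unfolding tracks_on_def guarding_def by auto
      then show ?thesis
        using in_sync_move[of X T r r' \<tau> i cs] True r' k Some by fastforce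
    qed
    then obtain cs' where cs': "\<And>i. i < 4 \<Longrightarrow> adj (cs i) (cs' i) \<and> (i = k \<longrightarrow> cs' i = f r') \<and>
        (\<forall>T. J i = Some T \<longrightarrow> (\<forall>cs''. cs'' i = cs' i \<longrightarrow> in_sync (Suc \<tau>) i T cs'' r'))"
      by metis
    have "parities_ok (Suc \<tau>) cs'"
      unfolding parities_ok_def
    proof (intro allI impI)
      fix i :: nat assume "i < 4"
      then have "parity_at (cs i) (\<tau> + i)" "adj (cs i) (cs' i)"
        using guarding cs' by (auto simp: guarding_def parities_ok_def)
      then show "parity_at (cs' i) (Suc \<tau> + i)"
        using parity_at_step by fastforce
    qed
    then have "guarding J X (Suc \<tau>) cs' r'"
      using True guarding cs' unfolding guarding_def by blast
    then have "robber_loses cs' r'"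
      using win True r' cs' k by blast
    then show ?thesis
      using cs' by (intro cops_win_step) auto
  qed
qed

text \<open>The free cop \<open>k\<close> walks to the start of the walk and then along it. Cop and level change by at most
  one per turn, so by parity the cop cannot overtake the level without being in sync.\<close>

lemma wins_sync:
  assumes J: "tracks_on X J" and T: "track_on X T" and k: "k < 4" "J k = None"
    and safe: "\<And>\<tau> cs r r'. guarding J X \<tau> cs r \<Longrightarrow> \<not> good r \<Longrightarrow> adj r r' \<Longrightarrow> r' \<notin> X \<Longrightarrow>
      \<exists>i<4. cs i = r' \<or> adj (cs i) r'"
    and good: "\<And>\<tau> cs r. guarding J X \<tau> cs r \<Longrightarrow> good r \<Longrightarrow> robber_loses cs r"
    and win: "wins (J(k \<mapsto> T)) X"
  shows "wins J X"
proof -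
  have synced: "robber_loses cs r" if "guarding J X \<tau> cs r" "in_sync \<tau> k T cs r" for \<tau> cs r
    using that win k unfolding wins_def guarding_def by (metis fun_upd_apply option.inject)
  have step: "robber_loses cs r"
    if "guarding J X \<tau> cs r" "\<not> good r" "\<And>r'. r' \<in> X \<Longrightarrow> r' = r \<or> adj r r' \<Longrightarrow> adj (cs k) (f r')"
      "\<And>r' cs'. r' \<in> X \<Longrightarrow> r' = r \<or> adj r r' \<Longrightarrow> guarding J X (Suc \<tau>) cs' r' \<Longrightarrow> cs' k = f r' \<Longrightarrow> robber_loses cs' r'"
    for f \<tau> cs r
    using robber_loses_step[OF J k that(1), of f] safe that by blast
  have lv: "1 \<le> lev T r" "lev T r \<le> len T" if "r \<in> X" for r
    using T that unfolding track_on_def by blast+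
  have lip: "lev T r' \<le> lev T r + 1" "lev T r \<le> lev T r' + 1" if "r \<in> X" "r' \<in> X" "r' = r \<or> adj r r'" for r r'
    using T that adj_sym unfolding track_on_def by auto
  have wadj: "adj (wlk T c) (wlk T (Suc c))" if "c < len T" for c
    using T that unfolding track_on_def by blast
  \<comment> \<open>The cop is below the level. He climbs every turn, whatever the level does, so
    either he gets in sync or \<open>len T - c\<close> decreases.\<close>
  have low: "robber_loses cs r" if "guarding J X \<tau> cs r" "cs k = wlk T c" "even (c + phase T + \<tau> + k)" "c + 2 \<le> lev T r" for \<tau> cs r c
    using that
  proof (induction "len T - c" arbitrary: c \<tau> cs r rule: less_induct)
    case less
    show ?case
    proof (cases "good r")
      case False
      have rX: "r \<in> X" using less.prems(1) by (simp add: guarding_def)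
      have c: "c < len T" using less.prems(4) lv[OF rX] by linarith
      show ?thesis
      proof (rule step[OF less.prems(1) False, of "\<lambda>_. wlk T (Suc c)"])
        fix r' cs'
        assume r': "r' \<in> X" "r' = r \<or> adj r r'" and i: "guarding J X (Suc \<tau>) cs' r'" and k': "cs' k = wlk T (Suc c)"
        have ev: "even (Suc c + phase T + Suc \<tau> + k)"
          using less.prems by simp
        show "robber_loses cs' r'"
        proof (cases "Suc c + 2 \<le> lev T r'")
          case True
          then show ?thesis
            using less.hyps[of "Suc c" "Suc \<tau>" cs' r'] i k' ev c by (simp add: diff_less_mono2)
        next
          case False
          then have "Suc c = lev T r' \<or> Suc (Suc c) = lev T r'"
            using less.prems(4) False lip[OF rX r'] by linarith
          then have "in_sync (Suc \<tau>) k T cs' r'"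
            unfolding in_sync_def using k' ev by (intro exI[of _ "Suc c"]) simp
          then show ?thesis
            by (rule synced[OF i])
        qed
      qed (simp add: less.prems(2) wadj c)
    qed (rule good[OF less.prems(1)])
  qed
  \<comment> \<open>The mirror image: above the level the cop descends every turn, until he is in
    sync.\<close>
  have high: "robber_loses cs r" if "guarding J X \<tau> cs r" "cs k = wlk T c" "even (c + phase T + \<tau> + k)" "lev T r < c" "c \<le> len T" for \<tau> cs r c
    using that
  proof (induction c arbitrary: \<tau> cs r)
    case (Suc c)
    show ?case
    proof (cases "good r")
      case False
      have rX: "r \<in> X" using Suc.prems(1) by (simp add: guarding_def)
      show ?thesis
      proof (rule step[OF Suc.prems(1) False, of "\<lambda>_. wlk T c"])
        fix r' cs'
        assume r': "r' \<in> X" "r' = r \<or> adj r r'" and i: "guarding J X (Suc \<tau>) cs' r'" and k': "cs' k = wlk T c"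
        have ev: "even (c + phase T + Suc \<tau> + k)"
          using Suc.prems by simp
        show "robber_loses cs' r'"
        proof (cases "lev T r' < c")
          case True
          then show ?thesis
            using Suc.IH[of "Suc \<tau>" cs' r'] i k' ev Suc.prems by simp
        next
          case False
          then have "c = lev T r' \<or> Suc c = lev T r'"
            using Suc.prems(4) False lip[OF rX r'] by linarith
          then have "in_sync (Suc \<tau>) k T cs' r'"
            unfolding in_sync_def using k' ev by (intro exI[of _ "c"]) simp
          then show ?thesis
            by (rule synced[OF i])
        qed
      qed (use Suc.prems(2,5) wadj[of c] in \<open>simp add: adj_commute\<close>)
    qed (rule good[OF Suc.prems(1)])
  qed simp
  \<comment> \<open>On the way to the start of the walk, the number \<open>n\<close> of steps left
    has the parity that makes the cop arrive in phase.\<close>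
  have far: "robber_loses cs r" if "guarding J X \<tau> cs r" "(adj ^^ n) (cs k) (wlk T 0)" "even (n + phase T + \<tau> + k)" for \<tau> cs r n
    using that
  proof (induction n arbitrary: \<tau> cs r)
    case 0
    have rX: "r \<in> X" using 0(1) by (simp add: guarding_def)
    have w: "cs k = wlk T 0" using 0(2) by simp
    show ?case
    proof (cases "lev T r = 1")
      case True
      then have "in_sync \<tau> k T cs r"
        unfolding in_sync_def using w 0(3) by (intro exI[of _ 0]) simp
      then show ?thesis by (rule synced[OF 0(1)])
    next
      case False
      then show ?thesis
        using low[OF 0(1), of 0] w 0(3) lv(1)[OF rX] by simp
    qed
  next
    case (Suc n)
    obtain y where y: "adj (cs k) y" "(adj ^^ n) y (wlk T 0)"
      using Suc.prems(2) by (rule relpowp_Suc_E2)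
    show ?case
    proof (cases "good r")
      case False
      show ?thesis
      proof (rule step[OF Suc.prems(1) False, of "\<lambda>_. y"])
        fix r' cs' assume "guarding J X (Suc \<tau>) cs' r'" "cs' k = y"
        then show "robber_loses cs' r'"
          using Suc.IH[of "Suc \<tau>" cs' r'] y(2) Suc.prems(3) by simp
      qed (use y(1) in simp)
    qed (rule good[OF Suc.prems(1)])
  qed
  show ?thesis
    unfolding wins_def
  proof (intro allI impI)
    fix \<tau> cs r assume i: "guarding J X \<tau> cs r"
    then have "parity_at (cs k) (\<tau> + k)"
      using k(1) by (simp add: guarding_def parities_ok_def)
    then obtain a where a: "(adj ^^ a) x0 (cs k)" "even (a + (\<tau> + k))"
      unfolding parity_at_def by blast
    have "parity_at (wlk T 0) (phase T)"
      using T by (simp add: track_on_def)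
    then obtain b where b: "(adj ^^ b) x0 (wlk T 0)" "even (b + phase T)"
      unfolding parity_at_def by blast
    \<comment> \<open>The way leads back to \<open>x0\<close> and from there to the start of the
      walk; the parities of both legs are known.\<close>
    have "(adj ^^ (a + b)) (cs k) (wlk T 0)"
      using relpowp_sym[OF a(1)] b(1) by (rule relpowp_trans)
    moreover have "even ((a + b) + phase T + \<tau> + k)"
      using a(2) b(2) by (auto simp: even_add)
    ultimately show "robber_loses cs r"
      using far[OF i] by blast
  qed
qed

lemma wins_sync_safe:
  assumes "tracks_on X J" "track_on X T" "k < 4" "J k = None"
    and "\<And>\<tau> cs r r'. guarding J X \<tau> cs r \<Longrightarrow> adj r r' \<Longrightarrow> r' \<notin> X \<Longrightarrow> \<exists>i<4. cs i = r' \<or> adj (cs i) r'"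
    and "wins (J(k \<mapsto> T)) X"
  shows "wins J X"
  using wins_sync[OF assms(1-4), of "\<lambda>_. False"] assms(5,6) by blast

lemma wins_weaken:
  assumes "wins J X" "J \<subseteq>\<^sub>m J'"
  shows "wins J' X"
  using assms unfolding wins_def guarding_def map_le_def by (metis domI)

lemma robber_loses_restrict:
  assumes "guarding J' X' \<tau> cs r" "r \<in> X" "wins J X" "J \<subseteq>\<^sub>m J'"
  shows "robber_loses cs r"
  using wins_weaken[OF assms(3,4)] assms(1,2) unfolding wins_def guarding_def by blast

lemma robber_loses_caught: "i < 4 \<Longrightarrow> cs i = r \<Longrightarrow> robber_loses cs r"
  unfolding robber_loses_def by blast

text \<open>Both cops obey the same levels and phase, so the odd sum of their numbers forces
  different positions. The walks may differ: with one cop on a path and the other on a tie, the two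
  still act as a pair.\<close>

lemma pair_pos:
  assumes "guarding J X \<tau> cs r" "J i = Some T" "J j = Some T'" "odd (i + j)" "lev T' = lev T" "phase T' = phase T"
  shows "i < 4" "j < 4"
    "cs i = wlk T (lev T r) \<and> cs j = wlk T' (lev T r - 1) \<or> cs i = wlk T (lev T r - 1) \<and> cs j = wlk T' (lev T r)"
proof -
  show ij: "i < 4" "j < 4" using assms unfolding guarding_def by blast+
  obtain c d where c: "c = lev T r \<or> Suc c = lev T r" "cs i = wlk T c" "even (c + phase T + \<tau> + i)"
    and d: "d = lev T r \<or> Suc d = lev T r" "cs j = wlk T' d" "even (d + phase T + \<tau> + j)"
    using assms unfolding guarding_def in_sync_def by metis
  have "odd (c + d)" using c(3) d(3) assms(4) by (auto simp: even_add)
  then have "c \<noteq> d" by auto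
  then have "c = lev T r \<and> d = lev T r - 1 \<or> c = lev T r - 1 \<and> d = lev T r"
    using c(1) d(1) by linarith
  then show "cs i = wlk T (lev T r) \<and> cs j = wlk T' (lev T r - 1) \<or> cs i = wlk T (lev T r - 1) \<and> cs j = wlk T' (lev T r)"
    using c d by auto
qed

text \<open>With \<open>c\<close> equal to \<open>lev T r\<close> or \<open>lev T r - 1\<close>, a
  cop at either of these positions is on \<open>c\<close> or next to it on the walk, whichever the
  parity imposes.\<close>

lemma strict_caught:
  assumes "guarding J X \<tau> cs r" "J i = Some T" "track_on X T" "lev T r = c \<or> lev T r = Suc c" "c \<le> len T"
  shows "\<exists>i<4. cs i = wlk T c \<or> adj (cs i) (wlk T c)"
proof -
  have r: "r \<in> X" "i < 4" using assms unfolding guarding_def by auto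
  obtain d where d: "d = lev T r \<or> Suc d = lev T r" "cs i = wlk T d"
    using assms unfolding guarding_def in_sync_def by metis
  have a: "adj (wlk T c) (wlk T (Suc c))" if "c < len T" for c
    using assms(3) that unfolding track_on_def by blast
  have l: "lev T r \<le> len T"
    using assms(3) r unfolding track_on_def by blast
  consider "d = c" | "d = Suc c" "c < len T" | "Suc d = c" "d < len T"
    using d(1) assms(4,5) l by linarith
  then have "wlk T d = wlk T c \<or> adj (wlk T d) (wlk T c)"
  proof cases
    case 2
    then show ?thesis using a[of c] by (simp add: adj_commute)
  next
    case 3
    then show ?thesis using a[of d] by auto
  qed simp
  then show ?thesis
    using d(2) r(2) by (intro exI[of _ i]) auto
qed

end

text \<open>Each winning position has a \<open>rank\<close>, the least number of rounds in which
  capture can be forced, and \<open>nxt\<close> picks a move after which every reply has smaller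
  rank. The strategy \<open>\<sigma>\<close> replays the history of the robber with
  \<open>nxt\<close>.\<close>

lemma active_cops_win_if_cops_win:
  fixes G :: "'a pair_pre_digraph"
  assumes "cop_game (pverts G) (\<lambda>u v. (u, v) \<in> parcs G) x0"
    and cs0: "\<And>i. i < 4 \<Longrightarrow> cs0 i \<in> pverts G"
    and cops_win: "\<And>r. r \<in> pverts G \<Longrightarrow> cop_game.cops_win (\<lambda>u v. (u, v) \<in> parcs G) cs0 r"
  shows "active_cops_win G 4"
proof -
  interpret cop_game "pverts G" "\<lambda>u v. (u, v) \<in> parcs G" x0 by fact
  define good where "good n cs r cs' \<longleftrightarrow> (\<forall>i<4. (cs i, cs' i) \<in> parcs G) \<and>
      ((\<exists>i<4. cs' i = r) \<or> (\<forall>r'. r' = r \<or> (r, r') \<in> parcs G \<longrightarrow> cops_win_in (n - 1) cs' r'))" for n cs r cs'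
  define rank where "rank cs r = (LEAST n. cops_win_in n cs r)" for cs r
  define nxt where "nxt cs r = (SOME cs'. good (rank cs r) cs r cs')" for cs r
  define \<sigma> where "\<sigma> hist = foldl nxt cs0 hist" for hist
  have cops_win_in_rank: "cops_win_in (rank cs r) cs r" if "cops_win cs r" for cs r
    using that LeastI_ex unfolding cops_win_def rank_def by fast
  have good: "good (rank cs r) cs r (nxt cs r) \<and> 0 < rank cs r" if "cops_win cs r" "\<not> (\<exists>i<4. cs i = r)" for cs r
  proof -
    have 0: "0 < rank cs r"
      using cops_win_in_rank[OF that(1)] that(2) by (cases "rank cs r") auto
    then obtain m where m: "rank cs r = Suc m" by (cases "rank cs r") auto
    have "\<exists>cs'. good (rank cs r) cs r cs'"
      using cops_win_in_rank[OF that(1)] that(2) unfolding m cops_win_in.simps good_def by auto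
    then have "good (rank cs r) cs r (nxt cs r)"
      unfolding nxt_def by (rule someI_ex)
    then show ?thesis
      using 0 by simp
  qed
  have at_Suc: "cops_at \<sigma> \<rho> (Suc n) = nxt (cops_at \<sigma> \<rho> n) (\<rho> n)" for \<rho> n
    by (simp add: cops_at_def \<sigma>_def)
  have at_0: "cops_at \<sigma> \<rho> 0 = cs0" for \<rho>
    by (simp add: cops_at_def \<sigma>_def)
  \<comment> \<open>Rank plus rounds played never increases, so no play without capture outlasts the
    initial rank.\<close>
  have main: "cops_win (cops_at \<sigma> \<rho> n) (\<rho> n) \<and> rank (cops_at \<sigma> \<rho> n) (\<rho> n) + n \<le> rank cs0 (\<rho> 0)"
    if \<rho>: "robber_trajectory G \<rho>" and "\<not> captured_by 4 \<sigma> \<rho> n" for \<rho> n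
    using that(2)
  proof (induction n)
    case 0
    then show ?case
      using \<rho> cops_win by (simp add: at_0 robber_trajectory_def)
  next
    case (Suc n)
    have nc: "\<not> captured_by 4 \<sigma> \<rho> n" "\<not> (\<exists>i<4. cops_at \<sigma> \<rho> n i = \<rho> n)" "\<not> (\<exists>i<4. cops_at \<sigma> \<rho> (Suc n) i = \<rho> n)"
      using Suc.prems unfolding captured_by_def by (auto simp: le_Suc_eq less_Suc_eq)
    let ?cs = "cops_at \<sigma> \<rho> n"
    have IH: "cops_win ?cs (\<rho> n)" "rank ?cs (\<rho> n) + n \<le> rank cs0 (\<rho> 0)"
      using Suc.IH nc(1) by auto
    have g: "good (rank ?cs (\<rho> n)) ?cs (\<rho> n) (cops_at \<sigma> \<rho> (Suc n))" "0 < rank ?cs (\<rho> n)"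
      using good[OF IH(1) nc(2)] at_Suc by auto
    have "\<rho> (Suc n) = \<rho> n \<or> (\<rho> n, \<rho> (Suc n)) \<in> parcs G"
      using \<rho> unfolding robber_trajectory_def by blast
    then have w: "cops_win_in (rank ?cs (\<rho> n) - 1) (cops_at \<sigma> \<rho> (Suc n)) (\<rho> (Suc n))"
      using g nc(3) unfolding good_def by blast
    then have "rank (cops_at \<sigma> \<rho> (Suc n)) (\<rho> (Suc n)) \<le> rank ?cs (\<rho> n) - 1"
      unfolding rank_def by (rule Least_le)
    then show ?case
      using w g IH unfolding cops_win_def by auto
  qed
  have "winning_cop_strategy G 4 \<sigma>"
    unfolding winning_cop_strategy_def
  proof (intro conjI allI impI)
    show "\<sigma> [] i \<in> pverts G" if "i < 4" for i
      using cs0 that by (simp add: \<sigma>_def)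
  next
    fix \<rho> n i assume \<rho>: "robber_trajectory G \<rho>" and nc: "\<not> captured_by 4 \<sigma> \<rho> n" and i: "i < (4::nat)"
    have "\<not> (\<exists>i<4. cops_at \<sigma> \<rho> n i = \<rho> n)"
      using nc unfolding captured_by_def by auto
    then show "(cops_at \<sigma> \<rho> n i, cops_at \<sigma> \<rho> (Suc n) i) \<in> parcs G"
      using good main[OF \<rho> nc] i unfolding at_Suc good_def by blast
  next
    fix \<rho> assume \<rho>: "robber_trajectory G \<rho>"
    show "\<exists>n. captured_by 4 \<sigma> \<rho> n"
    proof (rule ccontr)
      assume "\<not> ?thesis"
      then show False
        using main[OF \<rho>, of "Suc (rank cs0 (\<rho> 0))"] by auto
    qed
  qed
  then show ?thesis
    unfolding active_cops_win_def by blast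
qed

section \<open>Guarded territories\<close>

context cop_game
begin

definition seg :: "'a track \<Rightarrow> nat \<Rightarrow> nat \<Rightarrow> 'a set" where
  "seg T a b = wlk T ` {a..b}"

definition is_seg :: "'a track \<Rightarrow> nat \<Rightarrow> nat \<Rightarrow> bool" where
  "is_seg T a b \<longleftrightarrow> a < b \<and> b \<le> len T \<and> inj_on (wlk T) {a..b}"

definition bigon :: "'a track \<Rightarrow> nat \<Rightarrow> nat \<Rightarrow> 'a track \<Rightarrow> nat \<Rightarrow> nat \<Rightarrow> bool" where
  "bigon T a b S c d \<longleftrightarrow> is_seg T a b \<and> is_seg S c d \<and> wlk T a = wlk S c \<and> wlk T b = wlk S d \<and>
     (\<forall>i\<in>{a..b}. \<forall>j\<in>{c..d}. wlk T i = wlk S j \<longrightarrow> i = a \<and> j = c \<or> i = b \<and> j = d)"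

definition territory :: "'a set \<Rightarrow> 'a set \<Rightarrow> bool" where
  "territory R B \<longleftrightarrow> R \<subseteq> V \<and> con R \<and> R \<inter> B = {} \<and> (\<forall>r\<in>R. \<forall>x. adj r x \<longrightarrow> x \<notin> R \<longrightarrow> x \<in> B)"

text \<open>One cop guards a strict segment. A weak segment takes a pair of cops of opposite parity, one of whom
  is at \<open>lev r\<close> and the other at \<open>lev r - 1\<close>.\<close>

definition strict_on :: "'a set \<Rightarrow> 'a track \<Rightarrow> nat \<Rightarrow> nat \<Rightarrow> bool" where
  "strict_on R T a b \<longleftrightarrow> (\<forall>r\<in>R. \<forall>c\<in>{a..b}. adj r (wlk T c) \<longrightarrow> lev T r = c \<or> lev T r = Suc c)"

definition weak_on :: "'a set \<Rightarrow> 'a track \<Rightarrow> nat \<Rightarrow> nat \<Rightarrow> bool" where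
  "weak_on R T a b \<longleftrightarrow> (\<forall>r\<in>R. \<forall>c\<in>{a..b}. adj r (wlk T c) \<longrightarrow> lev T r \<le> c + 1 \<and> c \<le> lev T r + 1)"

text \<open>Below the cap \<open>len T\<close>, every level is explained by a step down, to a vertex
  of \<open>R\<close> one level lower or to a vertex of the segment itself. Tracing such steps is
  how ties are found.\<close>

definition desc_on :: "'a set \<Rightarrow> 'a track \<Rightarrow> nat \<Rightarrow> nat \<Rightarrow> bool" where
  "desc_on R T a b \<longleftrightarrow> (\<forall>r\<in>R. lev T r < len T \<longrightarrow>
     (\<exists>r'\<in>R. adj r r' \<and> lev T r = Suc (lev T r')) \<or> (\<exists>c\<in>{a..b}. adj r (wlk T c) \<and> lev T r = Suc c))"

definition region :: "'a set \<Rightarrow> 'a track \<Rightarrow> nat \<Rightarrow> nat \<Rightarrow> 'a track \<Rightarrow> nat \<Rightarrow> nat \<Rightarrow> bool" where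
  "region R T a b S c d \<longleftrightarrow> territory R (seg T a b \<union> seg S c d) \<and> bigon T a b S c d \<and> track_on R T \<and> track_on R S"

definition winA :: "'a set \<Rightarrow> bool" where
  "winA R \<longleftrightarrow> (\<forall>T a b S c d i j. region R T a b S c d \<longrightarrow> strict_on R T a b \<longrightarrow> strict_on R S c d \<longrightarrow>
     i < 4 \<longrightarrow> j < 4 \<longrightarrow> i \<noteq> j \<longrightarrow> wins [i \<mapsto> T, j \<mapsto> S] R)"

definition winB :: "'a set \<Rightarrow> bool" where
  "winB R \<longleftrightarrow> (\<forall>T a b S c d i j k. region R T a b S c d \<longrightarrow> strict_on R T a b \<longrightarrow> weak_on R S c d \<longrightarrow> desc_on R S c d \<longrightarrow>
     i < 4 \<longrightarrow> j < 4 \<longrightarrow> k < 4 \<longrightarrow> distinct [i, j, k] \<longrightarrow> odd (j + k) \<longrightarrow> wins [i \<mapsto> T, j \<mapsto> S, k \<mapsto> S] R)"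

text \<open>The level is constantly 1, so the cop alternates between the two ends;
  \<open>\<kappa>\<close> is the parity class of \<open>x\<close>.\<close>

definition edge_track :: "'a \<Rightarrow> 'a \<Rightarrow> nat \<Rightarrow> 'a track" where
  "edge_track x y \<kappa> = \<lparr>wlk = (\<lambda>c. if c = 0 then x else y), len = 1, lev = (\<lambda>_. 1), phase = \<kappa>\<rparr>"

definition winE :: "'a set \<Rightarrow> bool" where
  "winE R \<longleftrightarrow> (\<forall>x y \<kappa> i. territory R {x, y} \<longrightarrow> adj x y \<longrightarrow> parity_at x \<kappa> \<longrightarrow> i < 4 \<longrightarrow> wins [i \<mapsto> edge_track x y \<kappa>] R)"

lemma strict_on_mono: "strict_on R T a b \<Longrightarrow> R' \<subseteq> R \<Longrightarrow> a \<le> a' \<Longrightarrow> b' \<le> b \<Longrightarrow> strict_on R' T a' b'"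
  unfolding strict_on_def by (meson atLeastAtMost_iff order_trans subsetD)

lemma strict_safe:
  assumes "guarding J X \<tau> cs r" "J i = Some T" "track_on X T" "strict_on X T a b" "b \<le> len T" "adj r x" "x \<in> seg T a b"
  shows "\<exists>i<4. cs i = x \<or> adj (cs i) x"
proof -
  obtain c where c: "c \<in> {a..b}" "x = wlk T c" using assms(7) unfolding seg_def by blast
  have "r \<in> X" using assms(1) by (simp add: guarding_def)
  then have "lev T r = c \<or> lev T r = Suc c"
    using assms(4,6) c unfolding strict_on_def by blast
  then show ?thesis
    using strict_caught[OF assms(1,2,3), of c] c assms(5) by simp
qed

lemma weak_safe:
  assumes "guarding J X \<tau> cs r" "J i = Some T" "J j = Some T" "odd (i + j)" "track_on X T"
    "lev T r \<le> c + 1" "c \<le> lev T r + 1" "c \<le> len T"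
  shows "\<exists>i<4. cs i = wlk T c \<or> adj (cs i) (wlk T c)"
proof -
  have r: "r \<in> X" using assms(1) by (simp add: guarding_def)
  have l: "1 \<le> lev T r" "lev T r \<le> len T"
    using assms(5) r unfolding track_on_def by blast+
  have a: "adj (wlk T c) (wlk T (Suc c))" if "c < len T" for c
    using assms(5) that unfolding track_on_def by blast
  note p = pair_pos[OF assms(1-4) refl refl]
  consider "c = lev T r" | "c = lev T r - 1" | "c = Suc (lev T r)"
    using assms(6,7) l by linarith
  then show ?thesis
  proof cases
    case 3
    then have "adj (wlk T (lev T r)) (wlk T c)"
      using a[of "lev T r"] assms(8) by simp
    then show ?thesis using p by metis
  qed (use p in metis)+
qed

text \<open>One of the two is always at position \<open>lev T r\<close>, so the robber cannot
  survive on a paired path where level and position agree.\<close>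

lemma pair_on_path:
  assumes "guarding J X \<tau> cs r" "J i = Some T" "J j = Some T" "odd (i + j)" "wlk T (lev T r) = r"
  shows "robber_loses cs r"
  using pair_pos[OF assms(1-4) refl refl] assms(5) robber_loses_caught by metis

lemma exists_spare: "i < 4 \<Longrightarrow> \<exists>k<4. k \<noteq> (i::nat)"
  by (intro exI[of _ "if i = 0 then 1 else 0"]) auto

lemma track_on_edge: "adj x y \<Longrightarrow> parity_at x \<kappa> \<Longrightarrow> track_on X (edge_track x y \<kappa>)"
  unfolding track_on_def edge_track_def by simp

lemma seg_edge: "seg (edge_track x y \<kappa>) 0 1 = {x, y}"
proof -
  have "{0..1} = {0, 1::nat}" by auto
  then show ?thesis
    unfolding seg_def edge_track_def by auto
qed

lemma strict_on_edge: "strict_on X (edge_track x y \<kappa>) 0 1"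
  unfolding strict_on_def edge_track_def by auto

lemma territory_comp:
  assumes "territory R B" "M \<subseteq> R" "r \<in> R - M"
  shows "territory (comp_of (R - M) r) (B \<union> M)" "comp_of (R - M) r \<subseteq> R" "r \<in> comp_of (R - M) r"
proof -
  have s: "comp_of (R - M) r \<subseteq> R - M"
    using assms(3) by (rule comp_sub)
  then show "comp_of (R - M) r \<subseteq> R" by auto
  have "x \<in> B \<union> M" if "y \<in> comp_of (R - M) r" "adj y x" "x \<notin> comp_of (R - M) r" for x y
  proof (cases "x \<in> R")
    case True
    then show ?thesis
      using comp_closed[OF assms(3) that(1,2)] that(3) by blast
  next
    case False
    then show ?thesis
      using that s assms(1) unfolding territory_def by blast
  qed
  then show "territory (comp_of (R - M) r) (B \<union> M)"
    using con_comp[OF assms(3)] s assms(1) unfolding territory_def by blast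
qed simp

lemma territory_cong:
  assumes "territory R B" "\<And>r x. r \<in> R \<Longrightarrow> adj r x \<Longrightarrow> x \<in> B \<Longrightarrow> x \<in> B'" "R \<inter> B' = {}"
  shows "territory R B'"
  using assms unfolding territory_def by blast

text \<open>The cop alternates between the only exit \<open>q\<close> and a neighbour
  \<open>r0\<close> inside. Away from \<open>r0\<close> the robber sits in a component bounded by
  this edge, a smaller state E. At \<open>r0\<close> he is met by the cop, or the cop is at
  \<open>q\<close>, closing the exit, and will step onto \<open>r0\<close> next.\<close>

lemma edge_shrink:
  assumes E: "\<And>R'. R' \<subset> R \<Longrightarrow> winE R'"
    and R: "territory R {q}" and r0: "r0 \<in> R" "adj q r0" and \<kappa>: "parity_at q \<kappa>" and k: "k < 4"
  shows "wins [k \<mapsto> edge_track q r0 \<kappa>] R"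
proof -
  let ?T = "edge_track q r0 \<kappa>" and ?J = "[k \<mapsto> edge_track q r0 \<kappa>]"
  have T: "track_on R ?T" using r0 \<kappa> by (intro track_on_edge)
  have q: "q \<notin> R" using R unfolding territory_def by blast
  have away: "robber_loses cs r" if i: "guarding ?J R \<tau> cs r" and "r \<noteq> r0" for \<tau> cs r
  proof -
    have r: "r \<in> R - {r0}" using that by (simp add: guarding_def)
    have "{r0} \<subseteq> R" using r0 by simp
    note t = territory_comp[OF R this r]
    have "territory (comp_of (R - {r0}) r) {q, r0}"
      using t(1) r0 by (simp add: insert_commute)
    moreover have "comp_of (R - {r0}) r \<subset> R"
      using comp_sub[OF r] r0 by blast
    ultimately have "wins ?J (comp_of (R - {r0}) r)"
      using E r0 \<kappa> k unfolding winE_def by blast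
    then show ?thesis
      by (rule robber_loses_restrict[OF i t(3) _ map_le_refl])
  qed
  have "robber_loses cs r" if i: "guarding ?J R \<tau> cs r" for \<tau> cs r
  proof (cases "r = r0")
    case True
    have s: "in_sync \<tau> k ?T cs r" using i by (simp add: guarding_def)
    show ?thesis
    proof (cases "cs k = r0")
      case False
      then have ev: "even (\<kappa> + \<tau> + k)"
        using s unfolding in_sync_def edge_track_def by (auto split: if_splits)
      \<comment> \<open>Only cop \<open>k\<close> has a task; any other cop can play the free cop of
        the round, with any move.\<close>
      obtain k' where k': "k' < 4" "k' \<noteq> k" using exists_spare[OF k] by blast
      have "cs k' \<in> V"
        using i k'(1) parity_at_V unfolding guarding_def parities_ok_def by blast
      then obtain u where u: "adj (cs k') u" using nbr by blast
      show ?thesis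
      proof (rule robber_loses_step[OF _ k'(1) _ i, of "\<lambda>_. u"])
        show "tracks_on R ?J" using T k by (simp add: tracks_on_def)
        show "?J k' = None" using k' by simp
        show "\<exists>i<4. cs i = r' \<or> adj (cs i) r'" if "adj r r'" "r' \<notin> R" for r'
        proof -
          have "r' = q" using R that True r0(1) unfolding territory_def by blast
          moreover have "cs k = q"
            using s False unfolding in_sync_def edge_track_def by (auto split: if_splits)
          ultimately show ?thesis using k by blast
        qed
        fix r' cs' assume i': "guarding ?J R (Suc \<tau>) cs' r'"
        show "robber_loses cs' r'"
        proof (cases "r' = r0")
          case True
          have "in_sync (Suc \<tau>) k ?T cs' r'" using i' by (simp add: guarding_def)
          then have "cs' k = r0"
            using ev unfolding in_sync_def edge_track_def by (auto split: if_splits)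
          then show ?thesis using True k robber_loses_caught by blast
        qed (use away i' in blast)
      qed (use u in simp)
    qed (use True k robber_loses_caught in blast)
  qed (use away i in blast)
  then show ?thesis
    unfolding wins_def by blast
qed

section \<open>Walks through a territory and the levels of a shortest path\<close>

definition rwalk :: "'a set \<Rightarrow> 'a \<Rightarrow> 'a \<Rightarrow> nat \<Rightarrow> bool" where
  "rwalk R p q m \<longleftrightarrow> (\<exists>z. z 0 = p \<and> z m = q \<and> (\<forall>c<m. adj (z c) (z (Suc c))) \<and> (\<forall>c. 0 < c \<longrightarrow> c < m \<longrightarrow> z c \<in> R))"

lemma rwalk_0 [simp]: "rwalk R p q 0 \<longleftrightarrow> p = q"
  unfolding rwalk_def by auto

lemma rwalk_1: "rwalk R p q (Suc 0) \<longleftrightarrow> adj p q"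
proof
  assume "adj p q"
  then show "rwalk R p q (Suc 0)"
    unfolding rwalk_def by (intro exI[of _ "\<lambda>c. if c = 0 then p else q"]) auto
qed (auto simp: rwalk_def)

lemma rwalk_sym:
  assumes "rwalk R p q m"
  shows "rwalk R q p m"
proof -
  obtain z where z: "z 0 = p" "z m = q" "\<forall>c<m. adj (z c) (z (Suc c))" "\<forall>c. 0 < c \<longrightarrow> c < m \<longrightarrow> z c \<in> R"
    using assms unfolding rwalk_def by blast
  have "adj (z (m - c)) (z (m - Suc c))" if "c < m" for c
    using z(3)[rule_format, of "m - Suc c"] that adj_sym by (simp add: Suc_diff_Suc)
  then show ?thesis
    unfolding rwalk_def using z by (intro exI[of _ "\<lambda>c. z (m - c)"]) auto
qed

lemma rwalk_trans:
  assumes "rwalk R p r m" "rwalk R r q n" "r \<in> R"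
  shows "rwalk R p q (m + n)"
proof -
  obtain y where y: "y 0 = p" "y m = r" "\<forall>c<m. adj (y c) (y (Suc c))" "\<forall>c. 0 < c \<longrightarrow> c < m \<longrightarrow> y c \<in> R"
    using assms(1) unfolding rwalk_def by blast
  obtain z where z: "z 0 = r" "z n = q" "\<forall>c<n. adj (z c) (z (Suc c))" "\<forall>c. 0 < c \<longrightarrow> c < n \<longrightarrow> z c \<in> R"
    using assms(2) unfolding rwalk_def by blast
  let ?x = "\<lambda>c. if c \<le> m then y c else z (c - m)"
  have "adj (?x c) (?x (Suc c))" if "c < m + n" for c
  proof -
    consider "c < m" | "c = m" | "m < c" by linarith
    then show ?thesis
    proof cases
      case 2
      then show ?thesis using z(1) y(2) z(3)[rule_format, of 0] that by simp
    next
      case 3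
      then show ?thesis using z(3)[rule_format, of "c - m"] that by (simp add: Suc_diff_le)
    qed (use y in auto)
  qed
  moreover have "?x c \<in> R" if "0 < c" "c < m + n" for c
    using that y(2,4) z(4)[rule_format, of "c - m"] assms(3) by (cases "c = m") auto
  ultimately show ?thesis
    unfolding rwalk_def using y(1,2) z(1,2) by (intro exI[of _ ?x]) auto
qed

lemma rwalk_sub:
  assumes "\<And>c. a \<le> c \<Longrightarrow> c < b \<Longrightarrow> adj (z c) (z (Suc c))" "\<And>c. a < c \<Longrightarrow> c < b \<Longrightarrow> z c \<in> R" "a \<le> b"
  shows "rwalk R (z a) (z b) (b - a)"
  unfolding rwalk_def using assms by (intro exI[of _ "\<lambda>c. z (a + c)"]) auto

lemma rwalk_pos: "rwalk R p q m \<Longrightarrow> p \<noteq> q \<Longrightarrow> 1 \<le> m"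
  by (cases m) auto

lemma con_rwalk:
  assumes "con R" "x \<in> R" "y \<in> R"
  shows "\<exists>m. rwalk R x y m"
proof -
  have "reach R x y" using assms by (simp add: con_def)
  then show ?thesis
    unfolding reach_def
  proof (induction rule: rtranclp_induct)
    case (step y z)
    then obtain m where "rwalk R x y m" by blast
    then have "rwalk R x z (m + Suc 0)"
      using step.hyps(2) by (intro rwalk_trans[of R x y]) (auto simp: rwalk_1)
    then show ?case by blast
  qed (auto intro: exI[of _ 0])
qed

lemma rwalk_split:
  assumes "rwalk R p q (Suc m)"
  obtains x where "adj p x" "rwalk R x q m" "m = 0 \<or> x \<in> R"
proof -
  obtain z where z: "z 0 = p" "z (Suc m) = q" "\<forall>c<Suc m. adj (z c) (z (Suc c))" "\<forall>c. 0 < c \<longrightarrow> c < Suc m \<longrightarrow> z c \<in> R"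
    using assms unfolding rwalk_def by blast
  have "rwalk R (z 1) (z (Suc m)) (Suc m - 1)"
    using z by (intro rwalk_sub) auto
  then show thesis
    using z that[of "z 1"] by (cases "m = 0") auto
qed

text \<open>The levels are the largest 1-Lipschitz extension of the positions on \<open>w\<close> (McShane), cut off at \<open>N\<close>.\<close>

lemma canonical_track:
  fixes w :: "nat \<Rightarrow> 'a"
  assumes N: "1 \<le> N" and w: "\<And>c. c < N \<Longrightarrow> adj (w c) (w (Suc c))" and \<kappa>: "parity_at (w 0) \<kappa>" and w0: "w 0 \<notin> R"
    and geo: "\<And>r x y d d'. r \<in> R \<Longrightarrow> x \<le> N \<Longrightarrow> y \<le> N \<Longrightarrow> rwalk R r (w x) d \<Longrightarrow> rwalk R r (w y) d' \<Longrightarrow> y \<le> x + d + d'"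
  obtains T where "wlk T = w" "len T = N" "track_on R T"
    "\<And>r c. r \<in> R \<Longrightarrow> c \<le> N \<Longrightarrow> adj r (w c) \<Longrightarrow> lev T r \<le> c + 1 \<and> c \<le> lev T r + 1"
    "\<And>c. c \<le> N \<Longrightarrow> w c \<in> R \<Longrightarrow> lev T (w c) = c"
    "desc_on R T 0 N"
proof -
  define P where "P r s \<longleftrightarrow> s = N \<or> (\<exists>x d. x \<le> N \<and> rwalk R r (w x) d \<and> s = x + d)" for r s
  define g where "g r = (LEAST s. P r s)" for r
  have Pg: "P r (g r)" for r
    unfolding g_def by (rule LeastI[of _ N]) (simp add: P_def)
  have gle: "P r s \<Longrightarrow> g r \<le> s" for r s
    unfolding g_def by (rule Least_le)
  have gN: "g r \<le> N" for r
    by (rule gle) (simp add: P_def)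
  have up: "g r \<le> x + d" if "x \<le> N" "rwalk R r (w x) d" for r x d
    using that by (intro gle) (auto simp: P_def)
  \<comment> \<open>Here it matters that \<open>w\<close> has no shortcut through \<open>R\<close>:
    \<open>geo\<close> compares the walk that realises \<open>g r\<close> with any other walk from
    \<open>r\<close> to \<open>w\<close>.\<close>
  have dn: "x \<le> g r + d" if "r \<in> R" "x \<le> N" "rwalk R r (w x) d" for r x d
    using Pg[of r] geo[OF that(1) _ that(2) _ that(3)] that(2) unfolding P_def by auto
  \<comment> \<open>Value 0 would put \<open>r\<close> on \<open>w 0\<close>, which is outside
    \<open>R\<close>. A level of at least 1 makes \<open>lev r - 1\<close> a position.\<close>
  have g1: "1 \<le> g r" if "r \<in> R" for r
  proof (rule ccontr)
    assume "\<not> ?thesis"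
    then have "g r = 0" by simp
    then have "P r 0" using Pg[of r] by simp
    then show False using N that w0 unfolding P_def by auto
  qed
  have lip: "g r' \<le> g r + 1" if "r \<in> R" "r' \<in> R" "adj r r'" for r r'
  proof (cases "g r = N")
    case False
    then obtain x d where x: "x \<le> N" "rwalk R r (w x) d" "g r = x + d"
      using Pg[of r] unfolding P_def by auto
    have "rwalk R r' (w x) (Suc 0 + d)"
      using that x by (intro rwalk_trans[of R r' r]) (auto simp: rwalk_1 adj_commute)
    then show ?thesis using up[OF x(1)] x(3) by fastforce
  qed (use gN[of r'] in simp)
  define T where "T = \<lparr>wlk = w, len = N, lev = g, phase = \<kappa>\<rparr>"
  \<comment> \<open>The first step of a walk that realises the minimum goes down one level; if
    \<open>r\<close> lies on \<open>w\<close> itself, the step back along \<open>w\<close>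
    does.\<close>
  have desc: "(\<exists>r'\<in>R. adj r r' \<and> g r = Suc (g r')) \<or> (\<exists>c\<in>{0..N}. adj r (w c) \<and> g r = Suc c)"
    if r: "r \<in> R" "g r < N" for r
  proof -
    obtain x d where x: "x \<le> N" "rwalk R r (w x) d" "g r = x + d"
      using Pg[of r] r unfolding P_def by auto
    show ?thesis
    proof (cases d)
      case 0
      then have "r = w x" "g r = x" using x by auto
      then obtain c where c: "x = Suc c" using g1[OF r(1)] by (cases x) auto
      then have "adj r (w c)" using w[of c] x(1) \<open>r = w x\<close> by (simp add: adj_commute)
      then show ?thesis using c \<open>g r = x\<close> x(1) by auto
    next
      case (Suc m)
      obtain y where y: "adj r y" "rwalk R y (w x) m" "m = 0 \<or> y \<in> R"
        using rwalk_split x(2) Suc by metis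
      show ?thesis
      proof (cases "y \<in> R")
        case True
        have "g y \<le> x + m" using up[OF x(1) y(2)] .
        then have "g r = Suc (g y)" using lip[OF True r(1)] y(1) x(3) Suc by (simp add: adj_commute)
        then show ?thesis using True y(1) by blast
      next
        case False
        then have "m = 0" "y = w x" using y by auto
        then show ?thesis using y(1) x Suc by auto
      qed
    qed
  qed
  show thesis
  proof (rule that[of T])
    show "track_on R T"
      unfolding track_on_def T_def using N w \<kappa> g1 gN lip by simp
    show "lev T r \<le> c + 1 \<and> c \<le> lev T r + 1" if "r \<in> R" "c \<le> N" "adj r (w c)" for r c
      using up[of c r "Suc 0"] dn[of r c "Suc 0"] that by (simp add: T_def rwalk_1)
    show "lev T (w c) = c" if "c \<le> N" "w c \<in> R" for c
      using up[of c "w c" 0] dn[of "w c" c 0] that by (simp add: T_def)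
    show "desc_on R T 0 N"
      unfolding desc_on_def T_def using desc by simp
  qed (simp_all add: T_def)
qed

lemma wins_add:
  assumes "tracks_on X J" "track_on X T" "k < 4" "J k = None"
    and "\<And>\<tau> cs r r'. guarding J X \<tau> cs r \<Longrightarrow> adj r r' \<Longrightarrow> r' \<notin> X \<Longrightarrow> \<exists>i<4. cs i = r' \<or> adj (cs i) r'"
    and "wins J' X" "J' \<subseteq>\<^sub>m J(k \<mapsto> T)"
  shows "wins J X"
  by (rule wins_sync_safe[OF assms(1-5) wins_weaken[OF assms(6,7)]])

text \<open>Once the pair patrols a shortest path \<open>w\<close> through \<open>R\<close>, the robber sits in one component of the
  rest, which the bigon formed by \<open>P\<close> and part of \<open>w\<close> bounds.\<close>

lemma split_B:
  assumes B: "\<And>R'. R' \<subset> R \<Longrightarrow> winB R'"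
    and T: "track_on R T" and wk: "\<And>r c. r \<in> R \<Longrightarrow> c \<le> len T \<Longrightarrow> adj r (wlk T c) \<Longrightarrow> lev T r \<le> c + 1 \<and> c \<le> lev T r + 1"
    and lev: "\<And>c. c \<le> len T \<Longrightarrow> wlk T c \<in> R \<Longrightarrow> lev T (wlk T c) = c"
    and desc: "desc_on R T 0 (len T)"
    and inj: "inj_on (wlk T) {0..len T}"
    and M: "M = wlk T ` {I<..<K}" "M \<subseteq> R" "I + 1 < K" "K \<le> len T" and ends: "wlk T I \<notin> R" "wlk T K \<notin> R"
    and out: "\<And>c. c \<le> I \<or> K \<le> c \<Longrightarrow> c \<le> len T \<Longrightarrow> wlk T c \<notin> R"
    and P: "track_on R P" "strict_on R P p1 p2" "is_seg P p1 p2" "seg P p1 p2 \<inter> R = {}"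
    and q: "q1 \<le> I" "K \<le> q2" "q2 \<le> len T" "wlk P p1 = wlk T q1" "wlk P p2 = wlk T q2"
    and int: "\<And>c d. c \<in> {p1..p2} \<Longrightarrow> d \<le> len T \<Longrightarrow> d \<le> I \<or> K \<le> d \<Longrightarrow> wlk P c = wlk T d \<Longrightarrow> c = p1 \<and> d = q1 \<or> c = p2 \<and> d = q2"
    and R: "territory R Bd" and r: "r \<in> R - M"
    and nb: "\<And>y x. y \<in> comp_of (R - M) r \<Longrightarrow> adj y x \<Longrightarrow> x \<in> Bd \<Longrightarrow> x \<in> seg P p1 p2 \<union> seg T q1 q2"
    and ijk: "i < 4" "j < 4" "k < 4" "distinct [i, j, k]" "odd (j + k)"
  shows "wins [i \<mapsto> P, j \<mapsto> T, k \<mapsto> T] (comp_of (R - M) r)"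
proof -
  let ?R = "comp_of (R - M) r"
  note t = territory_comp[OF R M(2) r]
  have sub: "?R \<subseteq> R - M" using comp_sub[OF r] .
  have Mq: "M \<subseteq> seg T q1 q2"
    using M(1) q unfolding seg_def by auto
  have "wlk T (Suc I) \<in> M" using M by auto
  then have ps: "?R \<subset> R" using sub M(2) by blast
  have dsj: "?R \<inter> seg T q1 q2 = {}"
  proof -
    have "wlk T c \<notin> ?R" if "c \<le> q2" for c
      using out[of c] sub M(1) that q by (cases "I < c \<and> c < K") auto
    then show ?thesis unfolding seg_def by auto
  qed
  have te: "territory ?R (seg P p1 p2 \<union> seg T q1 q2)"
    using t(1) by (rule territory_cong) (use nb Mq dsj P(4) t(2) in auto)
  have sT: "is_seg T q1 q2"
    unfolding is_seg_def using q M(3) inj_on_subset[OF inj, of "{q1..q2}"] by auto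
  have "bigon P p1 p2 T q1 q2"
    unfolding bigon_def
  proof (intro conjI ballI impI)
    fix c d assume cd: "c \<in> {p1..p2}" "d \<in> {q1..q2}" "wlk P c = wlk T d"
    have "wlk P c \<in> seg P p1 p2" using cd(1) unfolding seg_def by simp
    then have "wlk P c \<notin> R" using P(4) by blast
    then have "d \<le> I \<or> K \<le> d"
      using M(1,2) cd(3) by (metis greaterThanLessThan_iff imageI linorder_not_less subsetD)
    then show "c = p1 \<and> d = q1 \<or> c = p2 \<and> d = q2"
      using int cd q by auto
  qed (use P(3) sT q in auto)
  then have reg: "region ?R P p1 p2 T q1 q2"
    unfolding region_def using te track_on_mono[OF P(1) t(2)] track_on_mono[OF T t(2)] by blast
  have st: "strict_on ?R P p1 p2"
    using strict_on_mono[OF P(2) t(2)] by simp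
  have wk': "weak_on ?R T q1 q2"
    unfolding weak_on_def using wk t(2) q by (meson atLeastAtMost_iff order_trans subsetD)
  \<comment> \<open>The component sees no position of the walk outside the bigon: a position off
    \<open>M\<close> that it sees lies between \<open>q1\<close> and \<open>q2\<close> or on
    \<open>P\<close>, and on \<open>P\<close> only \<open>q1\<close> and \<open>q2\<close>
    occur.\<close>
  have idx: "c \<in> {q1..q2}" if y: "y \<in> ?R" "adj y (wlk T c)" "c \<le> len T" for y c
  proof (cases "I < c \<and> c < K")
    case True
    then show ?thesis using q by auto
  next
    case False
    then have c: "c \<le> I \<or> K \<le> c" by auto
    then have "wlk T c \<notin> ?R" using out y(3) t(2) by blast
    then have "wlk T c \<in> seg P p1 p2 \<union> seg T q1 q2"
      using te y(1,2) unfolding territory_def by blast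
    then consider d where "d \<in> {p1..p2}" "wlk P d = wlk T c" | d where "d \<in> {q1..q2}" "wlk T c = wlk T d"
      unfolding seg_def by auto
    then show ?thesis
    proof cases
      case 1
      then show ?thesis using int[OF 1(1) y(3) c 1(2)] q M(3) by auto
    next
      case 2
      then have "c = d" using inj y(3) q(3) by (auto dest: inj_onD)
      then show ?thesis using 2 by simp
    qed
  qed
  have de: "desc_on ?R T q1 q2"
    unfolding desc_on_def
  proof (intro ballI impI)
    fix y assume y: "y \<in> ?R" "lev T y < len T"
    then have "y \<in> R" using t(2) by blast
    then have "(\<exists>r'\<in>R. adj y r' \<and> lev T y = Suc (lev T r')) \<or> (\<exists>c\<in>{0..len T}. adj y (wlk T c) \<and> lev T y = Suc c)"
      using desc y(2) unfolding desc_on_def by blast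
    then consider r' where "r' \<in> R" "adj y r'" "lev T y = Suc (lev T r')" | c where "c \<le> len T" "adj y (wlk T c)" "lev T y = Suc c"
      by auto
    then show "(\<exists>r'\<in>?R. adj y r' \<and> lev T y = Suc (lev T r')) \<or> (\<exists>c\<in>{q1..q2}. adj y (wlk T c) \<and> lev T y = Suc c)"
    proof cases
      case 1
      show ?thesis
      proof (cases "r' \<in> M")
        case True
        \<comment> \<open>A lower neighbour that was removed with \<open>M\<close> lies on the walk
          at the position equal to its level, so it now counts as a vertex of the segment.\<close>
        then obtain c where c: "r' = wlk T c" "c \<le> len T" using M by auto
        then show ?thesis using 1 lev[OF c(2)] idx[OF y(1) _ c(2)] by auto
      next
        case False
        then have "r' \<in> ?R" using comp_closed[OF r y(1) 1(2)] 1(1) by blast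
        then show ?thesis using 1 by blast
      qed
    next
      case 2
      then show ?thesis using idx[OF y(1) 2(2,1)] by blast
    qed
  qed
  show ?thesis
    using B[OF ps] reg st wk' de ijk unfolding winB_def by blast
qed

end

section \<open>Paths as vertex sets and the two sides of a chord\<close>

context sgraph
begin

text \<open>The planarity arguments only ask which vertices a path occupies; as sets, paths are cut
  and joined without handling lists.\<close>

definition path_on :: "'a \<Rightarrow> 'a \<Rightarrow> 'a set \<Rightarrow> bool" where
  "path_on s t S \<longleftrightarrow> (\<exists>vs. vpath s t vs \<and> set vs = S)"

lemma path_on_rev: "path_on s t S \<Longrightarrow> path_on t s S"
  unfolding path_on_def using vpath_rev by (metis set_rev)

lemma path_on_join:
  assumes "path_on s t A" "path_on t u B" "A \<inter> B = {t}"
  shows "path_on s u (A \<union> B)"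
proof -
  obtain vs us where vs: "vpath s t vs" "set vs = A" and us: "vpath t u us" "set us = B"
    using assms unfolding path_on_def by blast
  show ?thesis
  proof (cases "tl us")
    case Nil
    then have "us = [t]" using us by (cases us) (auto simp: vpath_def)
    then have "u = t" "A \<union> B = A" using us vs vpath_ends[OF vs(1)] by (auto simp: vpath_def)
    then show ?thesis using assms(1) by simp
  next
    case (Cons y ys)
    then have u: "us = t # y # ys" using us by (cases us) (auto simp: vpath_def)
    then have "vpath y u (y # ys)" "adj t y" using us by (auto simp: vpath_def)
    moreover have "set vs \<inter> set (y # ys) = {}"
      using assms(3) vs us u by (auto simp: vpath_def)
    ultimately have "vpath s u (vs @ y # ys)"
      using vpath_append vs(1) by blast
    moreover have "set (vs @ y # ys) = A \<union> B"
      using vs us u vpath_ends[OF vs(1)] by auto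
    ultimately show ?thesis unfolding path_on_def by blast
  qed
qed

lemma path_on_image:
  assumes "\<And>c. i \<le> c \<Longrightarrow> c < j \<Longrightarrow> adj (w c) (w (Suc c))" "inj_on w {i..j}" "i \<le> j"
  shows "path_on (w i) (w j) (w ` {i..j})"
proof -
  have "successively adj (map w [i..<Suc j])"
    using assms(1,3) by (simp add: successively_conv_nth del: upt_Suc)
  moreover have "distinct (map w [i..<Suc j])"
    using assms(2) by (simp add: distinct_map atLeastLessThanSuc_atLeastAtMost del: upt_Suc)
  ultimately have "vpath (w i) (w j) (map w [i..<Suc j])"
    using assms(3) unfolding vpath_def by (simp add: hd_map last_map del: upt_Suc)
  moreover have "set (map w [i..<Suc j]) = w ` {i..j}"
    by (simp add: atLeastLessThanSuc_atLeastAtMost del: upt_Suc)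
  ultimately show ?thesis unfolding path_on_def by blast
qed

lemma path_on_ends: "path_on s t S \<Longrightarrow> s \<in> S \<and> t \<in> S"
  unfolding path_on_def using vpath_ends by blast

end

context drawn_graph
begin

lemma theta_sets:
  assumes "path_on s t A" "path_on s t B" "path_on s t C" "s \<noteq> t"
    and "A \<inter> B = {s, t}" "A \<inter> C = {s, t}" "B \<inter> C = {s, t}"
    and "con U1" "con U2" "con U3" and "x \<in> U1" "x \<in> U2" "x \<in> U3"
    and "U1 \<subseteq> V" "U2 \<subseteq> V" "U3 \<subseteq> V"
    and "U1 \<inter> A \<noteq> {}" "U1 \<inter> B = {}" "U1 \<inter> C = {}"
    and "U2 \<inter> B \<noteq> {}" "U2 \<inter> A = {}" "U2 \<inter> C = {}"
    and "U3 \<inter> C \<noteq> {}" "U3 \<inter> A = {}" "U3 \<inter> B = {}"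
  shows False
proof -
  obtain a b c where a: "vpath s t a" "set a = A" and b: "vpath s t b" "set b = B" and c: "vpath s t c" "set c = C"
    using assms(1-3) unfolding path_on_def by blast
  note assms(5-)[folded a(2) b(2) c(2)]
  then show False
    by (rule theta_free[OF a(1) b(1) c(1) assms(4)])
qed

lemma four_sets_not_linked:
  assumes "path_on s t A" "path_on s t B" "path_on s t C" "path_on s t D" "s \<noteq> t"
    and "A \<inter> B = {s, t}" "A \<inter> C = {s, t}" "A \<inter> D = {s, t}"
      "B \<inter> C = {s, t}" "B \<inter> D = {s, t}" "C \<inter> D = {s, t}"
    and "con AB" "con AC" "con BC"
    and "AB \<subseteq> V" "AC \<subseteq> V" "BC \<subseteq> V"
    and "AB \<inter> A \<noteq> {}" "AB \<inter> B \<noteq> {}" "AB \<inter> C = {}" "AB \<inter> D = {}"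
    and "AC \<inter> A \<noteq> {}" "AC \<inter> C \<noteq> {}" "AC \<inter> B = {}" "AC \<inter> D = {}"
    and "BC \<inter> B \<noteq> {}" "BC \<inter> C \<noteq> {}" "BC \<inter> A = {}" "BC \<inter> D = {}"
  shows False
proof -
  obtain a b c d where a: "vpath s t a" "set a = A" and b: "vpath s t b" "set b = B" and c: "vpath s t c" "set c = C"
    and d: "vpath s t d" "set d = D"
    using assms(1-4) unfolding path_on_def by blast
  note assms(6-)[folded a(2) b(2) c(2) d(2)]
  then show False
    by (rule four_paths_not_linked[OF a(1) b(1) c(1) d(1) assms(5)])
qed

text \<open>The \<open>K\<^sub>3\<^sub>,\<^sub>3\<close> argument: a component left over by the chord \<open>M\<close> cannot reach both sides of the cycle.\<close>

lemma chord_side: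
  assumes p: "path_on s t A" "path_on s t B" "path_on s t C" and st: "s \<noteq> t"
    and int: "A \<inter> B = {s, t}" "C = M \<union> {s, t}" and R: "con R" "R \<subseteq> V" "M \<subseteq> R" "M \<noteq> {}" "R \<inter> A = {}" "R \<inter> B = {}"
    and r: "r \<in> R - M"
  shows "(\<forall>y\<in>comp_of (R - M) r. \<forall>x\<in>A - {s, t}. \<not> adj y x) \<or> (\<forall>y\<in>comp_of (R - M) r. \<forall>x\<in>B - {s, t}. \<not> adj y x)"
proof (rule ccontr)
  let ?R = "comp_of (R - M) r"
  assume "\<not> ?thesis"
  then obtain y1 x1 y2 x2 where y: "y1 \<in> ?R" "x1 \<in> A - {s, t}" "adj y1 x1" "y2 \<in> ?R" "x2 \<in> B - {s, t}" "adj y2 x2"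
    by blast
  have sub: "?R \<subseteq> R - M" using comp_sub[OF r] .
  then have s': "?R \<subseteq> R" "?R \<noteq> R" "?R \<noteq> {}" using R(3,4) comp_self[of r] by blast+
  \<comment> \<open>\<open>R\<close> is connected, so the component has a neighbour on the chord;
    with both sides in reach as well, it would be a hub for all three paths.\<close>
  obtain y3 x3 where 3: "y3 \<in> ?R" "x3 \<in> R - ?R" "adj y3 x3"
    using con_boundary[OF R(1) s'(1,3,2)] by blast
  then have x3: "x3 \<in> M" using comp_closed[OF r, of y3 x3] by blast
  have c: "con ?R" using con_comp[OF r] .
  have con: "con (insert x1 ?R)" "con (insert x2 ?R)" "con (insert x3 ?R)"
    using con_insert[OF c] y 3 adj_sym by blast+
  have st': "s \<in> A" "t \<in> A" "s \<in> B" "t \<in> B" using int(1) by auto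
  have d: "?R \<inter> A = {}" "?R \<inter> B = {}" "?R \<inter> C = {}"
    using sub R(5,6) int(2) st' by auto
  have i: "A \<inter> C = {s, t}" "B \<inter> C = {s, t}"
    using int(2) R(3,5,6) st' by auto
  have v: "insert x1 ?R \<subseteq> V" "insert x2 ?R \<subseteq> V" "insert x3 ?R \<subseteq> V"
    using y 3 adjV2 s'(1) R(2) by auto
  have n: "x1 \<notin> B" "x2 \<notin> A"
    using y(2,5) int(1) by auto
  have n': "x1 \<notin> C" "x2 \<notin> C"
    using y(2,5) i by auto
  have n'': "x3 \<notin> A" "x3 \<notin> B" "x3 \<in> C"
    using x3 int(2) R(3,5,6) by auto
  have rx: "r \<in> insert x1 ?R" "r \<in> insert x2 ?R" "r \<in> insert x3 ?R"
    by simp_all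
  show False
    by (rule theta_sets[OF p st int(1) i con rx v])
      (use d n n' n'' y(2,5) in simp_all)
qed

end

section \<open>Cutting a bigon at two of its vertices, and spare cops\<close>

context cop_game
begin

lemma track_adj: "track_on X T \<Longrightarrow> c < len T \<Longrightarrow> adj (wlk T c) (wlk T (Suc c))"
  unfolding track_on_def by blast

lemma bigon_sym: "bigon T a b S c d \<Longrightarrow> bigon S c d T a b"
  unfolding bigon_def by metis

lemma region_sym: "region R T a b S c d \<Longrightarrow> region R S c d T a b"
  unfolding region_def by (simp add: bigon_sym Un_commute)

lemma path_on_seg:
  assumes "track_on X T" "is_seg T a b" "a \<le> i" "i \<le> j" "j \<le> b"
  shows "path_on (wlk T i) (wlk T j) (seg T i j)"
  unfolding seg_def
proof (rule path_on_image)
  show "inj_on (wlk T) {i..j}"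
    using assms(2-5) inj_on_subset[of "wlk T" "{a..b}" "{i..j}"] unfolding is_seg_def by auto
qed (use assms track_adj[OF assms(1)] in \<open>auto simp: is_seg_def\<close>)

lemma seg_mem: "c \<in> {a..b} \<Longrightarrow> wlk T c \<in> seg T a b"
  unfolding seg_def by simp

lemma segE: assumes "x \<in> seg T a b" obtains c where "a \<le> c" "c \<le> b" "x = wlk T c"
  using assms unfolding seg_def by auto

lemma seg_Int:
  assumes "is_seg T a b" "a \<le> i" "j \<le> b" "a \<le> i'" "j' \<le> b"
    "\<And>x. i \<le> x \<Longrightarrow> x \<le> j \<Longrightarrow> i' \<le> x \<Longrightarrow> x \<le> j' \<Longrightarrow> x \<in> S"
  shows "seg T i j \<inter> seg T i' j' \<subseteq> wlk T ` S"
proof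
  fix v assume "v \<in> seg T i j \<inter> seg T i' j'"
  then obtain x y where x: "i \<le> x" "x \<le> j" "v = wlk T x" and y: "i' \<le> y" "y \<le> j'" "v = wlk T y"
    by (elim IntE segE)
  have "inj_on (wlk T) {a..b}" using assms(1) by (simp add: is_seg_def)
  then have "x = y"
    using x y assms(2-5) by (intro inj_onD[of "wlk T" "{a..b}"]) auto
  then show "v \<in> wlk T ` S" using x y assms(6) by blast
qed

lemma bigon_Int:
  assumes "bigon T a b S c d" "a \<le> i" "j \<le> b" "c \<le> k" "l \<le> d" "v \<in> seg T i j" "v \<in> seg S k l"
  shows "v = wlk T a \<and> i = a \<and> k = c \<or> v = wlk T b \<and> j = b \<and> l = d"
proof -
  obtain x y where x: "i \<le> x" "x \<le> j" "v = wlk T x" and y: "k \<le> y" "y \<le> l" "v = wlk S y"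
    using assms(6,7) by (elim segE)
  have "x = a \<and> y = c \<or> x = b \<and> y = d"
    using assms(1-5) x y unfolding bigon_def by (metis atLeastAtMost_iff order_trans)
  then show ?thesis using x y assms(2-5) by auto
qed

text \<open>The boundary cycle as seen from a chord with both ends on side \<open>T\<close>: one arc
  is the piece between them, the other goes round through \<open>S\<close>.\<close>

lemma bigon_arcs_same:
  assumes bg: "bigon T a b S c d" and T: "track_on X T" and S: "track_on X S" and ij: "a \<le> i" "i < j" "j \<le> b"
  shows "path_on (wlk T i) (wlk T j) (seg T i j)"
    "path_on (wlk T i) (wlk T j) (seg T a i \<union> seg S c d \<union> seg T j b)"
    "seg T i j \<inter> (seg T a i \<union> seg S c d \<union> seg T j b) = {wlk T i, wlk T j}"
proof -
  have sT: "is_seg T a b" and sS: "is_seg S c d" and e: "wlk T a = wlk S c" "wlk T b = wlk S d"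
    using bg unfolding bigon_def by auto
  have cd: "c < d" using sS by (simp add: is_seg_def)
  have ne: "wlk T x \<noteq> wlk T y" if "a \<le> x" "x < y" "y \<le> b" for x y
    using sT that inj_onD[of "wlk T" "{a..b}" x y] by (auto simp: is_seg_def)
  show "path_on (wlk T i) (wlk T j) (seg T i j)"
    using path_on_seg[OF T sT] ij by simp
  have 1: "path_on (wlk T i) (wlk T a) (seg T a i)"
    using path_on_rev[OF path_on_seg[OF T sT, of a i]] ij by simp
  have 2: "path_on (wlk T a) (wlk T b) (seg S c d)"
    using path_on_seg[OF S sS, of c d] e cd by simp
  have 3: "path_on (wlk T b) (wlk T j) (seg T j b)"
    using path_on_rev[OF path_on_seg[OF T sT, of j b]] ij by simp
  have i1: "seg T a i \<inter> seg S c d = {wlk T a}"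
  proof
    show "seg T a i \<inter> seg S c d \<subseteq> {wlk T a}"
      using bigon_Int[OF bg, of a i c d] ij by auto
    show "{wlk T a} \<subseteq> seg T a i \<inter> seg S c d"
      using path_on_ends[OF 1] path_on_ends[OF 2] by auto
  qed
  have i2: "(seg T a i \<union> seg S c d) \<inter> seg T j b = {wlk T b}"
  proof
    have "seg T a i \<inter> seg T j b \<subseteq> wlk T ` {}"
      by (rule seg_Int[OF sT]) (use ij in auto)
    then show "(seg T a i \<union> seg S c d) \<inter> seg T j b \<subseteq> {wlk T b}"
      using bigon_Int[OF bg, of j b c d] ij by auto
    show "{wlk T b} \<subseteq> (seg T a i \<union> seg S c d) \<inter> seg T j b"
      using path_on_ends[OF 2] path_on_ends[OF 3] by auto
  qed
  show "path_on (wlk T i) (wlk T j) (seg T a i \<union> seg S c d \<union> seg T j b)"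
    using path_on_join[OF path_on_join[OF 1 2 i1] 3 i2] .
  have "seg T i j \<inter> seg T a i \<subseteq> wlk T ` {i}" "seg T i j \<inter> seg T j b \<subseteq> wlk T ` {j}"
    using ij seg_Int[OF sT, of i j a i "{i}"] seg_Int[OF sT, of i j j b "{j}"] by auto
  moreover have "seg T i j \<inter> seg S c d \<subseteq> {wlk T i, wlk T j}"
    using bigon_Int[OF bg, of i j c d] ij by auto
  moreover have "wlk T i \<in> seg T a i" "wlk T j \<in> seg T j b" "wlk T i \<in> seg T i j" "wlk T j \<in> seg T i j"
    using ij by (auto intro!: seg_mem)
  ultimately show "seg T i j \<inter> (seg T a i \<union> seg S c d \<union> seg T j b) = {wlk T i, wlk T j}"
    by blast
qed

text \<open>For a chord between the two sides. The half-open ranges \<open>i < b\<close> and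
  \<open>c < j\<close> give each corner of the bigon only one name, on \<open>T\<close> for the
  first and on \<open>S\<close> for the last, so that the two ends are distinct.\<close>

lemma bigon_arcs_opp:
  assumes bg: "bigon T a b S c d" and T: "track_on X T" and S: "track_on X S"
    and ij: "a \<le> i" "i < b" "c < j" "j \<le> d"
  shows "path_on (wlk T i) (wlk S j) (seg T i b \<union> seg S j d)"
    "path_on (wlk T i) (wlk S j) (seg T a i \<union> seg S c j)"
    "(seg T i b \<union> seg S j d) \<inter> (seg T a i \<union> seg S c j) = {wlk T i, wlk S j}"
    "wlk T i \<noteq> wlk S j"
proof -
  have sT: "is_seg T a b" and sS: "is_seg S c d" and e: "wlk T a = wlk S c" "wlk T b = wlk S d"
    using bg unfolding bigon_def by auto
  have 1: "path_on (wlk T i) (wlk T b) (seg T i b)"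
    using path_on_seg[OF T sT] ij by simp
  have 2: "path_on (wlk T b) (wlk S j) (seg S j d)"
    using path_on_rev[OF path_on_seg[OF S sS, of j d]] ij e by simp
  have 3: "path_on (wlk T i) (wlk T a) (seg T a i)"
    using path_on_rev[OF path_on_seg[OF T sT, of a i]] ij by simp
  have 4: "path_on (wlk T a) (wlk S j) (seg S c j)"
    using path_on_seg[OF S sS, of c j] ij e by simp
  have "seg T i b \<inter> seg S j d \<subseteq> {wlk T b}"
    using bigon_Int[OF bg, of i b j d] ij by auto
  then show "path_on (wlk T i) (wlk S j) (seg T i b \<union> seg S j d)"
    using path_on_join[OF 1 2] path_on_ends[OF 1] path_on_ends[OF 2] by auto
  have "seg T a i \<inter> seg S c j \<subseteq> {wlk T a}"
    using bigon_Int[OF bg, of a i c j] ij by auto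
  then show "path_on (wlk T i) (wlk S j) (seg T a i \<union> seg S c j)"
    using path_on_join[OF 3 4] path_on_ends[OF 3] path_on_ends[OF 4] by auto
  have "seg T i b \<inter> seg T a i \<subseteq> wlk T ` {i}" "seg S j d \<inter> seg S c j \<subseteq> wlk S ` {j}"
    using ij seg_Int[OF sT, of i b a i "{i}"] seg_Int[OF sS, of j d c j "{j}"] by auto
  moreover have "seg T i b \<inter> seg S c j \<subseteq> {wlk T i, wlk S j}"
  proof
    fix x assume "x \<in> seg T i b \<inter> seg S c j"
    then have "x = wlk T a \<and> i = a \<and> c = c \<or> x = wlk T b \<and> b = b \<and> j = d"
      using bigon_Int[OF bg, of i b c j x] ij by simp
    then show "x \<in> {wlk T i, wlk S j}"
      using e by blast
  qed
  moreover have "seg T a i \<inter> seg S j d \<subseteq> {}"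
    using bigon_Int[OF bg, of a i j d] ij by auto
  ultimately show "(seg T i b \<union> seg S j d) \<inter> (seg T a i \<union> seg S c j) = {wlk T i, wlk S j}"
    using path_on_ends[OF 1] path_on_ends[OF 2] path_on_ends[OF 3] path_on_ends[OF 4] by blast
  show "wlk T i \<noteq> wlk S j"
    using bg ij unfolding bigon_def by (metis atLeastAtMost_iff less_imp_le nat_neq_iff)
qed

lemma strict_imp_weak: "strict_on R T a b \<Longrightarrow> weak_on R T a b"
  unfolding strict_on_def weak_on_def by fastforce

text \<open>Levels change by at most 1 per step and the last step obeys \<open>weak_on\<close>, so a
  walk of length \<open>d\<close> cannot bridge more than \<open>d\<close> levels.\<close>

lemma weak_rwalk:
  assumes T: "track_on R T" "weak_on R T a b" and c: "c \<in> {a..b}" "wlk T c \<notin> R"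
  shows "r \<in> R \<Longrightarrow> rwalk R r (wlk T c) d \<Longrightarrow> lev T r \<le> c + d \<and> c \<le> lev T r + d"
proof (induction d arbitrary: r)
  case 0
  then show ?case using c by simp
next
  case (Suc d)
  obtain y where y: "adj r y" "rwalk R y (wlk T c) d" "d = 0 \<or> y \<in> R"
    using rwalk_split[OF Suc.prems(2)] by blast
  show ?case
  proof (cases "y \<in> R")
    case True
    have "lev T y \<le> lev T r + 1" "lev T r \<le> lev T y + 1"
      using T(1) True Suc.prems(1) y(1) adj_sym unfolding track_on_def by blast+
    then show ?thesis using Suc.IH[OF True y(2)] by auto
  next
    case False
    then have "d = 0" "y = wlk T c" using y by auto
    then show ?thesis using T(2) Suc.prems(1) c(1) y(1) unfolding weak_on_def by auto
  qed
qed

text \<open>Two such walks joined at \<open>r\<close>: a guarded segment has no shortcut through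
  \<open>R\<close>. This passes the shortest-path property on to the next walk, whose levels
  \<open>canonical_track\<close> then provides.\<close>

lemma weak_geo:
  assumes "track_on R T" "weak_on R T a b" "seg T a b \<inter> R = {}" "c \<in> {a..b}" "c' \<in> {a..b}" "r \<in> R"
    "rwalk R r (wlk T c) d" "rwalk R r (wlk T c') d'"
  shows "c' \<le> c + d + d'"
proof -
  have "wlk T c \<notin> R" "wlk T c' \<notin> R" using assms(3-5) seg_mem by blast+
  then show ?thesis
    using weak_rwalk[OF assms(1,2,4) _ assms(6,7)] weak_rwalk[OF assms(1,2,5) _ assms(6,8)] by simp
qed

lemma four_spares:
  assumes "i < 4" "j < 4" "i \<noteq> (j::nat)"
  shows "\<exists>k<4. \<exists>l<4. distinct [i, j, k, l] \<and> (odd (k + l) \<or> odd (i + l) \<and> odd (i + k))"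
proof -
  have "i \<in> {0,1,2,3}" "j \<in> {0,1,2,3}" using assms(1,2) by auto
  then show ?thesis
    using assms(3)
    by (elim insertE emptyE; simp) 
       (rule exI[of _ 0] exI[of _ 1] exI[of _ 2], simp; rule exI[of _ 1] exI[of _ 2] exI[of _ 3], simp)+
qed

text \<open>If the two spare cops have equal parity, both guards have the other one. Then a spare
  cop takes over \<open>P\<close>, and the guard so freed is opposite to the remaining
  spare.\<close>

lemma opposite_spares:
  assumes P: "track_on R P" and Q: "track_on R Q"
    and safe: "\<And>i j \<tau> cs r r'. i < 4 \<Longrightarrow> j < 4 \<Longrightarrow> i \<noteq> j \<Longrightarrow> guarding [i \<mapsto> P, j \<mapsto> Q] R \<tau> cs r \<Longrightarrow> adj r r' \<Longrightarrow> r' \<notin> R \<Longrightarrow>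
      \<exists>i<4. cs i = r' \<or> adj (cs i) r'"
    and main: "\<And>i j k l. i < 4 \<Longrightarrow> j < 4 \<Longrightarrow> k < 4 \<Longrightarrow> l < 4 \<Longrightarrow> distinct [i, j, k, l] \<Longrightarrow> odd (k + l) \<Longrightarrow>
      wins [i \<mapsto> P, j \<mapsto> Q] R"
    and ij: "i < 4" "j < 4" "i \<noteq> j"
  shows "wins [i \<mapsto> P, j \<mapsto> Q] R"
proof -
  obtain k l where kl: "k < 4" "l < 4" "distinct [i, j, k, l]" "odd (k + l) \<or> odd (i + l) \<and> odd (i + k)"
    using four_spares[OF ij] by blast
  show ?thesis
  proof (cases "odd (k + l)")
    case True
    then show ?thesis using main kl ij by blast
  next
    case False
    then have w: "wins [k \<mapsto> P, j \<mapsto> Q] R"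
      using main[of k j i l] kl ij by auto
    show ?thesis
    proof (rule wins_add[OF _ P kl(1) _ _ w])
      show "tracks_on R [i \<mapsto> P, j \<mapsto> Q]"
        using P Q ij by (simp add: tracks_on_def)
      show "[i \<mapsto> P, j \<mapsto> Q] k = None" using kl(3) by simp
      show "[k \<mapsto> P, j \<mapsto> Q] \<subseteq>\<^sub>m [i \<mapsto> P, j \<mapsto> Q, k \<mapsto> P]"
        using kl(3) by (auto simp: map_le_def)
    qed (use safe[OF ij] in blast)
  qed
qed

end

section \<open>Chords\<close>

locale planar_game = drawn_graph V adj p \<gamma> + cop_game V adj x0
  for V :: "'a set" and adj p \<gamma> x0
begin

lemma seg_V:
  assumes "track_on X T" "is_seg T a b"
  shows "seg T a b \<subseteq> V"
proof
  fix x assume "x \<in> seg T a b"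
  then obtain c where c: "c \<le> b" "a \<le> c" "x = wlk T c" by (elim segE)
  have "b \<le> len T" "a < b" using assms(2) by (auto simp: is_seg_def)
  show "x \<in> V"
  proof (cases "c < len T")
    case True
    then show ?thesis using track_adj[OF assms(1)] c(3) adjV by blast
  next
    case False
    then obtain e where "c = Suc e" "e < len T"
      using c \<open>b \<le> len T\<close> \<open>a < b\<close> by (cases c) auto
    then show ?thesis using track_adj[OF assms(1)] c(3) adjV2 by blast
  qed
qed

lemma seg_sub: "a \<le> a' \<Longrightarrow> b' \<le> b \<Longrightarrow> seg T a' b' \<subseteq> seg T a b"
  unfolding seg_def by (rule image_mono) auto

lemma seg_cover: "seg T a b \<subseteq> seg T a x \<union> seg T x b"
proof
  fix v assume "v \<in> seg T a b"
  then obtain y where "a \<le> y" "y \<le> b" "v = wlk T y" by (elim segE)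
  then show "v \<in> seg T a x \<union> seg T x b"
    using seg_mem[of y a x T] seg_mem[of y x b T] by (cases "y \<le> x") auto
qed

lemma bigonD:
  assumes "bigon T a b S c d" "a \<le> x" "x \<le> b" "c \<le> y" "y \<le> d" "wlk T x = wlk S y"
  shows "x = a \<and> y = c \<or> x = b \<and> y = d"
  using assms by (simp add: bigon_def)

text \<open>The chord through \<open>R\<close> is chosen so that it completes the initial segment of \<open>P\<close> and the final
  segment of \<open>E\<close> to a shortest walk, which the two spare cops can therefore guard.\<close>

lemma A_chord:
  assumes B: "\<And>R'. R' \<subset> R \<Longrightarrow> winB R'"
    and reg: "region R P a b Q c d" and st: "strict_on R P a b" "strict_on R Q c d"
    and E: "same \<and> E = P \<and> ea = a \<and> eb = b \<or> \<not> same \<and> E = Q \<and> ea = c \<and> eb = d"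
    and cand: "a \<le> i0" "i0 < b" "ea < j0" "j0 \<le> eb" "same \<longrightarrow> i0 < j0" "rwalk R (wlk P i0) (wlk E j0) m0" "2 \<le> m0"
    and ix: "i1 < 4" "i2 < 4" "k < 4" "l < 4" "distinct [i1, i2, k, l]" "odd (k + l)"
  shows "wins [i1 \<mapsto> P, i2 \<mapsto> Q] R"
proof -
  have bg: "bigon P a b Q c d" and te: "territory R (seg P a b \<union> seg Q c d)" and P: "track_on R P" and Q: "track_on R Q"
    using reg unfolding region_def by auto
  have sP: "is_seg P a b" and sQ: "is_seg Q c d" and e: "wlk P a = wlk Q c" "wlk P b = wlk Q d"
    using bg unfolding bigon_def by auto
  have R: "R \<subseteq> V" "con R" "R \<inter> seg P a b = {}" "R \<inter> seg Q c d = {}"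
    using te unfolding territory_def by auto
  have ab: "a < b" "b \<le> len P" "c < d" "d \<le> len Q" using sP sQ by (auto simp: is_seg_def)
  have EE: "track_on R E" "is_seg E ea eb" "R \<inter> seg E ea eb = {}" "strict_on R E ea eb" "ea < eb" "eb \<le> len E"
    using E P Q sP sQ R st ab by auto
  \<comment> \<open>Not the chord alone is minimised but the whole walk: \<open>P\<close> up to
    \<open>i\<close>, the chord of length \<open>m\<close>, and \<open>E\<close> from
    \<open>j\<close> on, where \<open>E\<close> is \<open>P\<close> itself or the other side. The
    bound \<open>2 \<le> m\<close> forces the chord through \<open>R\<close>.\<close>
  define cnd where "cnd n i j m \<longleftrightarrow> a \<le> i \<and> i < b \<and> ea < j \<and> j \<le> eb \<and> (same \<longrightarrow> i < j) \<and>
      rwalk R (wlk P i) (wlk E j) m \<and> 2 \<le> m \<and> n = (i - a) + m + (eb - j)" for n i j m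
  define N where "N = (LEAST n. \<exists>i j m. cnd n i j m)"
  have "\<exists>i j m. cnd ((i0 - a) + m0 + (eb - j0)) i j m"
    using cand unfolding cnd_def by blast
  then have "\<exists>i j m. cnd N i j m"
    unfolding N_def by (rule LeastI)
  then obtain i j m where ijm: "cnd N i j m" by blast
  have ij: "a \<le> i" "i < b" "ea < j" "j \<le> eb" "same \<Longrightarrow> i < j" "2 \<le> m"
    using ijm unfolding cnd_def by auto
  have Neq: "N = (i - a) + m + (eb - j)" using ijm unfolding cnd_def by simp
  \<comment> \<open>Moving the ends towards the start of \<open>P\<close> and the end of
    \<open>E\<close> preserves all constraints on positions, so such competitors are
    admissible.\<close>
  have Nmin: "N \<le> (i' - a) + m' + (eb - j')"
    if "a \<le> i'" "i' \<le> i" "j \<le> j'" "j' \<le> eb" "rwalk R (wlk P i') (wlk E j') m'" "2 \<le> m'" for i' j' m'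
  proof -
    have "cnd ((i' - a) + m' + (eb - j')) i' j' m'"
      using that ij unfolding cnd_def by auto
    then show ?thesis unfolding N_def by (intro Least_le) blast
  qed
  obtain z where z: "z 0 = wlk P i" "z m = wlk E j" "\<And>c. c < m \<Longrightarrow> adj (z c) (z (Suc c))" "\<And>c. 0 < c \<Longrightarrow> c < m \<Longrightarrow> z c \<in> R"
    using ijm unfolding cnd_def rwalk_def by blast
  define I where "I = i - a"
  define K where "K = I + m"
  have NK: "N = K + (eb - j)" by (simp add: Neq K_def I_def)
  define w where "w x = (if x \<le> I then wlk P (a + x) else if x \<le> K then z (x - I) else wlk E (j + (x - K)))" for x
  have w_pre: "w x = wlk P (a + x)" if "x \<le> I" for x using that by (simp add: w_def)
  have w_mid: "w x = z (x - I)" if "I \<le> x" "x \<le> K" for x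
    using that z(1) ij(1) by (auto simp: w_def I_def)
  have w_post: "w x = wlk E (j + (x - K))" if "K \<le> x" for x
  proof (cases "x = K")
    case True
    then have "w x = z m" using w_mid[of K] by (simp add: K_def)
    then show ?thesis using z(2) True by simp
  qed (use that in \<open>simp add: w_def K_def\<close>)
  have wI: "w I = wlk P i" using w_pre[of I] ij(1) by (simp add: I_def)
  have wK: "w K = wlk E j" using w_post[of K] by simp
  have IK: "I + 1 < K" "K \<le> N" using ij(6) by (auto simp: K_def NK)
  have adj_w: "adj (w x) (w (Suc x))" if "x < N" for x
  proof -
    consider "x < I" | "I \<le> x" "x < K" | "K \<le> x" by linarith
    then show ?thesis
    proof cases
      case 1
      then show ?thesis using w_pre[of x] w_pre[of "Suc x"] track_adj[OF P, of "a + x"] ij ab by (simp add: I_def)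
    next
      case 2
      then show ?thesis
        using w_mid[of x] w_mid[of "Suc x"] z(3)[of "x - I"] by (simp add: K_def Suc_diff_le)
    next
      case 3
      have "j + (x - K) < len E" using 3 that EE(6) ij by (simp add: NK)
      then show ?thesis
        using w_post[of x] w_post[of "Suc x"] 3 track_adj[OF EE(1), of "j + (x - K)"] by (simp add: Suc_diff_le)
    qed
  qed
  have wR: "w x \<in> R" if "I < x" "x < K" for x
    using w_mid[of x] z(4)[of "x - I"] that by (simp add: K_def)
  have pre_seg: "w x \<in> seg P a i" if "x \<le> I" for x
    unfolding w_pre[OF that] by (rule seg_mem) (use that ij in \<open>auto simp: I_def\<close>)
  have post_seg: "w x \<in> seg E j eb" if "K \<le> x" "x \<le> N" for x
    unfolding w_post[OF that(1)] by (rule seg_mem) (use that ij in \<open>auto simp: NK\<close>)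
  have sub: "seg P a i \<subseteq> seg P a b" "seg E j eb \<subseteq> seg E ea eb"
    using ij by (simp_all add: seg_sub)
  have out: "w x \<notin> R" if "x \<le> I \<or> K \<le> x" "x \<le> N" for x
    using that pre_seg post_seg sub R EE(3) by blast
  \<comment> \<open>Three kinds of shortcut: one between two positions of \<open>P\<close>, or of
    \<open>E\<close>, contradicts \<open>weak_geo\<close>; any other, prolonged along the chord
    where necessary, yields a competitor shorter than \<open>N\<close>.\<close>
  have geo: "y \<le> x + d1 + d2"
    if r: "r \<in> R" and xy: "x \<le> N" "y \<le> N" and robber_loses: "rwalk R r (w x) d1" "rwalk R r (w y) d2" for r x y d1 d2
  proof (rule ccontr)
    assume lt: "\<not> y \<le> x + d1 + d2"
    consider "y \<le> I" | "K \<le> x" | "x < K" "I < y" by linarith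
    then show False
    proof cases
      case 1
      then have "a + y \<le> a + x + d1 + d2"
        using robber_loses w_pre[of x] w_pre[of y] lt ij R
        by (intro weak_geo[OF P strict_imp_weak[OF st(1)] _ _ _ r, of "a + x" "a + y" d1 d2]) (auto simp: I_def)
      then show False using lt by simp
    next
      case 2
      then have "j + (y - K) \<le> j + (x - K) + d1 + d2"
        using robber_loses w_post[of x] w_post[of y] lt ij xy EE(3)
        by (intro weak_geo[OF EE(1) strict_imp_weak[OF EE(4)] _ _ _ r, of "j + (x - K)" "j + (y - K)" d1 d2]) (auto simp: NK)
      then show False using lt 2 by simp
    next
      case 3
      have "\<exists>i' L. a \<le> i' \<and> i' \<le> i \<and> rwalk R (wlk P i') r L \<and> (i' - a) + L \<le> x + d1"
      proof (cases "x \<le> I")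
        case True
        then show ?thesis
          using robber_loses(1) w_pre[OF True] rwalk_sym ij by (intro exI[of _ "a + x"] exI[of _ d1]) (auto simp: I_def)
      next
        case False
        have "rwalk R (w I) (w x) (x - I)"
          using False 3 adj_w wR IK by (intro rwalk_sub) auto
        then have "rwalk R (wlk P i) r ((x - I) + d1)"
          unfolding wI using rwalk_sym[OF robber_loses(1)] wR False 3 by (intro rwalk_trans) auto
        then show ?thesis
          using False ij by (intro exI[of _ i] exI[of _ "(x - I) + d1"]) (auto simp: I_def)
      qed
      then obtain i' L where i': "a \<le> i'" "i' \<le> i" "rwalk R (wlk P i') r L" "(i' - a) + L \<le> x + d1" by blast
      have "\<exists>j' L. j \<le> j' \<and> j' \<le> eb \<and> rwalk R r (wlk E j') L \<and> L + (eb - j') \<le> (N - y) + d2"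
      proof (cases "K \<le> y")
        case True
        then show ?thesis
          using robber_loses(2) w_post[OF True] ij xy by (intro exI[of _ "j + (y - K)"] exI[of _ d2]) (auto simp: NK)
      next
        case False
        have "rwalk R (w y) (w K) (K - y)"
          using False 3 adj_w wR IK by (intro rwalk_sub) auto
        then have "rwalk R r (wlk E j) (d2 + (K - y))"
          using robber_loses(2) wR False 3 unfolding wK by (intro rwalk_trans) auto
        then show ?thesis
          using False ij by (intro exI[of _ j] exI[of _ "d2 + (K - y)"]) (auto simp: NK)
      qed
      then obtain j' L' where j': "j \<le> j'" "j' \<le> eb" "rwalk R r (wlk E j') L'" "L' + (eb - j') \<le> (N - y) + d2" by blast
      have "wlk P i' \<in> seg P a b" "wlk E j' \<in> seg E ea eb"
        using i' j' ij by (auto intro!: seg_mem)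
      then have "wlk P i' \<noteq> r" "r \<noteq> wlk E j'" using r R EE(3) by blast+
      then have "2 \<le> L + L'" using rwalk_pos[OF i'(3)] rwalk_pos[OF j'(3)] by simp
      then have "N \<le> (i' - a) + (L + L') + (eb - j')"
        using Nmin[OF i'(1,2) j'(1,2) rwalk_trans[OF i'(3) j'(3) r]] by blast
      then show False using i'(4) j'(4) lt xy by linarith
    qed
  qed
  have "w 0 \<in> V" using adj_w[of 0] IK adjV by auto
  then obtain \<kappa> where \<kappa>: "parity_at (w 0) \<kappa>" by (rule parity_at_ex)
  have N1: "1 \<le> N" and w0: "w 0 \<notin> R" using IK out[of 0] by simp_all
  obtain T where T: "wlk T = w" "len T = N" "track_on R T"
      "\<And>r c. r \<in> R \<Longrightarrow> c \<le> N \<Longrightarrow> adj r (w c) \<Longrightarrow> lev T r \<le> c + 1 \<and> c \<le> lev T r + 1"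
      "\<And>c. c \<le> N \<Longrightarrow> w c \<in> R \<Longrightarrow> lev T (w c) = c" "desc_on R T 0 N"
  proof (rule canonical_track[of N w \<kappa> R, OF N1 _ \<kappa> w0])
    show "adj (w x) (w (Suc x))" if "x < N" for x by (rule adj_w[OF that])
    show "y \<le> x + d1 + d2"
      if "r \<in> R" "x \<le> N" "y \<le> N" "rwalk R r (w x) d1" "rwalk R r (w y) d2" for r x y d1 d2
      by (rule geo[OF that])
  qed (rule that)
  have injP: "wlk P x \<noteq> wlk P y" if "a \<le> x" "x < y" "y \<le> b" for x y
    using sP that inj_onD[of "wlk P" "{a..b}" x y] by (auto simp: is_seg_def)
  have injE: "wlk E x \<noteq> wlk E y" if "ea \<le> x" "x < y" "y \<le> eb" for x y
    using EE(2) that inj_onD[of "wlk E" "{ea..eb}" x y] by (auto simp: is_seg_def)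
  have PE: "wlk P x \<noteq> wlk E y" if "a \<le> x" "x \<le> i" "j \<le> y" "y \<le> eb" for x y
  proof (cases same)
    case True
    then show ?thesis using E ij that injP[of x y] by auto
  next
    case False
    then have "E = Q" "ea = c" "eb = d" using E by auto
    then show ?thesis using bigonD[OF bg, of x y] ij that by auto
  qed
  \<comment> \<open>Inside \<open>R\<close> the level of a vertex of \<open>w\<close> is its
    position; on the boundary, \<open>P\<close> and \<open>E\<close> are injective and the pieces
    used are disjoint.\<close>
  have neq: "w x \<noteq> w y" if "x < y" "y \<le> N" for x y
  proof
    assume eq: "w x = w y"
    show False
    proof (cases "w x \<in> R")
      case True
      then show False using T(5)[of x] T(5)[of y] eq that by simp
    next
      case False
      then have "x \<le> I \<or> K \<le> x" "y \<le> I \<or> K \<le> y" using wR[of x] wR[of y] eq by force+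
      then consider "y \<le> I" | "x \<le> I" "K \<le> y" | "K \<le> x" using that by linarith
      then show False
      proof cases
        case 1
        then show False using eq w_pre[of x] w_pre[of y] injP[of "a + x" "a + y"] that ij by (simp add: I_def)
      next
        case 2
        then obtain y' where "y = K + y'" by (metis le_Suc_ex)
        moreover from this have "j + y' \<le> eb" using that(2) ij(4) unfolding NK by linarith
        moreover have "a + x \<le> i" using 2(1) ij(1) unfolding I_def by linarith
        ultimately show False using 2(1) eq w_pre[of x] w_post[of y] PE[of "a + x" "j + y'"] by simp
      next
        case 3
        moreover obtain x' where "x = K + x'" using 3 by (metis le_Suc_ex)
        moreover have "K \<le> y" using 3 that(1) by linarith
        then obtain y' where "y = K + y'" by (metis le_Suc_ex)
        moreover from this have "j + y' \<le> eb" using that(2) ij(4) unfolding NK by linarith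
        ultimately show False using eq w_post[of x] w_post[of y] injE[of "j + x'" "j + y'"] that ij(3) by simp
      qed
    qed
  qed
  have inj: "inj_on w {0..N}"
    using neq by (auto intro!: linorder_inj_onI)
  define M where "M = w ` {I<..<K}"
  have MR: "M \<subseteq> R" using wR by (auto simp: M_def)
  have "w (Suc I) \<in> M" using IK by (auto simp: M_def)
  then have Mne: "M \<noteq> {}" by blast
  have st_ne: "wlk P i \<noteq> wlk E j" using PE[of i j] ij by simp
  have pC: "path_on (wlk P i) (wlk E j) (M \<union> {wlk P i, wlk E j})"
  proof -
    have "path_on (w I) (w K) (w ` {I..K})"
      using adj_w IK inj_on_subset[OF inj, of "{I..K}"] by (intro path_on_image) auto
    moreover have "{I..K} = insert I (insert K {I<..<K})" using IK by auto
    then have "w ` {I..K} = M \<union> {wlk P i, wlk E j}" unfolding M_def using wI wK by auto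
    ultimately show ?thesis using wI wK by simp
  qed
  let ?J = "[i1 \<mapsto> P, i2 \<mapsto> Q]"
  have safe: "\<exists>i<4. cs i = r' \<or> adj (cs i) r'"
    if i: "guarding J R \<tau> cs r" "J i1 = Some P" "J i2 = Some Q" and r': "adj r r'" "r' \<notin> R" for J \<tau> cs r r'
  proof -
    have "r' \<in> seg P a b \<union> seg Q c d" using te i(1) r' unfolding territory_def guarding_def by blast
    then show ?thesis
      using strict_safe[OF i(1,2) P st(1) ab(2) r'(1)] strict_safe[OF i(1,3) Q st(2) ab(4) r'(1)] by blast
  qed
  have comp: "\<exists>J'. J' \<subseteq>\<^sub>m ?J(k \<mapsto> T, l \<mapsto> T) \<and> wins J' (comp_of (R - M) r)" if r: "r \<in> R - M" for r
  proof -
    let ?R = "comp_of (R - M) r"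
    \<comment> \<open>Whatever the component does not see, it is bounded by a piece
      \<open>P'\<close> of an old side, still guarded by a single cop \<open>g\<close>, and a piece
      of the new walk, guarded by the pair.\<close>
    have spl: "wins [g \<mapsto> P', k \<mapsto> T, l \<mapsto> T] ?R"
      if P': "track_on R P'" "strict_on R P' p1 p2" "is_seg P' p1 p2" "R \<inter> seg P' p1 p2 = {}"
        and q: "q1 \<le> I" "K \<le> q2" "q2 \<le> N" "wlk P' p1 = w q1" "wlk P' p2 = w q2"
        and int: "\<And>x y. p1 \<le> x \<Longrightarrow> x \<le> p2 \<Longrightarrow> y \<le> N \<Longrightarrow> y \<le> I \<or> K \<le> y \<Longrightarrow> wlk P' x = w y \<Longrightarrow> x = p1 \<and> y = q1 \<or> x = p2 \<and> y = q2"
        and nb: "\<And>y x. y \<in> ?R \<Longrightarrow> adj y x \<Longrightarrow> x \<in> seg P a b \<union> seg Q c d \<Longrightarrow> x \<in> seg P' p1 p2 \<or> x \<in> w ` {q1..q2}"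
        and g: "g \<in> {i1, i2}" for P' p1 p2 q1 q2 g
    proof -
      have wIK: "w I \<notin> R" "w K \<notin> R" using out[of I] out[of K] IK by auto
      have P4: "seg P' p1 p2 \<inter> R = {}" using P'(4) by blast
      have int': "x = p1 \<and> y = q1 \<or> x = p2 \<and> y = q2"
        if "x \<in> {p1..p2}" "y \<le> N" "y \<le> I \<or> K \<le> y" "wlk P' x = w y" for x y
        using int[of x y] that by simp
      have nb': "x \<in> seg P' p1 p2 \<union> seg T q1 q2" if "y \<in> ?R" "adj y x" "x \<in> seg P a b \<union> seg Q c d" for y x
        using nb[OF that] by (simp add: seg_def[of T] T(1))
      have ixs: "g < 4" "k < 4" "l < 4" "distinct [g, k, l]" "odd (k + l)" using ix g by auto
      show ?thesis
        by (rule split_B[OF B T(3) T(4)[folded T(1,2)] T(5)[folded T(1,2)] T(6)[folded T(2)] inj[folded T(1,2)]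
              M_def[folded T(1)] MR IK(1) IK(2)[folded T(2)] wIK[folded T(1)] out[folded T(1,2)] P'(1-3) P4
              q(1,2) q(3)[folded T(2)] q(4,5)[folded T(1)] int'[folded T(1,2)] te r nb' ixs])
    qed
    have preI: "seg P a i \<subseteq> w ` {0..I}"
    proof
      fix v assume "v \<in> seg P a i"
      then obtain x where x: "a \<le> x" "x \<le> i" "v = wlk P x" by (elim segE)
      then have "v = w (x - a)" using w_pre[of "x - a"] by (simp add: I_def)
      then show "v \<in> w ` {0..I}" using x by (auto simp: I_def)
    qed
    have postI: "seg E j eb \<subseteq> w ` {K..N}"
    proof
      fix v assume "v \<in> seg E j eb"
      then obtain x where x: "j \<le> x" "x \<le> eb" "v = wlk E x" by (elim segE)
      then have "v = w (K + (x - j))" using w_post[of "K + (x - j)"] by simp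
      then show "v \<in> w ` {K..N}" using x by (intro image_eqI[of _ _ "K + (x - j)"]) (auto simp: NK)
    qed
    have split3: "seg P a b \<subseteq> seg P a x \<union> seg P x y \<union> seg P y b" for x y
      using seg_cover[of P a b x] seg_cover[of P x b y] by blast
    show ?thesis
    proof (cases same)
      case True
      then have Eq: "E = P" "ea = a" "eb = b" using E by auto
      note bs = bigon_arcs_same[OF bg P Q ij(1) ij(5)[OF True]]
      have jb: "j \<le> b" using ij Eq by simp
      let ?A = "seg P i j" and ?B = "seg P a i \<union> seg Q c d \<union> seg P j b"
      have sA: "?A \<subseteq> seg P a b" "seg P a i \<subseteq> seg P a b" "seg P j b \<subseteq> seg P a b" 
        using ij jb Eq by (simp_all add: seg_sub)
      have "(\<forall>y\<in>?R. \<forall>x\<in>?A - {wlk P i, wlk P j}. \<not> adj y x) \<or> (\<forall>y\<in>?R. \<forall>x\<in>?B - {wlk P i, wlk P j}. \<not> adj y x)"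
      proof -
        have RA: "R \<inter> ?A = {}" "R \<inter> ?B = {}" using R(3,4) sA by blast+
        show ?thesis
          by (rule chord_side[OF bs(1)[OF jb] bs(2)[OF jb] pC[unfolded Eq(1)] st_ne[unfolded Eq(1)] bs(3)[OF jb] refl
                R(2,1) MR Mne RA r])
      qed
      then show ?thesis
      proof
        \<comment> \<open>The piece of \<open>P\<close> cut off by the chord is out of sight:
          \<open>Q\<close> and the whole walk remain, and the cop on \<open>P\<close> is
          released.\<close>
        assume H: "\<forall>y\<in>?R. \<forall>x\<in>?A - {wlk P i, wlk P j}. \<not> adj y x"
        have "wins [i2 \<mapsto> Q, k \<mapsto> T, l \<mapsto> T] ?R"
        proof (rule spl[of Q c d 0 N])
          show "wlk Q c = w 0" using e w_pre[of 0] by simp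
          show "wlk Q d = w N" using e w_post[of N] IK ij Eq by (simp add: NK)
          show "x = c \<and> y = 0 \<or> x = d \<and> y = N"
            if "c \<le> x" "x \<le> d" "y \<le> N" "y \<le> I \<or> K \<le> y" "wlk Q x = w y" for x y
          proof (cases "y \<le> I")
            case True
            then have "wlk P (a + y) = wlk Q x" "a + y \<le> b" "a + y \<noteq> b" using that w_pre[of y] ij by (auto simp: I_def)
            then show ?thesis using bigonD[OF bg, of "a + y" x] that by auto
          next
            case False
            then have "K \<le> y" using that by simp
            then have "wlk P (j + (y - K)) = wlk Q x" "j + (y - K) \<le> b" "j + (y - K) \<noteq> a" "a \<le> j + (y - K)"
              using that w_post[of y] ij Eq by (auto simp: NK)
            then have "j + (y - K) = b \<and> x = d" using bigonD[OF bg, of "j + (y - K)" x] that by auto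
            then show ?thesis using that \<open>K \<le> y\<close> Eq ij by (auto simp: NK)
          qed
          show "x \<in> seg Q c d \<or> x \<in> w ` {0..N}" if "y \<in> ?R" "adj y x" "x \<in> seg P a b \<union> seg Q c d" for x y
          proof -
            have "w I \<in> w ` {0..N}" "w K \<in> w ` {0..N}" using IK by simp_all
            then have "wlk P i \<in> w ` {0..N}" "wlk P j \<in> w ` {0..N}" using wI wK Eq by simp_all
            moreover have "seg P a i \<subseteq> w ` {0..N}" "seg P j b \<subseteq> w ` {0..N}"
              using preI postI IK Eq by (auto intro!: subset_trans[OF preI] subset_trans[OF postI] image_mono)
            ultimately show ?thesis using that H split3[of i j] by blast
          qed
        qed (use Q st sQ R IK in auto)
        then show ?thesis using ix by (intro exI[of _ "[i2 \<mapsto> Q, k \<mapsto> T, l \<mapsto> T]"]) (auto simp: map_le_def)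
      next
        \<comment> \<open>Only the chord and the piece of \<open>P\<close> that it cuts off remain;
          the cop on \<open>Q\<close> is released.\<close>
        assume H: "\<forall>y\<in>?R. \<forall>x\<in>?B - {wlk P i, wlk P j}. \<not> adj y x"
        have "wins [i1 \<mapsto> P, k \<mapsto> T, l \<mapsto> T] ?R"
        proof (rule spl[of P i j I K])
          show "strict_on R P i j" using strict_on_mono[OF st(1)] ij jb by blast
          show "is_seg P i j" using sP ij jb True inj_on_subset[of "wlk P" "{a..b}" "{i..j}"] by (auto simp: is_seg_def)
          show "R \<inter> seg P i j = {}" using R sA by blast
          show "x = i \<and> y = I \<or> x = j \<and> y = K"
            if "i \<le> x" "x \<le> j" "y \<le> N" "y \<le> I \<or> K \<le> y" "wlk P x = w y" for x y
          proof (cases "y \<le> I")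
            case True
            then have "wlk P (a + y) = wlk P x" "a + y \<le> x" using that w_pre[of y] ij by (auto simp: I_def)
            then have "a + y = x" using injP[of "a + y" x] that jb by fastforce
            then show ?thesis using that True ij by (auto simp: I_def)
          next
            case False
            then have "K \<le> y" using that by simp
            then have "wlk P (j + (y - K)) = wlk P x" "j + (y - K) \<le> b"
              using that w_post[of y] ij Eq by (auto simp: NK)
            then have "j + (y - K) = x" using injP[of x "j + (y - K)"] that ij by fastforce
            then show ?thesis using that \<open>K \<le> y\<close> by auto
          qed
          show "x \<in> seg P i j \<or> x \<in> w ` {I..K}" if "y \<in> ?R" "adj y x" "x \<in> seg P a b \<union> seg Q c d" for x y
          proof -
            have "wlk P i \<in> seg P i j" "wlk P j \<in> seg P i j" using ij True by (auto intro!: seg_mem)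
            then show ?thesis using that H split3[of i j] by blast
          qed
        qed (use P wI wK Eq IK in auto)
        then show ?thesis using ix by (intro exI[of _ "[i1 \<mapsto> P, k \<mapsto> T, l \<mapsto> T]"]) (auto simp: map_le_def)
      qed
    next
      case False
      then have Eq: "E = Q" "ea = c" "eb = d" using E by auto
      have jc: "c < j" "j \<le> d" using ij Eq by auto
      note bs = bigon_arcs_opp[OF bg P Q ij(1,2) jc]
      let ?A = "seg P i b \<union> seg Q j d" and ?B = "seg P a i \<union> seg Q c j"
      have sA: "seg P i b \<subseteq> seg P a b" "seg P a i \<subseteq> seg P a b" "seg Q j d \<subseteq> seg Q c d" "seg Q c j \<subseteq> seg Q c d"
        using ij jc by (simp_all add: seg_sub)
      have cov: "seg P a b \<subseteq> seg P a i \<union> seg P i b" "seg Q c d \<subseteq> seg Q c j \<union> seg Q j d"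
        using seg_cover by blast+
      have injQ: "wlk Q x \<noteq> wlk Q y" if "c \<le> x" "x < y" "y \<le> d" for x y
        using injE[of x y] that Eq by simp
      have bgD: "x = a \<and> y = c \<or> x = b \<and> y = d" if "a \<le> x" "x \<le> b" "c \<le> y" "y \<le> d" "wlk P x = wlk Q y" for x y
        using bigonD[OF bg that] .
      have "(\<forall>y\<in>?R. \<forall>x\<in>?A - {wlk P i, wlk Q j}. \<not> adj y x) \<or> (\<forall>y\<in>?R. \<forall>x\<in>?B - {wlk P i, wlk Q j}. \<not> adj y x)"
      proof -
        have RA: "R \<inter> ?A = {}" "R \<inter> ?B = {}" using R(3,4) sA by blast+
        show ?thesis
          by (rule chord_side[OF bs(1,2) pC[unfolded Eq(1)] bs(4,3) refl R(2,1) MR Mne RA r])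
      qed
      then show ?thesis
      proof
        \<comment> \<open>The final parts of both sides are out of sight; \<open>Q\<close> up to
          \<open>j\<close> and \<open>w\<close> up to \<open>K\<close> form the bigon.\<close>
        assume H: "\<forall>y\<in>?R. \<forall>x\<in>?A - {wlk P i, wlk Q j}. \<not> adj y x"
        have "wins [i2 \<mapsto> Q, k \<mapsto> T, l \<mapsto> T] ?R"
        proof (rule spl[of Q c j 0 K])
          show "strict_on R Q c j" using strict_on_mono[OF st(2)] jc by blast
          show "is_seg Q c j" using sQ jc inj_on_subset[of "wlk Q" "{c..d}" "{c..j}"] by (auto simp: is_seg_def)
          show "R \<inter> seg Q c j = {}" using R sA by blast
          show "wlk Q c = w 0" using e w_pre[of 0] by simp
          show "wlk Q j = w K" using wK Eq by simp
          show "x = c \<and> y = 0 \<or> x = j \<and> y = K"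
            if "c \<le> x" "x \<le> j" "y \<le> N" "y \<le> I \<or> K \<le> y" "wlk Q x = w y" for x y
          proof (cases "y \<le> I")
            case True
            then have "wlk P (a + y) = wlk Q x" "a + y \<le> b" "a + y \<noteq> b" using that w_pre[of y] ij by (auto simp: I_def)
            then show ?thesis using bgD[of "a + y" x] that jc by auto
          next
            case False
            then have "K \<le> y" using that by simp
            then have "wlk Q (j + (y - K)) = wlk Q x" "j + (y - K) \<le> d"
              using that w_post[of y] ij Eq by (auto simp: NK)
            then have "j + (y - K) = x" using injQ[of x "j + (y - K)"] that jc by fastforce
            then show ?thesis using that \<open>K \<le> y\<close> by auto
          qed
          show "x \<in> seg Q c j \<or> x \<in> w ` {0..K}" if "y \<in> ?R" "adj y x" "x \<in> seg P a b \<union> seg Q c d" for x y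
          proof -
            have "w I \<in> w ` {0..K}" using IK by simp
            then have "wlk P i \<in> w ` {0..K}" "wlk Q j \<in> seg Q c j" using jc wI by (simp_all add: seg_mem)
            moreover have "seg P a i \<subseteq> w ` {0..K}"
              using IK by (intro subset_trans[OF preI] image_mono) auto
            ultimately show ?thesis using that H cov by blast
          qed
        qed (use Q IK in auto)
        then show ?thesis using ix by (intro exI[of _ "[i2 \<mapsto> Q, k \<mapsto> T, l \<mapsto> T]"]) (auto simp: map_le_def)
      next
        \<comment> \<open>The initial parts are out of sight; \<open>P\<close> from \<open>i\<close>
          on and \<open>w\<close> from \<open>I\<close> on form the bigon.\<close>
        assume H: "\<forall>y\<in>?R. \<forall>x\<in>?B - {wlk P i, wlk Q j}. \<not> adj y x"
        have "wins [i1 \<mapsto> P, k \<mapsto> T, l \<mapsto> T] ?R"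
        proof (rule spl[of P i b I N])
          show "strict_on R P i b" using strict_on_mono[OF st(1)] ij by blast
          show "is_seg P i b" using sP ij inj_on_subset[of "wlk P" "{a..b}" "{i..b}"] by (auto simp: is_seg_def)
          show "R \<inter> seg P i b = {}" using R sA by blast
          show "wlk P i = w I" using wI by simp
          show "wlk P b = w N" using e w_post[of N] IK ij Eq by (simp add: NK)
          show "x = i \<and> y = I \<or> x = b \<and> y = N"
            if "i \<le> x" "x \<le> b" "y \<le> N" "y \<le> I \<or> K \<le> y" "wlk P x = w y" for x y
          proof (cases "y \<le> I")
            case True
            then have "wlk P (a + y) = wlk P x" "a + y \<le> x" using that w_pre[of y] ij by (auto simp: I_def)
            then have "a + y = x" using injP[of "a + y" x] that by fastforce
            then show ?thesis using that True ij by (auto simp: I_def)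
          next
            case False
            then have "K \<le> y" using that by simp
            then have "wlk P x = wlk Q (j + (y - K))" "j + (y - K) \<le> d" "j + (y - K) \<noteq> c" "c \<le> j + (y - K)"
              using that w_post[of y] jc Eq by (auto simp: NK)
            then have "x = b \<and> j + (y - K) = d" using bgD[of x "j + (y - K)"] that ij by auto
            then show ?thesis using that \<open>K \<le> y\<close> Eq jc by (auto simp: NK)
          qed
          show "x \<in> seg P i b \<or> x \<in> w ` {I..N}" if "y \<in> ?R" "adj y x" "x \<in> seg P a b \<union> seg Q c d" for x y
          proof -
            have "w K \<in> w ` {I..N}" using IK by simp
            then have "wlk P i \<in> seg P i b" "wlk Q j \<in> w ` {I..N}" using ij wK Eq by (simp_all add: seg_mem)
            moreover have "w ` {K..N} \<subseteq> w ` {I..N}"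
              using IK by (intro image_mono) auto
            then have "seg Q j d \<subseteq> w ` {I..N}"
              using postI Eq by simp
            ultimately show ?thesis using that H cov by blast
          qed
        qed (use P IK in auto)
        then show ?thesis using ix by (intro exI[of _ "[i1 \<mapsto> P, k \<mapsto> T, l \<mapsto> T]"]) (auto simp: map_le_def)
      qed
    qed
  qed
  \<comment> \<open>On the chord the robber meets one of the pair; elsewhere he is in a component,
    where state B on a smaller set takes over.\<close>
  have w2: "wins (?J(k \<mapsto> T, l \<mapsto> T)) R"
    unfolding wins_def
  proof (intro allI impI)
    fix \<tau> cs r assume i: "guarding (?J(k \<mapsto> T, l \<mapsto> T)) R \<tau> cs r"
    show "robber_loses cs r"
    proof (cases "r \<in> M")
      case True
      then obtain x where x: "r = w x" "x \<le> N" using IK by (auto simp: M_def)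
      have "r \<in> R" using True MR by blast
      then have "wlk T (lev T r) = r" using T(1) T(5)[of x] x by simp
      then show ?thesis
        using pair_on_path[OF i, of k T l] ix by simp
    next
      case False
      then have r: "r \<in> R - M" using i by (simp add: guarding_def)
      then obtain J' where "J' \<subseteq>\<^sub>m ?J(k \<mapsto> T, l \<mapsto> T)" "wins J' (comp_of (R - M) r)"
        using comp by blast
      then show ?thesis using robber_loses_restrict[OF i comp_self] by blast
    qed
  qed
  have J: "?J i1 = Some P" "?J i2 = Some Q" "(?J(k \<mapsto> T)) i1 = Some P" "(?J(k \<mapsto> T)) i2 = Some Q"
      "?J k = None" "(?J(k \<mapsto> T)) l = None"
    using ix(5) by simp_all
  have tr: "tracks_on R ?J" "tracks_on R (?J(k \<mapsto> T))"
    using P Q T(3) ix unfolding tracks_on_def by (auto split: if_splits)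
  have w1: "wins (?J(k \<mapsto> T)) R"
    by (rule wins_add[OF tr(2) T(3) ix(4) J(6) safe[OF _ J(3,4)] w2 map_le_refl])
  show ?thesis
    by (rule wins_add[OF tr(1) T(3) ix(3) J(5) safe[OF _ J(1,2)] w1 map_le_refl])
qed

lemma attached_exists:
  assumes "territory R B" "R \<noteq> {}" "R \<noteq> V"
  obtains r q where "r \<in> R" "q \<in> B" "adj r q"
proof -
  have "R \<subseteq> V" using assms(1) by (simp add: territory_def)
  then obtain r q where "r \<in> R" "q \<in> V - R" "adj r q"
    using con_boundary[OF conV _ assms(2,3)] by blast
  then show thesis
    using assms(1) that unfolding territory_def by blast
qed

text \<open>Two attached boundary vertices are joined by a walk through \<open>R\<close>, so there
  is a chord. With only one, the territory hangs on it and both guards can be given up for one cop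
  on an edge.\<close>

lemma A_step:
  assumes B: "\<And>R'. R' \<subset> R \<Longrightarrow> winB R'" and E: "\<And>R'. R' \<subset> R \<Longrightarrow> winE R'"
  shows "winA R"
  unfolding winA_def
proof (intro allI impI)
  fix P a b Q c d and i0 j0 :: nat
  assume reg: "region R P a b Q c d" and st: "strict_on R P a b" "strict_on R Q c d" and ij0: "i0 < 4" "j0 < 4" "i0 \<noteq> j0"
  have bg: "bigon P a b Q c d" and te: "territory R (seg P a b \<union> seg Q c d)" and P: "track_on R P" and Q: "track_on R Q"
    using reg unfolding region_def by auto
  have sP: "is_seg P a b" and sQ: "is_seg Q c d" and e: "wlk P a = wlk Q c" "wlk P b = wlk Q d"
    using bg unfolding bigon_def by auto
  have R: "R \<subseteq> V" "con R" "R \<inter> seg P a b = {}" "R \<inter> seg Q c d = {}"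
    using te unfolding territory_def by auto
  have ab: "a < b" "b \<le> len P" "c < d" "d \<le> len Q" using sP sQ by (auto simp: is_seg_def)
  have safe: "\<exists>i<4. cs i = r' \<or> adj (cs i) r'"
    if i: "guarding J R \<tau> cs r" "J i = Some P" "J j = Some Q" and r': "adj r r'" "r' \<notin> R" for i j J \<tau> cs r r'
  proof -
    have "r' \<in> seg P a b \<union> seg Q c d" using te i(1) r' unfolding territory_def guarding_def by blast
    then show ?thesis
      using strict_safe[OF i(1,2) P st(1) ab(2) r'(1)] strict_safe[OF i(1,3) Q st(2) ab(4) r'(1)] by blast
  qed
  define att where "att x \<longleftrightarrow> x \<in> seg P a b \<union> seg Q c d \<and> (\<exists>r\<in>R. adj r x)" for x
  show "wins [i0 \<mapsto> P, j0 \<mapsto> Q] R"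
  proof (rule opposite_spares[OF P Q _ _ ij0])
    show "\<exists>i<4. cs i = r' \<or> adj (cs i) r'"
      if "i < 4" "j < 4" "i \<noteq> j" "guarding [i \<mapsto> P, j \<mapsto> Q] R \<tau> cs r" "adj r r'" "r' \<notin> R" for i j \<tau> cs r r'
      using safe[OF that(4), of i j] that by simp
  next
    fix i j k l :: nat
    assume ix: "i < 4" "j < 4" "k < 4" "l < 4" "distinct [i, j, k, l]" "odd (k + l)"
    show "wins [i \<mapsto> P, j \<mapsto> Q] R"
    proof (cases "\<exists>x y. att x \<and> att y \<and> x \<noteq> y")
      case True
      then obtain x y rx ry where x: "x \<in> seg P a b \<union> seg Q c d" "rx \<in> R" "adj rx x"
        and y: "y \<in> seg P a b \<union> seg Q c d" "ry \<in> R" "adj ry y" and xy: "x \<noteq> y"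
        unfolding att_def by blast
      obtain m0 where "rwalk R rx ry m0" using con_rwalk[OF R(2) x(2) y(2)] by blast
      then have "rwalk R rx y (m0 + Suc 0)"
        using y by (intro rwalk_trans[of R rx ry]) (auto simp: rwalk_1)
      then have "rwalk R x y (Suc 0 + (m0 + Suc 0))"
        using x by (intro rwalk_trans[of R x rx]) (auto simp: rwalk_1 adj_commute)
      then have robber_loses: "rwalk R x y (m0 + 2)" by simp
      note robber_loses' = rwalk_sym[OF robber_loses]
      have m: "2 \<le> m0 + 2" by simp
      have ix': "j < 4" "i < 4" "k < 4" "l < 4" "distinct [j, i, k, l]" "odd (k + l)" using ix by auto
      have sw: "[j \<mapsto> Q, i \<mapsto> P] = [i \<mapsto> P, j \<mapsto> Q]" using ix(5) by (auto simp: fun_upd_twist)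
      have PP: "wins [i \<mapsto> P, j \<mapsto> Q] R" if "a \<le> s" "s < t" "t \<le> b" "rwalk R (wlk P s) (wlk P t) (m0 + 2)" for s t
        by (rule A_chord[where same = True and E = P and ea = a and eb = b and ?i0.0 = s and ?j0.0 = t and ?m0.0 = "m0 + 2",
              OF B reg st _ _ _ _ _ _ _ m ix]) (use that in auto)
      have PQ: "wins [i \<mapsto> P, j \<mapsto> Q] R" if "a \<le> s" "s < b" "c < t" "t \<le> d" "rwalk R (wlk P s) (wlk Q t) (m0 + 2)" for s t
        by (rule A_chord[where same = False and E = Q and ea = c and eb = d and ?i0.0 = s and ?j0.0 = t and ?m0.0 = "m0 + 2",
              OF B reg st _ _ _ _ _ _ _ m ix]) (use that in auto)
      have QQ: "wins [j \<mapsto> Q, i \<mapsto> P] R" if "c \<le> s" "s < t" "t \<le> d" "rwalk R (wlk Q s) (wlk Q t) (m0 + 2)" for s t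
        by (rule A_chord[where same = True and E = Q and ea = c and eb = d and ?i0.0 = s and ?j0.0 = t and ?m0.0 = "m0 + 2",
              OF B region_sym[OF reg] st(2,1) _ _ _ _ _ _ _ m ix']) (use that in auto)
      have QP: "wins [j \<mapsto> Q, i \<mapsto> P] R" if "c \<le> s" "s < d" "a < t" "t \<le> b" "rwalk R (wlk Q s) (wlk P t) (m0 + 2)" for s t
        by (rule A_chord[where same = False and E = P and ea = a and eb = b and ?i0.0 = s and ?j0.0 = t and ?m0.0 = "m0 + 2",
              OF B region_sym[OF reg] st(2,1) _ _ _ _ _ _ _ m ix']) (use that in auto)
      \<comment> \<open>A corner may have been named on the side that the ranges of
        \<open>A_chord\<close> exclude. It is then renamed, and the chord counts as one with both
        ends on the same side.\<close>
      have mixed: "wins [i \<mapsto> P, j \<mapsto> Q] R"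
        if s: "a \<le> s" "s \<le> b" and t: "c \<le> t" "t \<le> d" and w: "rwalk R (wlk P s) (wlk Q t) (m0 + 2)" and ne: "wlk P s \<noteq> wlk Q t" for s t
      proof -
        consider "s < b" "c < t" | "s = b" | "t = c" using s t by linarith
        then show ?thesis
        proof cases
          case 1
          then show ?thesis using PQ s t w by blast
        next
          case 2
          then have "t < d" using ne e t by (cases "t = d") auto
          moreover have "rwalk R (wlk Q t) (wlk Q d) (m0 + 2)" using rwalk_sym[OF w] 2 e by simp
          ultimately show ?thesis using QQ[of t d] t sw by simp
        next
          case 3
          then have "a < s" using ne e s by (cases "s = a") auto
          moreover have "rwalk R (wlk P a) (wlk P s) (m0 + 2)" using rwalk_sym[OF w] 3 e by simp
          ultimately show ?thesis using PP[of a s] s by simp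
        qed
      qed
      consider s t where "a \<le> s" "s \<le> b" "x = wlk P s" "a \<le> t" "t \<le> b" "y = wlk P t"
        | s t where "c \<le> s" "s \<le> d" "x = wlk Q s" "c \<le> t" "t \<le> d" "y = wlk Q t"
        | s t where "a \<le> s" "s \<le> b" "x = wlk P s" "c \<le> t" "t \<le> d" "y = wlk Q t"
        | s t where "a \<le> s" "s \<le> b" "y = wlk P s" "c \<le> t" "t \<le> d" "x = wlk Q t"
        using x(1) y(1) by (elim UnE segE) blast+
      then show ?thesis
      proof cases
        case 1
        then have "s \<noteq> t" using xy by blast
        then show ?thesis using 1 PP[of s t] PP[of t s] robber_loses robber_loses' by (cases "s < t") auto
      next
        case 2
        then have "s \<noteq> t" using xy by blast
        then show ?thesis using 2 QQ[of s t] QQ[of t s] robber_loses robber_loses' sw by (cases "s < t") auto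
      next
        case 3
        then show ?thesis using mixed[of s t] robber_loses xy by simp
      next
        case 4
        then show ?thesis using mixed[of s t] robber_loses' xy by simp
      qed
    next
      case False
      show ?thesis
      proof (cases "R = {}")
        case True
        then show ?thesis by (simp add: wins_def guarding_def)
      next
        case ne: False
        have "wlk P a \<in> seg P a b" using ab by (simp add: seg_mem)
        then have "R \<noteq> V" using R seg_V[OF P sP] by blast
        then obtain r0 q where q: "r0 \<in> R" "q \<in> seg P a b \<union> seg Q c d" "adj r0 q"
          using attached_exists[OF te ne] by blast
        have "territory R {q}"
          using te by (rule territory_cong) (use False q R in \<open>auto simp: att_def\<close>)
        moreover obtain \<kappa> where \<kappa>: "parity_at q \<kappa>" using parity_at_ex adjV2[OF q(3)] by blast
        ultimately have w: "wins [k \<mapsto> edge_track q r0 \<kappa>] R"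
          using edge_shrink[OF E _ q(1)] q(3) ix(3) adj_sym by blast
        show ?thesis
        proof (rule wins_add[OF _ _ ix(3) _ _ w])
          show "track_on R (edge_track q r0 \<kappa>)" using q(3) \<kappa> adj_sym by (intro track_on_edge) auto
          show "tracks_on R [i \<mapsto> P, j \<mapsto> Q]" using P Q ix by (simp add: tracks_on_def)
          show "[i \<mapsto> P, j \<mapsto> Q] k = None" using ix(5) by simp
          show "[k \<mapsto> edge_track q r0 \<kappa>] \<subseteq>\<^sub>m [i \<mapsto> P, j \<mapsto> Q, k \<mapsto> edge_track q r0 \<kappa>]"
            by (simp add: map_le_def)
          show "\<exists>i<4. cs i = r' \<or> adj (cs i) r'"
            if "guarding [i \<mapsto> P, j \<mapsto> Q] R \<tau> cs r" "adj r r'" "r' \<notin> R" for \<tau> cs r r'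
            using safe[OF that(1), of i j] that ix(5) by simp
        qed
      qed
    qed
  qed
qed

text \<open>The edge plays the part of the guarded side. If both its ends see \<open>R\<close>, the
  pair patrols a shortest walk from \<open>x\<close> to \<open>y\<close> through \<open>R\<close>,
  and edge and walk form a bigon; otherwise the territory hangs on one end.\<close>

lemma E_step:
  assumes B: "\<And>R'. R' \<subset> R \<Longrightarrow> winB R'" and E: "\<And>R'. R' \<subset> R \<Longrightarrow> winE R'"
  shows "winE R"
  unfolding winE_def
proof (intro allI impI)
  fix x y \<kappa> and i :: nat
  assume te: "territory R {x, y}" and xy: "adj x y" and \<kappa>: "parity_at x \<kappa>" and i: "i < 4"
  let ?P = "edge_track x y \<kappa>"
  have P: "track_on R ?P" using xy \<kappa> by (rule track_on_edge)
  have lP: "len ?P = 1" by (simp add: edge_track_def)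
  have R: "R \<subseteq> V" "con R" "x \<notin> R" "y \<notin> R" using te unfolding territory_def by auto
  have V: "x \<in> V" "y \<in> V" using xy adjV adjV2 by auto
  have safe: "\<exists>i<4. cs i = r' \<or> adj (cs i) r'"
    if "guarding J R \<tau> cs r" "J i = Some ?P" and r': "adj r r'" "r' \<notin> R" for J \<tau> cs r r'
  proof -
    have "r' \<in> seg ?P 0 1" using te that(1) r' unfolding territory_def guarding_def seg_edge by blast
    then show ?thesis
      using strict_safe[OF that(1,2) P strict_on_edge _ r'(1)] lP by simp
  qed
  show "wins [i \<mapsto> ?P] R"
  proof (cases "R = {}")
    case True
    then show ?thesis by (simp add: wins_def guarding_def)
  next
    case ne: False
    show ?thesis
    proof (cases "(\<exists>r\<in>R. adj r x) \<and> (\<exists>r\<in>R. adj r y)")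
      case False
      have "R \<noteq> V" using R V by blast
      then obtain r0 q where q: "r0 \<in> R" "q \<in> {x, y}" "adj r0 q"
        using attached_exists[OF te ne] by blast
      have "territory R {q}"
        using te by (rule territory_cong) (use False q R in auto)
      moreover obtain \<mu> where \<mu>: "parity_at q \<mu>" using parity_at_ex adjV2[OF q(3)] by blast
      moreover obtain k where k: "k < 4" "k \<noteq> i" using exists_spare[OF i] by blast
      ultimately have w: "wins [k \<mapsto> edge_track q r0 \<mu>] R"
        using edge_shrink[OF E _ q(1)] q(3) adj_sym by blast
      show ?thesis
      proof (rule wins_add[OF _ _ k(1) _ _ w])
        show "track_on R (edge_track q r0 \<mu>)" using q(3) \<mu> adj_sym by (intro track_on_edge) auto
        show "tracks_on R [i \<mapsto> ?P]" using P i by (simp add: tracks_on_def)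
        show "[i \<mapsto> ?P] k = None" using k by simp
        show "[k \<mapsto> edge_track q r0 \<mu>] \<subseteq>\<^sub>m [i \<mapsto> ?P, k \<mapsto> edge_track q r0 \<mu>]"
          by (simp add: map_le_def)
        show "\<exists>i<4. cs i = r' \<or> adj (cs i) r'"
          if "guarding [i \<mapsto> ?P] R \<tau> cs r" "adj r r'" "r' \<notin> R" for \<tau> cs r r'
          using safe[OF that(1)] that by simp
      qed
    next
      case True
      then obtain rx ry where r: "rx \<in> R" "adj rx x" "ry \<in> R" "adj ry y" by blast
      obtain m0 where "rwalk R rx ry m0" using con_rwalk[OF R(2) r(1,3)] by blast
      then have "rwalk R rx y (m0 + Suc 0)"
        using r by (intro rwalk_trans[of R rx ry]) (auto simp: rwalk_1)
      then have "rwalk R x y (Suc 0 + (m0 + Suc 0))"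
        using r by (intro rwalk_trans[of R x rx]) (auto simp: rwalk_1 adj_commute)
      then have ex: "rwalk R x y (m0 + 2) \<and> 2 \<le> m0 + 2" by simp
      \<comment> \<open>The bound \<open>2 \<le> m\<close> keeps the edge from \<open>x\<close> to
        \<open>y\<close> itself out of the competition.\<close>
      define K where "K = (LEAST m. rwalk R x y m \<and> 2 \<le> m)"
      have K: "rwalk R x y K" "2 \<le> K"
        using LeastI[of "\<lambda>m. rwalk R x y m \<and> 2 \<le> m", OF ex] unfolding K_def by auto
      have Kmin: "K \<le> m" if "rwalk R x y m" "2 \<le> m" for m
        unfolding K_def using that by (intro Least_le) simp
      obtain w where w: "w 0 = x" "w K = y" "\<And>c. c < K \<Longrightarrow> adj (w c) (w (Suc c))" "\<And>c. 0 < c \<Longrightarrow> c < K \<Longrightarrow> w c \<in> R"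
        using K(1) unfolding rwalk_def by blast
      have geo: "t \<le> s + d1 + d2"
        if q: "q \<in> R" and st: "s \<le> K" "t \<le> K" and robber_loses: "rwalk R q (w s) d1" "rwalk R q (w t) d2" for q s t d1 d2
      proof (rule ccontr)
        assume lt: "\<not> t \<le> s + d1 + d2"
        then have s: "s < K" "0 < t" using st by auto
        have 1: "rwalk R x q (s + d1)"
        proof (cases "s = 0")
          case True
          then show ?thesis using rwalk_sym[OF robber_loses(1)] w(1) by simp
        next
          case False
          have "rwalk R (w 0) (w s) (s - 0)"
            using s w(3,4) by (intro rwalk_sub) auto
          then show ?thesis using rwalk_sym[OF robber_loses(1)] w False s by (intro rwalk_trans[of R x "w s"]) auto
        qed
        have 2: "rwalk R q y (d2 + (K - t))"
        proof (cases "t = K")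
          case True
          then show ?thesis using robber_loses(2) w(2) by simp
        next
          case False
          have "rwalk R (w t) (w K) (K - t)"
            using s st w(3,4) by (intro rwalk_sub) auto
          then show ?thesis using robber_loses(2) w False s st by (intro rwalk_trans[of R q "w t"]) auto
        qed
        have "x \<noteq> q" "q \<noteq> y" using q R by auto
        then have "2 \<le> (s + d1) + (d2 + (K - t))" using rwalk_pos[OF 1] rwalk_pos[OF 2] by simp
        then have "K \<le> (s + d1) + (d2 + (K - t))"
          using Kmin rwalk_trans[OF 1 2 q] by blast
        then show False using lt st by linarith
      qed
      have N1: "1 \<le> K" and w0: "w 0 \<notin> R" and \<kappa>': "parity_at (w 0) \<kappa>" using K w R \<kappa> by auto
      obtain T where T: "wlk T = w" "len T = K" "track_on R T"
          "\<And>r c. r \<in> R \<Longrightarrow> c \<le> K \<Longrightarrow> adj r (w c) \<Longrightarrow> lev T r \<le> c + 1 \<and> c \<le> lev T r + 1"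
          "\<And>c. c \<le> K \<Longrightarrow> w c \<in> R \<Longrightarrow> lev T (w c) = c" "desc_on R T 0 K"
      proof (rule canonical_track[of K w \<kappa> R, OF N1 _ \<kappa>' w0])
        show "adj (w x) (w (Suc x))" if "x < K" for x by (rule w(3)[OF that])
        show "y \<le> x + d1 + d2"
          if "r \<in> R" "x \<le> K" "y \<le> K" "rwalk R r (w x) d1" "rwalk R r (w y) d2" for r x y d1 d2
          by (rule geo[OF that])
      qed (rule that)
      have neq: "w s \<noteq> w t" if "s < t" "t \<le> K" for s t
      proof
        assume eq: "w s = w t"
        show False
        proof (cases "w s \<in> R")
          case True
          then show False using T(5)[of s] T(5)[of t] eq that by simp
        next
          case False
          have s: "s = 0" using False w(4)[of s] that by (metis gr0I less_le_trans)
          have "t = K"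
          proof (rule ccontr)
            assume "t \<noteq> K"
            then have "w t \<in> R" using w(4)[of t] that by linarith
            then show False using False eq by simp
          qed
          then show False using s eq w(1,2) xy adj_irrefl by simp
        qed
      qed
      have inj: "inj_on w {0..K}"
        using neq by (auto intro!: linorder_inj_onI)
      define M where "M = w ` {0<..<K}"
      have MR: "M \<subseteq> R" using w(4) by (auto simp: M_def)
      have out: "w c \<notin> R" if "c \<le> 0 \<or> K \<le> c" "c \<le> K" for c
        using that w R by (cases "c = 0") auto
      have sP: "is_seg ?P 0 1" using xy adj_irrefl by (auto simp: is_seg_def edge_track_def inj_on_def)
      \<comment> \<open>One of the pairs 0, 1 and 2, 3 avoids \<open>i\<close>, and each consists of
        opposite parities.\<close>
      obtain k l where kl: "k < 4" "l < 4" "distinct [i, k, l]" "odd (k + l)"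
      proof -
        have "i \<in> {0,1,2,3}" using i by auto
        then show thesis
          using that[of 0 1] that[of 2 3] by fastforce
      qed
      have comp: "wins [i \<mapsto> ?P, k \<mapsto> T, l \<mapsto> T] (comp_of (R - M) r)" if r: "r \<in> R - M" for r
      proof -
        have wp: "wlk ?P 0 = w 0" "wlk ?P 1 = w K" using w by (auto simp: edge_track_def)
        have PR: "seg ?P 0 1 \<inter> R = {}" using R seg_edge by auto
        have int: "c = 0 \<and> d = 0 \<or> c = 1 \<and> d = K"
          if "c \<in> {0..1}" "d \<le> K" "d \<le> 0 \<or> K \<le> d" "wlk ?P c = w d" for c d
        proof -
          have "c = 0 \<or> c = 1" using that(1) by auto
          then show ?thesis using that(2-) wp neq[of 0 K] N1 by (cases "d = 0") auto
        qed
        have nb: "v \<in> seg ?P 0 1 \<union> seg T 0 K" if "u \<in> comp_of (R - M) r" "adj u v" "v \<in> {x, y}" for u v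
          using that(3) seg_edge by auto
        have K2: "0 + 1 < K" using K by simp
        have wK: "w 0 \<notin> R" "w K \<notin> R" using out[of 0] out[of K] by simp_all
        have q: "0 \<le> (0::nat)" "K \<le> K" by simp_all
        have ixs: "i < 4" "k < 4" "l < 4" "distinct [i, k, l]" "odd (k + l)" using i kl by auto
        show ?thesis
          by (rule split_B[OF B T(3) T(4)[folded T(1,2)] T(5)[folded T(1,2)] T(6)[folded T(2)] inj[folded T(1,2)]
              M_def[folded T(1,2)] MR K2[folded T(2)] q(2)[folded T(2)] wK[folded T(1,2)] out[folded T(1,2)]
              P strict_on_edge sP PR q[folded T(2)] q(2)[folded T(2)] wp[folded T(1,2)] int[folded T(1,2)] te r nb[folded T(2)] ixs])
      qed
      have w2: "wins [i \<mapsto> ?P, k \<mapsto> T, l \<mapsto> T] R"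
        unfolding wins_def
      proof (intro allI impI)
        fix \<tau> cs r assume guarding: "guarding [i \<mapsto> ?P, k \<mapsto> T, l \<mapsto> T] R \<tau> cs r"
        show "robber_loses cs r"
        proof (cases "r \<in> M")
          case True
          then obtain s where s: "r = w s" "s \<le> K" by (auto simp: M_def)
          have "r \<in> R" using True MR by blast
          then have "wlk T (lev T r) = r" using T(1) T(5)[of s] s by simp
          then show ?thesis
            using pair_on_path[OF guarding, of k T l] kl by simp
        next
          case False
          then have r: "r \<in> R - M" using guarding by (simp add: guarding_def)
          show ?thesis by (rule robber_loses_restrict[OF guarding comp_self comp[OF r] map_le_refl])
        qed
      qed
      have J: "[i \<mapsto> ?P] i = Some ?P" "[i \<mapsto> ?P, k \<mapsto> T] i = Some ?P" "[i \<mapsto> ?P] k = None" "[i \<mapsto> ?P, k \<mapsto> T] l = None"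
        using kl(3) by simp_all
      have tr: "tracks_on R [i \<mapsto> ?P]" "tracks_on R [i \<mapsto> ?P, k \<mapsto> T]"
        using P T(3) i kl unfolding tracks_on_def by (auto split: if_splits)
      have w1: "wins [i \<mapsto> ?P, k \<mapsto> T] R"
        by (rule wins_add[OF tr(2) T(3) kl(2) J(4) safe[where J = "[i \<mapsto> ?P, k \<mapsto> T]", OF _ J(2)] w2 map_le_refl])
      show ?thesis
        by (rule wins_add[OF tr(1) T(3) kl(1) J(3) safe[where J = "[i \<mapsto> ?P]", OF _ J(1)] w1 map_le_refl])
    qed
  qed
qed

section \<open>Ties and lenses\<close>

text \<open>A tie is a detour through \<open>R\<close> exactly as long as the piece of the walk that it bypasses; ties are
  what keeps a single cop on \<open>S\<close> from guarding the walk.\<close>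

definition tie :: "'a set \<Rightarrow> 'a track \<Rightarrow> nat \<Rightarrow> nat \<Rightarrow> nat \<Rightarrow> (nat \<Rightarrow> 'a) \<Rightarrow> bool" where
  "tie R S c \<beta> \<alpha> t \<longleftrightarrow> c \<le> \<alpha> \<and> \<alpha> + 1 < \<beta> \<and> t \<alpha> = wlk S \<alpha> \<and> t \<beta> = wlk S \<beta> \<and>
     (\<forall>x. \<alpha> < x \<longrightarrow> x < \<beta> \<longrightarrow> t x \<in> R \<and> lev S (t x) = x) \<and> (\<forall>x. \<alpha> \<le> x \<longrightarrow> x < \<beta> \<longrightarrow> adj (t x) (t (Suc x)))"

text \<open>The union of the components of \<open>R\<close> minus the tie that see an inner vertex
  of the bypassed piece. That they see no boundary vertex off this piece is a consequence of
  planarity, proved in \<open>lens_nb\<close>.\<close>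

definition lens :: "'a set \<Rightarrow> 'a track \<Rightarrow> nat \<Rightarrow> nat \<Rightarrow> (nat \<Rightarrow> 'a) \<Rightarrow> 'a set" where
  "lens R S \<beta> \<alpha> t = {r \<in> R - t ` {\<alpha><..<\<beta>}.
     \<exists>y\<in>comp_of (R - t ` {\<alpha><..<\<beta>}) r. \<exists>x. \<alpha> < x \<and> x < \<beta> \<and> adj y (wlk S x)}"

text \<open>Iterates \<open>desc_on\<close> inside \<open>K\<close>. The descent \<open>s\<close> is
  indexed by level, so it fits into a tie as it stands. It stops at some level \<open>m\<close>, on
  the walk at position \<open>m\<close> or in \<open>M\<close>, through which alone \<open>K\<close>
  can be left within \<open>R\<close>.\<close>

lemma descend:
  assumes de: "desc_on R S c d" and K: "K \<subseteq> R" "\<forall>y\<in>K. \<forall>z\<in>R. adj y z \<longrightarrow> z \<in> K \<union> M"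
    and r: "r \<in> K" "lev S r < len S"
  shows "\<exists>m s. m < lev S r \<and> s (lev S r) = r \<and> (\<forall>x. m < x \<longrightarrow> x \<le> lev S r \<longrightarrow> s x \<in> K \<and> lev S (s x) = x) \<and>
    (\<forall>x. m \<le> x \<longrightarrow> x < lev S r \<longrightarrow> adj (s x) (s (Suc x))) \<and>
    (s m = wlk S m \<and> c \<le> m \<and> m \<le> d \<or> s m \<in> M \<and> lev S (s m) = m)"
  using r
proof (induction "lev S r" arbitrary: r)
  case 0
  have "r \<in> R" using 0(2) K(1) by blast
  then show ?case using de 0 unfolding desc_on_def by fastforce
next
  case (Suc h)
  have rR: "r \<in> R" using Suc.prems(1) K(1) by blast
  have base: ?case if "adj r q" "q = wlk S h \<and> c \<le> h \<and> h \<le> d \<or> q \<in> M \<and> lev S q = h" for q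
    using that Suc.prems(1) Suc.hyps(2)
    by (intro exI[of _ h] exI[of _ "\<lambda>x. if x = h then q else r"]) (auto simp: adj_commute le_Suc_eq)
  consider r' where "r' \<in> R" "adj r r'" "lev S r = Suc (lev S r')"
    | e where "e \<in> {c..d}" "adj r (wlk S e)" "lev S r = Suc e"
    using de rR Suc.prems(2) unfolding desc_on_def by blast
  then show ?case
  proof cases
    case 1
    then have h: "h = lev S r'" using Suc.hyps(2) by simp
    show ?thesis
    proof (cases "r' \<in> K")
      case True
      obtain m s where s: "m < lev S r'" "s (lev S r') = r'"
          "\<And>x. m < x \<Longrightarrow> x \<le> lev S r' \<Longrightarrow> s x \<in> K \<and> lev S (s x) = x"
          "\<And>x. m \<le> x \<Longrightarrow> x < lev S r' \<Longrightarrow> adj (s x) (s (Suc x))"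
          "s m = wlk S m \<and> c \<le> m \<and> m \<le> d \<or> s m \<in> M \<and> lev S (s m) = m"
        using Suc.hyps(1)[OF h True] 1(3) Suc.prems(2) by auto
      let ?s = "s(lev S r := r)"
      have "adj (?s x) (?s (Suc x))" if "m \<le> x" "x < lev S r" for x
        using that s(1,2,4) 1(2,3) by (cases "x = lev S r'") (auto simp: adj_commute)
      moreover have "?s x \<in> K \<and> lev S (?s x) = x" if "m < x" "x \<le> lev S r" for x
        using that s(3)[of x] 1(3) Suc.prems(1) by (cases "x = lev S r") auto
      ultimately show ?thesis
        using s(1,5) 1(3) by (intro exI[of _ m] exI[of _ ?s]) auto
    next
      case False
      then have "r' \<in> M" using K(2) Suc.prems(1) 1(1,2) by blast
      then show ?thesis using base[of r'] 1(2) h by simp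
    qed
  next
    case 2
    then have "h = e" using Suc.hyps(2) by simp
    then show ?thesis using base[of "wlk S e"] 2 by simp
  qed
qed

end

text \<open>No position before \<open>\<beta>\<close> is threatened from the level just below it,
  which is the defect of a lone cop; and no tie that ends at \<open>\<beta>\<close> starts after
  \<open>\<alpha>\<close>. A tie from \<open>\<alpha>\<close> to \<open>\<beta>\<close> is thus the
  shortest one with its end.\<close>

locale tie_game = planar_game +
  fixes R P a b S c d \<alpha> \<beta>
  assumes reg: "region R P a b S c d" and stP: "strict_on R P a b" and wkS: "weak_on R S c d" and deS: "desc_on R S c d"
    and \<beta>d: "\<beta> \<le> d"
    and \<beta>_min: "\<And>e r. c \<le> e \<Longrightarrow> e < \<beta> \<Longrightarrow> r \<in> R \<Longrightarrow> adj r (wlk S e) \<Longrightarrow> Suc (lev S r) \<noteq> e"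
    and \<alpha>_max: "\<And>\<alpha>' t. tie R S c \<beta> \<alpha>' t \<Longrightarrow> \<alpha>' \<le> \<alpha>"
begin

abbreviation "w \<equiv> wlk S"
abbreviation "g \<equiv> lev S"
abbreviation "arc2 \<equiv> seg S c \<alpha> \<union> seg P a b \<union> seg S \<beta> d"

lemma basic:
  "bigon S c d P a b" "territory R (seg P a b \<union> seg S c d)" "track_on R P" "track_on R S" "is_seg S c d" "is_seg P a b"
  "R \<subseteq> V" "con R" "R \<inter> seg P a b = {}" "R \<inter> seg S c d = {}" "d \<le> len S" "b \<le> len P" "c < d" "a < b"
proof -
  have r: "territory R (seg P a b \<union> seg S c d)" "bigon P a b S c d" "track_on R P" "track_on R S"
    using reg unfolding region_def by simp_all
  then show "bigon S c d P a b" "territory R (seg P a b \<union> seg S c d)" "track_on R P" "track_on R S"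
    by (simp_all add: bigon_sym)
  show "is_seg S c d" "is_seg P a b"
    using r(2) unfolding bigon_def by simp_all
  then show "d \<le> len S" "b \<le> len P" "c < d" "a < b"
    unfolding is_seg_def by simp_all
  show "R \<subseteq> V" "con R"
    using r(1) unfolding territory_def by simp_all
  have "R \<inter> (seg P a b \<union> seg S c d) = {}"
    using r(1) unfolding territory_def by simp
  then show "R \<inter> seg P a b = {}" "R \<inter> seg S c d = {}"
    by blast+
qed

lemma w_out: "c \<le> x \<Longrightarrow> x \<le> d \<Longrightarrow> w x \<notin> R"
  using basic(10) seg_mem[of x c d S] by auto

lemma w_inj: "c \<le> x \<Longrightarrow> x \<le> d \<Longrightarrow> c \<le> y \<Longrightarrow> y \<le> d \<Longrightarrow> w x = w y \<Longrightarrow> x = y"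
  using basic(5) inj_onD[of w "{c..d}" x y] by (auto simp: is_seg_def)

lemma g_lip: "r \<in> R \<Longrightarrow> r' \<in> R \<Longrightarrow> adj r r' \<Longrightarrow> g r' \<le> g r + 1 \<and> g r \<le> g r' + 1"
  using basic(4) adj_sym unfolding track_on_def by blast

lemma weakD: "r \<in> R \<Longrightarrow> c \<le> x \<Longrightarrow> x \<le> d \<Longrightarrow> adj r (w x) \<Longrightarrow> g r \<le> x + 1 \<and> x \<le> g r + 1"
  using wkS unfolding weak_on_def by simp

end

locale tie_path = tie_game +
  fixes t
  assumes tie: "tie R S c \<beta> \<alpha> t"
begin

abbreviation "M \<equiv> t ` {\<alpha><..<\<beta>}"

lemma tie_facts:
  "c \<le> \<alpha>" "\<alpha> + 1 < \<beta>" "t \<alpha> = w \<alpha>" "t \<beta> = w \<beta>"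
  "\<And>x. \<alpha> < x \<Longrightarrow> x < \<beta> \<Longrightarrow> t x \<in> R" "\<And>x. \<alpha> < x \<Longrightarrow> x < \<beta> \<Longrightarrow> g (t x) = x"
  "\<And>x. \<alpha> \<le> x \<Longrightarrow> x < \<beta> \<Longrightarrow> adj (t x) (t (Suc x))"
  using tie unfolding tie_def by auto

lemma M_sub: "M \<subseteq> R" using tie_facts(5) by auto

lemma M_ne: "M \<noteq> {}" using tie_facts(2) by auto

lemma M_eq: "r \<in> M \<Longrightarrow> r = t (g r) \<and> \<alpha> < g r \<and> g r < \<beta>"
  using tie_facts(6) by auto

lemma t_inj: "inj_on t {\<alpha>..\<beta>}"
proof (rule linorder_inj_onI)
  fix x y assume xy: "x < y" "x \<in> {\<alpha>..\<beta>}" "y \<in> {\<alpha>..\<beta>}"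
  have "\<beta> \<le> d" "c \<le> \<alpha>" using \<beta>d tie_facts by auto
  then have e: "t \<alpha> \<notin> R" "t \<beta> \<notin> R" "t \<alpha> \<noteq> t \<beta>"
    using w_out[of \<alpha>] w_out[of \<beta>] w_inj[of \<alpha> \<beta>] tie_facts(2,3,4) by auto
  consider "\<alpha> < x" "y < \<beta>" | "x = \<alpha>" "y = \<beta>" | "x = \<alpha>" "y < \<beta>" | "\<alpha> < x" "y = \<beta>"
    using xy by force
  then show "t x \<noteq> t y"
  proof cases
    case 1
    then show ?thesis using tie_facts(6)[of x] tie_facts(6)[of y] xy by auto
  next
    case 2
    then show ?thesis using e by simp
  next
    case 3
    then show ?thesis using e tie_facts(5)[of y] xy by auto
  next
    case 4
    then show ?thesis using e tie_facts(5)[of x] xy by auto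
  qed
qed auto

text \<open>Level \<open>x - 1\<close> would be a defect before \<open>\<beta>\<close>; level
  \<open>x + 1\<close> would give a tie that starts at \<open>x\<close>, later than
  \<open>\<alpha>\<close>.\<close>

lemma M_chord: "r \<in> M \<Longrightarrow> \<alpha> < x \<Longrightarrow> x < \<beta> \<Longrightarrow> adj r (w x) \<Longrightarrow> g r = x"
proof (rule ccontr)
  assume r: "r \<in> M" and x: "\<alpha> < x" "x < \<beta>" and ad: "adj r (w x)" and ne: "g r \<noteq> x"
  have rR: "r \<in> R" using r M_sub by blast
  have xd: "c \<le> x" "x \<le> d" using x tie_facts \<beta>d by auto
  have "Suc (g r) \<noteq> x" using \<beta>_min[OF xd(1) x(2) rR ad] .
  then have gr: "g r = Suc x" using weakD[OF rR xd ad] ne by linarith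
  then have r': "r = t (Suc x)" "Suc x < \<beta>" using M_eq[OF r] by auto
  have "tie R S c \<beta> x (t(x := w x))"
    unfolding tie_def
  proof (intro conjI allI impI)
    show "adj ((t(x := w x)) y) ((t(x := w x)) (Suc y))" if "x \<le> y" "y < \<beta>" for y
      using that x r' ad adj_sym tie_facts(7)[of y] by (cases "y = x") auto
  qed (use x xd r' tie_facts in auto)
  then show False using \<alpha>_max x by fastforce
qed

lemma arcs:
  "path_on (w \<alpha>) (w \<beta>) (seg S \<alpha> \<beta>)" "path_on (w \<alpha>) (w \<beta>) arc2" "seg S \<alpha> \<beta> \<inter> arc2 = {w \<alpha>, w \<beta>}"
  "path_on (w \<alpha>) (w \<beta>) (M \<union> {w \<alpha>, w \<beta>})" "w \<alpha> \<noteq> w \<beta>" "R \<inter> seg S \<alpha> \<beta> = {}" "R \<inter> arc2 = {}"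
proof -
  have l: "c \<le> \<alpha>" "\<alpha> < \<beta>" "\<beta> \<le> d" using tie_facts(1,2) \<beta>d by auto
  note bs = bigon_arcs_same[OF basic(1) basic(4) basic(3) l]
  show "path_on (w \<alpha>) (w \<beta>) (seg S \<alpha> \<beta>)" "path_on (w \<alpha>) (w \<beta>) arc2" "seg S \<alpha> \<beta> \<inter> arc2 = {w \<alpha>, w \<beta>}"
    using bs by auto
  show "w \<alpha> \<noteq> w \<beta>" using w_inj[of \<alpha> \<beta>] l by auto
  have "seg S \<alpha> \<beta> \<subseteq> seg S c d" "seg S c \<alpha> \<subseteq> seg S c d" "seg S \<beta> d \<subseteq> seg S c d"
    using l by (simp_all add: seg_sub)
  then show "R \<inter> seg S \<alpha> \<beta> = {}" "R \<inter> arc2 = {}" using basic(9,10) by blast+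
  have "path_on (t \<alpha>) (t \<beta>) (t ` {\<alpha>..\<beta>})"
    using tie_facts(7) t_inj l by (intro path_on_image) auto
  moreover have "{\<alpha>..\<beta>} = insert \<alpha> (insert \<beta> {\<alpha><..<\<beta>})" using l by auto
  then have "t ` {\<alpha>..\<beta>} = M \<union> {w \<alpha>, w \<beta>}" using tie_facts(3,4) by auto
  ultimately show "path_on (w \<alpha>) (w \<beta>) (M \<union> {w \<alpha>, w \<beta>})" using tie_facts(3,4) by simp
qed

lemma W_interior: "\<alpha> < x \<Longrightarrow> x < \<beta> \<Longrightarrow> w x \<in> seg S \<alpha> \<beta> - {w \<alpha>, w \<beta>}"
  using w_inj[of x \<alpha>] w_inj[of x \<beta>] tie_facts(1,2) \<beta>d seg_mem[of x \<alpha> \<beta> S] by auto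

text \<open>The component sees an inner vertex of the bypassed piece, so by
  \<open>chord_side\<close>, with the tie as chord, it sees no inner vertex of \<open>arc2\<close>,
  the rest of the boundary cycle.\<close>

lemma lens_nb:
  assumes "r \<in> lens R S \<beta> \<alpha> t" "y \<in> comp_of (R - M) r" "adj y x" "x \<notin> R"
  shows "x \<in> seg S \<alpha> \<beta>"
proof -
  have r: "r \<in> R - M" using assms(1) by (simp add: lens_def)
  obtain y' x' where x': "y' \<in> comp_of (R - M) r" "\<alpha> < x'" "x' < \<beta>" "adj y' (w x')"
    using assms(1) unfolding lens_def by blast
  have "w x' \<in> seg S \<alpha> \<beta> - {w \<alpha>, w \<beta>}" using W_interior x' by blast
  then have n: "\<forall>y\<in>comp_of (R - M) r. \<forall>x\<in>arc2 - {w \<alpha>, w \<beta>}. \<not> adj y x"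
    using chord_side[OF arcs(1,2,4,5,3) refl basic(8,7) M_sub M_ne arcs(6,7) r] x'(1,4) by blast
  have "y \<in> R" using comp_sub[OF r] assms(2) by blast
  then have "x \<in> seg P a b \<union> seg S c d" using basic(2) assms(3,4) unfolding territory_def by blast
  then have "x \<in> arc2 \<or> x \<in> seg S \<alpha> \<beta>"
    using seg_cover[of S c d \<alpha>] seg_cover[of S \<alpha> d \<beta>] by blast
  then show ?thesis using n assms(2,3) path_on_ends[OF arcs(1)] by blast
qed

abbreviation "W \<equiv> w ` {\<alpha><..<\<beta>}"

lemma con_path: "path_on u v X \<Longrightarrow> con X"
  unfolding path_on_def using con_vpath by blast

lemma W_facts: "con W" "w (Suc \<alpha>) \<in> W" "W \<subseteq> V" "W \<inter> R = {}" "W \<inter> arc2 = {}" "W \<subseteq> seg S \<alpha> \<beta> - {w \<alpha>, w \<beta>}"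
  "adj (w \<alpha>) (w (Suc \<alpha>))" "w (\<beta> - 1) \<in> W" "adj (w \<beta>) (w (\<beta> - 1))" "w \<alpha> \<in> V" "w \<beta> \<in> V"
proof -
  have l: "c \<le> \<alpha>" "\<alpha> + 1 < \<beta>" "\<beta> \<le> d" "d \<le> len S" using tie_facts(1,2) \<beta>d basic(11) by auto
  have ad: "adj (w x) (w (Suc x))" if "x < d" for x
    using track_adj[OF basic(4)] that l by simp
  show "W \<subseteq> seg S \<alpha> \<beta> - {w \<alpha>, w \<beta>}"
  proof
    fix v assume "v \<in> W"
    then obtain x where "\<alpha> < x" "x < \<beta>" "v = w x" by auto
    then show "v \<in> seg S \<alpha> \<beta> - {w \<alpha>, w \<beta>}" using W_interior by simp
  qed
  then show "W \<inter> R = {}" "W \<inter> arc2 = {}" using arcs(3,6) by blast+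
  show "w (Suc \<alpha>) \<in> W" "w (\<beta> - 1) \<in> W" using l by auto
  show "adj (w \<alpha>) (w (Suc \<alpha>))" using ad l by simp
  have b1: "Suc (\<beta> - 1) = \<beta>" "\<beta> - 1 < d" using l by auto
  show b2: "adj (w \<beta>) (w (\<beta> - 1))" using ad[OF b1(2)] b1(1) adj_sym by simp
  show "w \<alpha> \<in> V" "w \<beta> \<in> V" using adjV[OF ad[of \<alpha>]] adjV[OF b2] l by auto
  have "seg S \<alpha> \<beta> \<subseteq> V" using seg_V[OF basic(4,5)] seg_sub[of c \<alpha> \<beta> d S] l by auto
  then show "W \<subseteq> V" using \<open>W \<subseteq> seg S \<alpha> \<beta> - {w \<alpha>, w \<beta>}\<close> by blast
  have "path_on (w (Suc \<alpha>)) (w (\<beta> - 1)) (w ` {Suc \<alpha>..\<beta> - 1})"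
  proof (rule path_on_image)
    show "inj_on w {Suc \<alpha>..\<beta> - 1}" 
    proof (rule inj_on_subset)
      show "inj_on w {c..d}" using basic(5) by (simp add: is_seg_def)
      show "{Suc \<alpha>..\<beta> - 1} \<subseteq> {c..d}" using l by auto
    qed
    show "Suc \<alpha> \<le> \<beta> - 1" using l by simp
    show "adj (w x) (w (Suc x))" if "Suc \<alpha> \<le> x" "x < \<beta> - 1" for x
      using ad[of x] that l by simp
  qed
  moreover have "{Suc \<alpha>..\<beta> - 1} = {\<alpha><..<\<beta>}" using l by auto
  ultimately show "con W" using con_path by simp
qed

lemma t_W: "t ` {\<alpha>..\<beta>} \<inter> W = {}"
proof -
  have "t x \<notin> W" if x: "x \<in> {\<alpha>..\<beta>}" for x
  proof -
    consider "x = \<alpha>" | "x = \<beta>" | "\<alpha> < x" "x < \<beta>"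
      using x by (cases "x = \<alpha>"; cases "x = \<beta>") auto
    then show ?thesis
    proof cases
      case 3
      then show ?thesis using tie_facts(5)[of x] W_facts(4) by blast
    qed (use tie_facts(3,4) W_facts(6) in auto)
  qed
  then show ?thesis by blast
qed

lemma avoid_t: "X \<subseteq> R - M \<Longrightarrow> X \<inter> t ` {\<alpha>..\<beta>} = {}"
proof -
  assume X: "X \<subseteq> R - M"
  have "t x \<notin> X" if x: "x \<in> {\<alpha>..\<beta>}" for x
  proof -
    consider "x = \<alpha>" | "x = \<beta>" | "\<alpha> < x" "x < \<beta>"
      using x by (cases "x = \<alpha>"; cases "x = \<beta>") auto
    then show ?thesis
    proof cases
      case 1
      then show ?thesis using tie_facts(1,2,3) w_out[of \<alpha>] \<beta>d X by auto
    next
      case 2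
      then show ?thesis using tie_facts(1,2,4) w_out[of \<beta>] \<beta>d X by auto
    next
      case 3
      then show ?thesis using X by auto
    qed
  qed
  then show ?thesis by blast
qed

lemma t_arc2: "t ` {\<alpha>..\<beta>} \<inter> arc2 \<subseteq> {w \<alpha>, w \<beta>}"
proof -
  have "t ` {\<alpha>..\<beta>} \<subseteq> insert (w \<alpha>) (insert (w \<beta>) R)"
  proof
    fix v assume "v \<in> t ` {\<alpha>..\<beta>}"
    then obtain x where x: "\<alpha> \<le> x" "x \<le> \<beta>" "v = t x" by auto
    show "v \<in> insert (w \<alpha>) (insert (w \<beta>) R)"
      using x tie_facts(3,4) tie_facts(5)[of x] by (cases "x = \<alpha> \<or> x = \<beta>") auto
  qed
  then show ?thesis using arcs(7) by blast
qed

lemma t_path: "\<alpha> \<le> i \<Longrightarrow> i \<le> j \<Longrightarrow> j \<le> \<beta> \<Longrightarrow> path_on (t i) (t j) (t ` {i..j})"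
  using tie_facts(7) inj_on_subset[OF t_inj, of "{i..j}"] by (intro path_on_image) auto

lemma t_disj: "\<alpha> \<le> i \<Longrightarrow> j \<le> \<beta> \<Longrightarrow> \<alpha> \<le> i' \<Longrightarrow> j' \<le> \<beta> \<Longrightarrow>
    t ` {i..j} \<inter> t ` {i'..j'} = t ` ({i..j} \<inter> {i'..j'})"
  using inj_on_image_Int[OF t_inj, of "{i..j}" "{i'..j'}"] by auto

lemma finite_lens: "finite (lens R S \<beta> \<alpha> t)"
  by (rule finite_subset[OF _ finV]) (use basic(7) in \<open>auto simp: lens_def\<close>)

end

lemma Int_eq_singleton: "X \<inter> Y \<subseteq> {a, b} \<Longrightarrow> b \<notin> X \<Longrightarrow> a \<in> X \<Longrightarrow> a \<in> Y \<Longrightarrow> X \<inter> Y = {a}"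
  by blast

lemma Int_Un3_sub: "Z \<inter> X \<subseteq> S \<Longrightarrow> Z \<inter> Y \<subseteq> S \<Longrightarrow> Z \<inter> U \<subseteq> S \<Longrightarrow> Z \<inter> (X \<union> Y \<union> U) \<subseteq> S"
  by blast

lemma Int_Un3_empty: "Z \<inter> X = {} \<Longrightarrow> Z \<inter> Y = {} \<Longrightarrow> Z \<inter> U = {} \<Longrightarrow> Z \<inter> (X \<union> Y \<union> U) = {}"
  by blast

lemma Un_Int_eq_singleton:
  "Z \<inter> Y \<subseteq> {a, b} \<Longrightarrow> X \<inter> Z = {} \<Longrightarrow> a \<notin> Z \<Longrightarrow> b \<in> Y \<Longrightarrow> b \<in> Z \<Longrightarrow> (X \<union> Y) \<inter> Z = {b}"
  by blast

locale tie_min = tie_path +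
  assumes lens_min: "\<And>t'. tie R S c \<beta> \<alpha> t' \<Longrightarrow> card (lens R S \<beta> \<alpha> t) \<le> card (lens R S \<beta> \<alpha> t')"
begin

text \<open>Minimality of the lens: a second tie inside it would have a smaller lens, by planarity.\<close>

lemma smaller_lens:
  assumes y: "y \<in> lens R S \<beta> \<alpha> t" and t2: "tie R S c \<beta> \<alpha> t2" and mx: "\<alpha> \<le> m" "m + 1 < x" "x \<le> \<beta>"
    and in2: "\<And>z. m < z \<Longrightarrow> z < x \<Longrightarrow> t2 z \<in> comp_of (R - M) y" and eq2: "\<And>z. z \<le> m \<or> x \<le> z \<Longrightarrow> t2 z = t z"
  shows False
proof -
  interpret t2: tie_path V adj p \<gamma> x0 R P a b S c d \<alpha> \<beta> t2
    by unfold_locales (rule t2)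
  let ?K = "comp_of (R - M) y"
  have yR: "y \<in> R - M" using y by (simp add: lens_def)
  have K: "?K \<subseteq> R - M" "con ?K" using comp_sub[OF yR] con_comp[OF yR] by auto
  obtain yk xk where yk: "yk \<in> ?K" "\<alpha> < xk" "xk < \<beta>" "adj yk (w xk)" using y unfolding lens_def by blast
  define v2 where "v2 = t2 (Suc m)"
  have v2: "v2 \<in> ?K" "v2 \<in> t2.M" "v2 \<in> t2 ` {m..x}"
    using in2[of "Suc m"] mx unfolding v2_def by auto
  have K_t: "?K \<inter> t ` {\<alpha>..\<beta>} = {}" using avoid_t[OF K(1)] .
  have K_arc: "?K \<inter> arc2 = {}" using K(1) arcs(7) by blast
  \<comment> \<open>The heart of the matter: the new lens does not reach back to \<open>t\<close>.
    Otherwise \<open>W\<close> would be linked to \<open>t\<close> off \<open>t2\<close>, through a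
    component of the new lens, and to \<open>t2\<close> off \<open>t\<close>, through
    \<open>?K\<close>.\<close>
  have disj: "comp_of (R - t2.M) q \<inter> M = {}" if q: "q \<in> lens R S \<beta> \<alpha> t2" for q
  proof (rule ccontr)
    let ?K2 = "comp_of (R - t2.M) q"
    assume "?K2 \<inter> M \<noteq> {}"
    then obtain z where z: "\<alpha> < z" "z < \<beta>" "t z \<in> ?K2" by auto
    have qR: "q \<in> R - t2.M" using q by (simp add: lens_def)
    have K2: "?K2 \<subseteq> R - t2.M" "con ?K2" using comp_sub[OF qR] con_comp[OF qR] by auto
    obtain y2 x2 where y2: "y2 \<in> ?K2" "\<alpha> < x2" "x2 < \<beta>" "adj y2 (w x2)" using q unfolding lens_def by blast
    have zm: "m < z" "z < x"
    proof -
      have "t2 z \<in> t2.M" using z by simp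
      then have "t2 z \<noteq> t z" using z(3) K2(1) by auto
      then show "m < z" "z < x" using eq2[of z] by (meson not_le)+
    qed
    have K2_t2: "?K2 \<inter> t2 ` {\<alpha>..\<beta>} = {}" using t2.avoid_t[OF K2(1)] .
    have K2_arc: "?K2 \<inter> arc2 = {}" using K2(1) arcs(7) by blast
    let ?B = "t ` {m..x}" and ?C = "t2 ` {m..x}"
    have Bs: "?B \<subseteq> t ` {\<alpha>..\<beta>}" "?C \<subseteq> t2 ` {\<alpha>..\<beta>}" using mx by auto
    have lo: "t ` {\<alpha>..m} = t2 ` {\<alpha>..m}" "t ` {x..\<beta>} = t2 ` {x..\<beta>}" using eq2 by auto
    have los: "t ` {\<alpha>..m} \<subseteq> t ` {\<alpha>..\<beta>}" "t ` {x..\<beta>} \<subseteq> t ` {\<alpha>..\<beta>}"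
      "t2 ` {\<alpha>..m} \<subseteq> t2 ` {\<alpha>..\<beta>}" "t2 ` {x..\<beta>} \<subseteq> t2 ` {\<alpha>..\<beta>}" using mx by auto
    have e2: "t2 m = t m" "t2 x = t x" using eq2 by auto
    have BC: "?B \<inter> ?C = {t m, t x}"
    proof
      show "?B \<inter> ?C \<subseteq> {t m, t x}"
      proof
        fix v assume v: "v \<in> ?B \<inter> ?C"
        then obtain u where u: "m \<le> u" "u \<le> x" "v = t2 u" by auto
        have "v \<notin> ?K" using v Bs(1) K_t by blast
        then have "u = m \<or> u = x" using in2[of u] u by force
        then show "v \<in> {t m, t x}" using u e2 by auto
      qed
      show "{t m, t x} \<subseteq> ?B \<inter> ?C"
        using mx e2 by (auto intro: image_eqI[of _ _ m] image_eqI[of _ _ x])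
    qed
    let ?UB = "?K2 \<union> W" and ?UC = "?K \<union> W"
    have cUB: "con ?UB" using con_Un_adj[OF K2(2) W_facts(1) y2(1) _ y2(4)] y2 by auto
    have cUC: "con ?UC" using con_Un_adj[OF K(2) W_facts(1) yk(1) _ yk(4)] yk by auto
    have VV: "?UB \<subseteq> V" "?UC \<subseteq> V" using K(1) K2(1) basic(7) W_facts(3) by auto
    have UB_C: "?UB \<inter> ?C = {}" using K2_t2 Bs(2) t2.t_W by blast
    have UC_B: "?UC \<inter> ?B = {}" using K_t Bs(1) t_W by blast
    have UB_arc: "?UB \<inter> arc2 = {}" using K2_arc W_facts(5) by blast
    have UC_arc: "?UC \<inter> arc2 = {}" using K_arc W_facts(5) by blast
    have UB_B: "?UB \<inter> ?B \<noteq> {}" using z(3) zm by auto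
    have UC_C: "?UC \<inter> ?C \<noteq> {}" using v2 by auto
    show False
    proof (cases "\<alpha> < m \<or> x < \<beta>")
      case True
      \<comment> \<open>If the detour leaves an end of the tie in place, \<open>W\<close> reaches
        the third path \<open>?D\<close> at \<open>w \<alpha>\<close> or \<open>w \<beta>\<close>,
        which is not an end of the detour: three paths from \<open>t m\<close> to \<open>t x\<close>
        with \<open>W\<close> as hub.\<close>
      let ?D = "t ` {\<alpha>..m} \<union> arc2 \<union> t ` {x..\<beta>}"
      have p1: "path_on (t m) (w \<alpha>) (t ` {\<alpha>..m})"
        using path_on_rev[OF t_path[of \<alpha> m]] mx tie_facts(3) by simp
      have p3: "path_on (w \<beta>) (t x) (t ` {x..\<beta>})"
        using path_on_rev[OF t_path[of x \<beta>]] mx tie_facts(4) by simp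
      have nb: "w \<beta> \<notin> t ` {\<alpha>..m}" "w \<alpha> \<notin> t ` {x..\<beta>}"
        using inj_onD[OF t_inj, of \<beta>] inj_onD[OF t_inj, of \<alpha>] mx tie_facts(3,4) by force+
      have i1: "t ` {\<alpha>..m} \<inter> arc2 = {w \<alpha>}"
      proof (rule Int_eq_singleton)
        show "t ` {\<alpha>..m} \<inter> arc2 \<subseteq> {w \<alpha>, w \<beta>}"
          by (rule subset_trans[OF Int_mono[OF los(1) subset_refl] t_arc2])
      qed (use nb path_on_ends[OF p1] path_on_ends[OF arcs(2)] in simp_all)
      have lh: "t ` {\<alpha>..m} \<inter> t ` {x..\<beta>} = {}"
        using t_disj[of \<alpha> m x \<beta>] mx by simp
      have i2: "(t ` {\<alpha>..m} \<union> arc2) \<inter> t ` {x..\<beta>} = {w \<beta>}"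
      proof (rule Un_Int_eq_singleton[OF _ lh])
        show "t ` {x..\<beta>} \<inter> arc2 \<subseteq> {w \<alpha>, w \<beta>}"
          by (rule subset_trans[OF Int_mono[OF los(2) subset_refl] t_arc2])
      qed (use nb path_on_ends[OF p3] path_on_ends[OF arcs(2)] in simp_all)
      have pD: "path_on (t m) (t x) ?D"
        using path_on_join[OF path_on_join[OF p1 arcs(2) i1] p3 i2] .
      have pB: "path_on (t m) (t x) ?B" using t_path[of m x] mx by simp
      have pC: "path_on (t m) (t x) ?C" using t2.t_path[of m x] mx e2 by simp
      have ne: "t m \<noteq> t x" using inj_onD[OF t_inj, of m x] mx by auto
      have Barc: "?B \<inter> arc2 \<subseteq> {t m, t x}"
      proof
        fix v assume v: "v \<in> ?B \<inter> arc2"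
        then obtain u where u: "m \<le> u" "u \<le> x" "v = t u" by auto
        have "\<not> (\<alpha> < u \<and> u < \<beta>)"
        proof
          assume "\<alpha> < u \<and> u < \<beta>"
          then have "v \<in> R" using tie_facts(5) u(3) by simp
          then have "v \<in> R \<inter> arc2" using IntD2[OF v] by (rule IntI)
          then show False unfolding arcs(7) by simp
        qed
        then have "u = m \<or> u = x" using u mx by linarith
        then show "v \<in> {t m, t x}" using u by auto
      qed
      have Blo: "?B \<inter> t ` {\<alpha>..m} \<subseteq> {t m}" "?B \<inter> t ` {x..\<beta>} \<subseteq> {t x}"
        using t_disj[of m x \<alpha> m] t_disj[of m x x \<beta>] mx by auto
      have BD: "?B \<inter> ?D = {t m, t x}"
      proof (rule equalityI)
        have "?B \<inter> t ` {\<alpha>..m} \<subseteq> {t m, t x}" "?B \<inter> t ` {x..\<beta>} \<subseteq> {t m, t x}" using Blo by blast+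
        then show "?B \<inter> ?D \<subseteq> {t m, t x}" by (intro Int_Un3_sub Barc)
        show "{t m, t x} \<subseteq> ?B \<inter> ?D"
          using path_on_ends[OF pB] path_on_ends[OF pD] by simp
      qed
      have K_D: "?K \<inter> ?D = {}"
      proof (rule Int_Un3_empty[OF _ K_arc])
        show "?K \<inter> t ` {\<alpha>..m} = {}" "?K \<inter> t ` {x..\<beta>} = {}" using K_t los(1,2) by blast+
      qed
      have CD: "?C \<inter> ?D = {t m, t x}"
      proof
        show "?C \<inter> ?D \<subseteq> {t m, t x}"
        proof
          fix v assume v: "v \<in> ?C \<inter> ?D"
          then obtain u where u: "m \<le> u" "u \<le> x" "v = t2 u" by auto
          have "v \<notin> ?K" using IntD2[OF v] K_D by (meson disjoint_iff)
          then have "u = m \<or> u = x" using in2[of u] u by force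
          then show "v \<in> {t m, t x}" using u e2 by auto
        qed
        show "{t m, t x} \<subseteq> ?C \<inter> ?D" using path_on_ends[OF pC] path_on_ends[OF pD] by simp
      qed
      have UB_D: "?UB \<inter> ?D = {}"
      proof (rule Int_Un3_empty[OF _ UB_arc])
        have "?UB \<inter> t2 ` {\<alpha>..\<beta>} = {}" using K2_t2 t2.t_W by blast
        then show "?UB \<inter> t ` {\<alpha>..m} = {}" "?UB \<inter> t ` {x..\<beta>} = {}"
          unfolding lo using los(3,4) by blast+
      qed
      have UC_D: "?UC \<inter> ?D = {}"
      proof (rule Int_Un3_empty[OF _ UC_arc])
        have "?UC \<inter> t ` {\<alpha>..\<beta>} = {}" using K_t t_W by blast
        then show "?UC \<inter> t ` {\<alpha>..m} = {}" "?UC \<inter> t ` {x..\<beta>} = {}"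
          using los(1,2) by blast+
      qed
      have WB: "W \<inter> ?B = {}" "W \<inter> ?C = {}"
        using UC_B UB_C by (simp_all add: Int_Un_distrib2)
      obtain UD where UD: "con UD" "w (Suc \<alpha>) \<in> UD" "UD \<subseteq> V" "UD \<inter> ?D \<noteq> {}" "UD \<inter> ?B = {}" "UD \<inter> ?C = {}"
      proof (cases "\<alpha> < m")
        case True
        have "w \<alpha> \<notin> ?B" "w \<alpha> \<notin> ?C"
          using inj_onD[OF t_inj, of \<alpha>] inj_onD[OF t2.t_inj, of \<alpha>] True mx tie_facts(3) t2.tie_facts(3) by force+
        then have "insert (w \<alpha>) W \<inter> ?B = {}" "insert (w \<alpha>) W \<inter> ?C = {}"
          using WB by simp_all
        moreover have "insert (w \<alpha>) W \<inter> ?D \<noteq> {}" using path_on_ends[OF p1] by blast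
        moreover have "insert (w \<alpha>) W \<subseteq> V" "w (Suc \<alpha>) \<in> insert (w \<alpha>) W"
          using W_facts(2,3,10,11) by simp_all
        ultimately show thesis
          using that[of "insert (w \<alpha>) W"] con_insert[OF W_facts(1,2,7)] by simp
      next
        case False
        then have "x < \<beta>" using \<open>\<alpha> < m \<or> x < \<beta>\<close> by simp
        then have "w \<beta> \<notin> ?B" "w \<beta> \<notin> ?C"
          using inj_onD[OF t_inj, of \<beta>] inj_onD[OF t2.t_inj, of \<beta>] mx tie_facts(4) t2.tie_facts(4) by force+
        then have "insert (w \<beta>) W \<inter> ?B = {}" "insert (w \<beta>) W \<inter> ?C = {}"
          using WB by simp_all
        moreover have "insert (w \<beta>) W \<inter> ?D \<noteq> {}" using path_on_ends[OF p3] by blast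
        moreover have "insert (w \<beta>) W \<subseteq> V" "w (Suc \<alpha>) \<in> insert (w \<beta>) W"
          using W_facts(2,3,10,11) by simp_all
        ultimately show thesis
          using that[of "insert (w \<beta>) W"] con_insert[OF W_facts(1,8,9)] by simp
      qed
      have sc: "w (Suc \<alpha>) \<in> ?UB" "w (Suc \<alpha>) \<in> ?UC" using W_facts(2) by blast+
      show False
        by (rule theta_sets[OF pB pC pD ne BC BD CD cUB cUC UD(1) sc UD(2) VV UD(3) UB_B UB_C UB_D UC_C UC_B UC_D UD(4-6)])
    next
      case False
      \<comment> \<open>Now \<open>w \<alpha>\<close> and \<open>w \<beta>\<close> are the common
        ends, so \<open>W\<close> cannot be linked to \<open>arc2\<close> at them. The bypassed
        piece, the two ties and \<open>arc2\<close> are four paths, and the first three are linked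
        pairwise: by \<open>?UB\<close>, by \<open>?UC\<close> and, between the ties, by
        \<open>R\<close> itself.\<close>
      then have mx': "m = \<alpha>" "x = \<beta>" using mx by auto
      have pB: "path_on (w \<alpha>) (w \<beta>) ?B" using t_path[of \<alpha> \<beta>] mx mx' tie_facts(3,4) by simp
      have pC: "path_on (w \<alpha>) (w \<beta>) ?C" using t2.t_path[of \<alpha> \<beta>] mx mx' t2.tie_facts(3,4) by simp
      have tR: "t ` {\<alpha>..\<beta>} \<subseteq> insert (w \<alpha>) (insert (w \<beta>) R)" "t2 ` {\<alpha>..\<beta>} \<subseteq> insert (w \<alpha>) (insert (w \<beta>) R)"
        using tie_facts(3,4,5) t2.tie_facts(3,4,5) by (force simp: le_less)+
      note en = path_on_ends[OF pB] path_on_ends[OF pC] path_on_ends[OF arcs(1)] path_on_ends[OF arcs(2)]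
      have AB: "seg S \<alpha> \<beta> \<inter> ?B = {w \<alpha>, w \<beta>}" "seg S \<alpha> \<beta> \<inter> ?C = {w \<alpha>, w \<beta>}"
        using tR arcs(6) en unfolding mx' by blast+
      have BD: "?B \<inter> arc2 = {w \<alpha>, w \<beta>}" "?C \<inter> arc2 = {w \<alpha>, w \<beta>}"
        using tR arcs(7) en unfolding mx' by blast+
      have BC': "?B \<inter> ?C = {w \<alpha>, w \<beta>}" using BC mx' tie_facts(3,4) by simp
      have UA: "?UB \<inter> seg S \<alpha> \<beta> \<noteq> {}" "?UC \<inter> seg S \<alpha> \<beta> \<noteq> {}" using W_facts(2,6) by blast+
      have RB: "R \<inter> ?B \<noteq> {}" "R \<inter> ?C \<noteq> {}" 
      proof -
        have "t z \<in> R" "t z \<in> ?B" using z(3) K2(1) zm by auto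
        then show "R \<inter> ?B \<noteq> {}" by blast
        have "v2 \<in> R" using v2(1) K(1) by blast
        then show "R \<inter> ?C \<noteq> {}" using v2(3) by blast
      qed
      show False
        by (rule four_sets_not_linked[OF arcs(1) pB pC arcs(2,5) AB arcs(3) BC' BD cUB cUC basic(8) VV basic(7)
              UA(1) UB_B UB_C UB_arc UA(2) UC_C UC_B UC_arc RB arcs(6,7)])
    qed
  qed
  \<comment> \<open>A component of \<open>R\<close> without \<open>t2\<close> that misses
    \<open>t\<close> lies in a component without \<open>t\<close>. So the new lens is contained in
    the old one, and it lacks \<open>v2\<close>, which is on the new tie.\<close>
  have "lens R S \<beta> \<alpha> t2 \<subseteq> lens R S \<beta> \<alpha> t"
  proof
    fix q assume q: "q \<in> lens R S \<beta> \<alpha> t2"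
    have qR: "q \<in> R - t2.M" using q by (simp add: lens_def)
    have "comp_of (R - t2.M) q \<subseteq> comp_of (R - M) q"
      using con_comp[OF qR] comp_sub[OF qR] disj[OF q] by (intro con_sub_comp) auto
    moreover have "q \<in> R - M" using disj[OF q] qR comp_self[of q] by blast
    ultimately show "q \<in> lens R S \<beta> \<alpha> t" using q unfolding lens_def by blast
  qed
  moreover have "v2 \<in> lens R S \<beta> \<alpha> t"
    using comp_eq[OF yR v2(1)] K(1) v2(1) yk unfolding lens_def by blast
  moreover have "v2 \<notin> lens R S \<beta> \<alpha> t2" using v2(2) unfolding lens_def by blast
  ultimately have "lens R S \<beta> \<alpha> t2 \<subset> lens R S \<beta> \<alpha> t" by blast
  then have "card (lens R S \<beta> \<alpha> t2) < card (lens R S \<beta> \<alpha> t)" by (rule psubset_card_mono[OF finite_lens])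
  then show False using lens_min[OF t2] by simp
qed

text \<open>If \<open>y\<close> had level \<open>x - 1\<close>, a descent from \<open>y\<close>
  inside its component would reach the tie or its start at some \<open>m\<close>. Descent and edge
  to \<open>t x\<close> could then replace the tie from \<open>m\<close> to \<open>x\<close>: a
  second tie through the lens, against minimality.\<close>

lemma lens_no_tie:
  assumes y: "y \<in> lens R S \<beta> \<alpha> t" and x: "\<alpha> < x" "x \<le> \<beta>" and ad: "adj y (t x)"
  shows "Suc (g y) \<noteq> x"
proof
  assume gy: "Suc (g y) = x"
  let ?K = "comp_of (R - M) y"
  have yR: "y \<in> R - M" using y by (simp add: lens_def)
  have K: "?K \<subseteq> R" using comp_sub[OF yR] by blast
  have l: "c \<le> \<alpha>" "\<beta> \<le> d" "d \<le> len S" using tie_facts(1) \<beta>d basic(11) by auto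
  have cl: "\<forall>y'\<in>?K. \<forall>z\<in>R. adj y' z \<longrightarrow> z \<in> ?K \<union> M"
    using comp_closed[OF yR] by blast
  have "g y < len S" using gy x l by linarith
  then obtain m s where s: "m < g y" "s (g y) = y" "\<And>z. m < z \<Longrightarrow> z \<le> g y \<Longrightarrow> s z \<in> ?K \<and> g (s z) = z"
      "\<And>z. m \<le> z \<Longrightarrow> z < g y \<Longrightarrow> adj (s z) (s (Suc z))"
      "s m = w m \<and> c \<le> m \<and> m \<le> d \<or> s m \<in> M \<and> g (s m) = m"
    using descend[where R = R and S = S and c = c and d = d and K = "?K" and M = M and r = y, OF deS K cl comp_self]
    by blast
  \<comment> \<open>Splices \<open>s\<close> strictly between \<open>m\<close> and \<open>x\<close>
    into a walk \<open>u\<close> that agrees with \<open>t\<close> from \<open>x\<close> on. Used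
    once to compare a start at \<open>m\<close> with \<open>\<alpha>\<close>, once for the second
    tie.\<close>
  have tie2: "tie R S c \<beta> e (\<lambda>z. if m < z \<and> z < x then s z else u z)"
    if e: "c \<le> e" "e \<le> m" "u e = w e" "u m = s m" "\<And>z. x \<le> z \<Longrightarrow> u z = t z"
      "\<And>z. e < z \<Longrightarrow> z \<le> m \<Longrightarrow> u z \<in> R \<and> g (u z) = z" "\<And>z. e \<le> z \<Longrightarrow> z < m \<Longrightarrow> adj (u z) (u (Suc z))" for e u
    unfolding tie_def
  proof (intro conjI allI impI)
    show "c \<le> e" by fact
    show "e + 1 < \<beta>" using e(2) s(1) gy x by linarith
    show "(if m < e \<and> e < x then s e else u e) = w e" using e by simp
    show "(if m < \<beta> \<and> \<beta> < x then s \<beta> else u \<beta>) = w \<beta>" using e(5)[of \<beta>] x tie_facts(4) by simp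
  next
    fix z assume z: "e < z" "z < \<beta>"
    consider "z \<le> m" | "m < z" "z < x" | "x \<le> z" by linarith
    then have "(if m < z \<and> z < x then s z else u z) \<in> R \<and> g (if m < z \<and> z < x then s z else u z) = z"
    proof cases
      case 1
      then show ?thesis using e(6)[of z] z by simp
    next
      case 2
      then show ?thesis using s(3)[of z] K gy by auto
    next
      case 3
      then show ?thesis using e(5)[of z] tie_facts(5)[of z] tie_facts(6)[of z] z x by simp
    qed
    then show "(if m < z \<and> z < x then s z else u z) \<in> R" "g (if m < z \<and> z < x then s z else u z) = z" by auto
  next
    fix z assume z: "e \<le> z" "z < \<beta>"
    consider "z < m" | "z = m" | "m < z" "Suc z < x" | "m < z" "Suc z = x" | "x \<le> z" by linarith
    then show "adj (if m < z \<and> z < x then s z else u z) (if m < Suc z \<and> Suc z < x then s (Suc z) else u (Suc z))"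
    proof cases
      case 1
      then show ?thesis using e(7)[of z] z by simp
    next
      case 2
      then show ?thesis using e(4) s(1) s(4)[of m] gy by simp
    next
      case 3
      then show ?thesis using s(4)[of z] gy by simp
    next
      case 4
      then show ?thesis using s(2) ad e(5)[of x] gy by auto
    next
      case 5
      then show ?thesis using e(5)[of z] e(5)[of "Suc z"] tie_facts(7)[of z] z x by simp
    qed
  qed
  \<comment> \<open>A descent that ends on \<open>S\<close> ends at the start of the tie:
    \<open>lens_nb\<close> gives \<open>\<alpha> \<le> m\<close>, and the spliced tie starting at
    \<open>m\<close> gives \<open>m \<le> \<alpha>\<close>.\<close>
  have am: "\<alpha> \<le> m \<and> s m = t m"
  proof (cases "s m \<in> M \<and> g (s m) = m")
    case True
    then show ?thesis using M_eq[of "s m"] by auto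
  next
    case False
    then have m: "s m = w m" "c \<le> m" "m \<le> d" using s(5) by auto
    have "adj (s (Suc m)) (w m)" "s (Suc m) \<in> ?K"
      using s(4)[of m] s(3)[of "Suc m"] s(1) m(1) adj_sym by auto
    then have "w m \<in> seg S \<alpha> \<beta>" using lens_nb[OF y] w_out[OF m(2,3)] by blast
    then obtain m' where m': "\<alpha> \<le> m'" "m' \<le> \<beta>" "w m = w m'" by (elim segE)
    then have "\<alpha> \<le> m" using w_inj[of m m'] m l by auto
    moreover have "tie R S c \<beta> m (\<lambda>z. if m < z \<and> z < x then s z else if z = m then w m else t z)"
      by (rule tie2) (use m s(1) gy in auto)
    then have "m \<le> \<alpha>" by (rule \<alpha>_max)
    ultimately show ?thesis using m tie_facts(3) by simp
  qed
  have "tie R S c \<beta> \<alpha> (\<lambda>z. if m < z \<and> z < x then s z else t z)"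
    by (rule tie2) (use am l tie_facts s(1) gy x in auto)
  then show False
    by (rule smaller_lens[OF y, of _ m x]) (use am s(1,3) gy x in auto)
qed

text \<open>Tie vertices have their position as level, so the walk can be rerouted over the tie with
  levels and phase unchanged. This is why a cop on \<open>S\<close> and one on \<open>S'\<close> can
  form a pair.\<close>

definition S' :: "'a track" where
  "S' = S\<lparr>wlk := (\<lambda>x. if \<alpha> < x \<and> x < \<beta> then t x else w x)\<rparr>"

lemma S'_simps: "len S' = len S" "lev S' = g" "phase S' = phase S"
  "\<alpha> \<le> x \<Longrightarrow> x \<le> \<beta> \<Longrightarrow> wlk S' x = t x" "x \<le> \<alpha> \<or> \<beta> \<le> x \<Longrightarrow> wlk S' x = w x"
  using tie_facts(3,4) by (auto simp: S'_def le_less)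

lemma track_S': "track_on R S'"
proof -
  have "adj (wlk S' x) (wlk S' (Suc x))" if "x < len S" for x
  proof -
    consider "x < \<alpha>" | "\<alpha> \<le> x" "x < \<beta>" | "\<beta> \<le> x" by linarith
    then show ?thesis
    proof cases
      case 2
      then show ?thesis using S'_simps(4)[of x] S'_simps(4)[of "Suc x"] tie_facts(7)[of x] by simp
    qed (use S'_simps(5)[of x] S'_simps(5)[of "Suc x"] track_adj[OF basic(4) that] in simp_all)
  qed
  then show ?thesis
    using basic(4) S'_simps(1,2,3) S'_simps(5)[of 0] unfolding track_on_def by simp
qed

lemma S'_inner: "\<alpha> < x \<Longrightarrow> x < \<beta> \<Longrightarrow> wlk S' x \<in> R" "\<alpha> < x \<Longrightarrow> x < \<beta> \<Longrightarrow> g (wlk S' x) = x"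
  using S'_simps(4)[of x] tie_facts(5,6)[of x] by simp_all

lemma S'_outer: "c \<le> x \<Longrightarrow> x \<le> d \<Longrightarrow> x \<le> \<alpha> \<or> \<beta> \<le> x \<Longrightarrow> wlk S' x \<notin> R"
  using S'_simps(5)[of x] w_out by simp

lemma S'_seg: "seg S' \<alpha> \<beta> = M \<union> {w \<alpha>, w \<beta>}"
proof -
  have "{\<alpha>..\<beta>} = insert \<alpha> (insert \<beta> {\<alpha><..<\<beta>})" using tie_facts(2) by auto
  moreover have "seg S' \<alpha> \<beta> = t ` {\<alpha>..\<beta>}"
    unfolding seg_def using S'_simps(4) by (intro image_cong) auto
  ultimately show ?thesis using tie_facts(3,4) by auto
qed

lemma S'_inj: "is_seg S' c d"
proof -
  have "wlk S' x \<noteq> wlk S' y" if xy: "x < y" "c \<le> x" "y \<le> d" for x y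
  proof
    assume eq: "wlk S' x = wlk S' y"
    show False
    proof (cases "wlk S' x \<in> R")
      case True
      then have "\<alpha> < x" "x < \<beta>" "\<alpha> < y" "y < \<beta>"
        using S'_outer[of x] S'_outer[of y] eq xy by (metis less_imp_le not_le order_trans)+
      then show False using S'_inner(2)[of x] S'_inner(2)[of y] eq xy by simp
    next
      case False
      then have "x \<le> \<alpha> \<or> \<beta> \<le> x" "y \<le> \<alpha> \<or> \<beta> \<le> y"
        using S'_inner(1)[of x] S'_inner(1)[of y] eq by (metis not_le)+
      then show False using S'_simps(5)[of x] S'_simps(5)[of y] w_inj[of x y] eq xy by simp
    qed
  qed
  then have "inj_on (wlk S') {c..d}" by (auto intro!: linorder_inj_onI)
  then show ?thesis using basic(11,13) S'_simps(1) by (simp add: is_seg_def)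
qed

text \<open>Inside the lens no defect remains on either side: before \<open>\<beta>\<close> by the
  choice of \<open>\<beta>\<close>, at \<open>\<beta>\<close> and along the tie by
  \<open>lens_no_tie\<close>. So a single cop per side suffices, which is state A.\<close>

lemma lens_region:
  assumes y: "y \<in> lens R S \<beta> \<alpha> t"
  defines "K \<equiv> comp_of (R - M) y"
  shows "K \<subset> R" "region K S \<alpha> \<beta> S' \<alpha> \<beta>" "strict_on K S \<alpha> \<beta>" "strict_on K S' \<alpha> \<beta>"
proof -
  have yR: "y \<in> R - M" using y by (simp add: lens_def)
  note tc = territory_comp[OF basic(2) M_sub yR, folded K_def]
  have l: "c \<le> \<alpha>" "\<alpha> + 1 < \<beta>" "\<beta> \<le> d" using tie_facts(1,2) \<beta>d by auto
  have sub: "K \<subseteq> R - M" unfolding K_def by (rule comp_sub[OF yR])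
  then show KR: "K \<subset> R" using M_sub M_ne by blast
  have Kl: "q \<in> lens R S \<beta> \<alpha> t" if "q \<in> K" for q
  proof -
    have "comp_of (R - M) q = K" by (rule comp_eq[OF yR that[unfolded K_def], folded K_def])
    then show ?thesis using y sub that unfolding lens_def K_def by blast
  qed
  have "territory K (seg S \<alpha> \<beta> \<union> seg S' \<alpha> \<beta>)"
    unfolding territory_def
  proof (intro conjI ballI allI impI)
    show "K \<subseteq> V" "con K" using tc(1) unfolding territory_def by auto
    show "K \<inter> (seg S \<alpha> \<beta> \<union> seg S' \<alpha> \<beta>) = {}"
      using sub arcs(6) path_on_ends[OF arcs(1)] unfolding S'_seg by blast
    fix q x assume q: "q \<in> K" "adj q x" "x \<notin> K"
    show "x \<in> seg S \<alpha> \<beta> \<union> seg S' \<alpha> \<beta>"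
    proof (cases "x \<in> R")
      case True
      then have "x \<in> M" using comp_closed[OF yR, of q x] q unfolding K_def by blast
      then show ?thesis unfolding S'_seg by blast
    next
      case False
      then show ?thesis using lens_nb[OF y, of q x] q unfolding K_def by blast
    qed
  qed
  moreover have "is_seg S \<alpha> \<beta>"
    using basic(5) l inj_on_subset[of w "{c..d}" "{\<alpha>..\<beta>}"] unfolding is_seg_def by auto
  moreover have "is_seg S' \<alpha> \<beta>"
    using S'_inj l inj_on_subset[of "wlk S'" "{c..d}" "{\<alpha>..\<beta>}"] unfolding is_seg_def by auto
  moreover have "i = \<alpha> \<and> j = \<alpha> \<or> i = \<beta> \<and> j = \<beta>" if ij: "i \<in> {\<alpha>..\<beta>}" "j \<in> {\<alpha>..\<beta>}" "w i = wlk S' j" for i j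
  proof -
    have "w i \<notin> R" using w_out[of i] ij(1) l by auto
    then have "\<not> (\<alpha> < j \<and> j < \<beta>)" using S'_inner(1)[of j] ij(3) by auto
    then have j: "j = \<alpha> \<or> j = \<beta>" using ij(2) by auto
    then have "w i = w j" using ij(3) S'_simps(5)[of j] by auto
    then show ?thesis using j w_inj[of i j] ij l by auto
  qed
  ultimately show "region K S \<alpha> \<beta> S' \<alpha> \<beta>"
    unfolding region_def bigon_def
    using track_on_mono[OF basic(4) tc(2)] track_on_mono[OF track_S' tc(2)] S'_simps(5)[of \<alpha>] S'_simps(5)[of \<beta>] by auto
  show "strict_on K S \<alpha> \<beta>"
    unfolding strict_on_def
  proof (intro ballI impI)
    fix q x assume q: "q \<in> K" "x \<in> {\<alpha>..\<beta>}" "adj q (w x)"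
    have qR: "q \<in> R" using q sub by blast
    have wk: "g q \<le> x + 1" "x \<le> g q + 1" using weakD[OF qR _ _ q(3)] q(2) l by auto
    have "Suc (g q) \<noteq> x"
    proof (cases "x < \<beta>")
      case True
      then show ?thesis using \<beta>_min[OF _ True qR q(3)] q(2) l by simp
    next
      case False
      then have "x = \<beta>" using q(2) by simp
      then show ?thesis using lens_no_tie[OF Kl[OF q(1)], of \<beta>] q(3) tie_facts(4) l by simp
    qed
    then show "g q = x \<or> g q = Suc x" using wk by linarith
  qed
  then show "strict_on K S' \<alpha> \<beta>"
    unfolding strict_on_def S'_simps(2)
  proof (intro ballI impI)
    fix q x assume h: "\<forall>r\<in>K. \<forall>x\<in>{\<alpha>..\<beta>}. adj r (w x) \<longrightarrow> g r = x \<or> g r = Suc x"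
      and q: "q \<in> K" "x \<in> {\<alpha>..\<beta>}" "adj q (wlk S' x)"
    show "g q = x \<or> g q = Suc x"
    proof (cases "\<alpha> < x \<and> x < \<beta>")
      case True
      have qR: "q \<in> R" using q sub by blast
      have "wlk S' x = t x" using S'_simps(4) True by simp
      then have ad: "adj q (t x)" using q(3) by simp
      have "g q \<le> x + 1" "x \<le> g q + 1" using g_lip[OF qR tie_facts(5) ad] tie_facts(6)[of x] True by auto
      moreover have "Suc (g q) \<noteq> x" using lens_no_tie[OF Kl[OF q(1)] _ _ ad] True by simp
      ultimately show ?thesis by linarith
    next
      case False
      then have "x = \<alpha> \<or> x = \<beta>" using q(2) by auto
      then have "wlk S' x = w x" using S'_simps(5) by auto
      then show ?thesis using h q by auto
    qed
  qed
qed

text \<open>Components outside the lens see no inner vertex of the bypassed piece, so for them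
  \<open>S'\<close> is as good as \<open>S\<close>. The tie vertices taken out of \<open>R\<close>
  reappear as positions of \<open>S'\<close> at their own level, which preserves descents.\<close>

lemma outer_region:
  assumes y: "y \<in> R - M" "y \<notin> lens R S \<beta> \<alpha> t"
  defines "K \<equiv> comp_of (R - M) y"
  shows "K \<subset> R" "region K P a b S' c d" "strict_on K P a b" "weak_on K S' c d" "desc_on K S' c d"
proof -
  note tc = territory_comp[OF basic(2) M_sub y(1), folded K_def]
  have l: "c \<le> \<alpha>" "\<alpha> + 1 < \<beta>" "\<beta> \<le> d" using tie_facts(1,2) \<beta>d by auto
  have sub: "K \<subseteq> R - M" unfolding K_def by (rule comp_sub[OF y(1)])
  then show KR: "K \<subset> R" using M_sub M_ne by blast
  have out: "x \<le> \<alpha> \<or> \<beta> \<le> x" if "q \<in> K" "adj q (w x)" for q x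
    using that y unfolding lens_def K_def by (metis (mono_tags, lifting) mem_Collect_eq not_le)
  have M_S': "M \<subseteq> seg S' c d" using S'_seg seg_sub[of c \<alpha> \<beta> d S'] l by auto
  have K_S': "K \<inter> seg S' c d = {}"
  proof -
    have "wlk S' x \<notin> K" if "c \<le> x" "x \<le> d" for x
    proof (cases "\<alpha> < x \<and> x < \<beta>")
      case True
      then have "wlk S' x \<in> M" using S'_simps(4)[of x] by auto
      then show ?thesis using sub by blast
    next
      case False
      then show ?thesis using S'_outer[of x] that sub by auto
    qed
    then show ?thesis unfolding seg_def by auto
  qed
  have "territory K (seg P a b \<union> seg S' c d)"
    using tc(1)
  proof (rule territory_cong)
    show "K \<inter> (seg P a b \<union> seg S' c d) = {}" using K_S' sub basic(9) by blast
    fix q x assume q: "q \<in> K" "adj q x" "x \<in> seg P a b \<union> seg S c d \<union> M"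
    show "x \<in> seg P a b \<union> seg S' c d"
    proof (cases "x \<in> seg S c d")
      case True
      then obtain e where e: "c \<le> e" "e \<le> d" "x = w e" by (elim segE)
      then have "x = wlk S' e" using out[OF q(1)] q(2) S'_simps(5) by simp
      then show ?thesis using e seg_mem[of e c d S'] by simp
    next
      case False
      then show ?thesis using q(3) M_S' by blast
    qed
  qed
  moreover have "bigon P a b S' c d"
  proof -
    have bg: "bigon P a b S c d" using bigon_sym[OF basic(1)] .
    have "i = a \<and> j = c \<or> i = b \<and> j = d" if ij: "i \<in> {a..b}" "j \<in> {c..d}" "wlk P i = wlk S' j" for i j
    proof -
      have "wlk P i \<notin> R" using seg_mem[OF ij(1)] basic(9) by blast
      then have "\<not> (\<alpha> < j \<and> j < \<beta>)" using S'_inner(1)[of j] ij(3) by auto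
      then have "wlk P i = w j" using ij(3) S'_simps(5)[of j] by auto
      then show ?thesis using bigonD[OF bg] ij by auto
    qed
    then show ?thesis
      using bg S'_inj l S'_simps(5)[of c] S'_simps(5)[of d] unfolding bigon_def by simp
  qed
  ultimately show "region K P a b S' c d"
    unfolding region_def using track_on_mono[OF basic(3) tc(2)] track_on_mono[OF track_S' tc(2)] by simp
  show "strict_on K P a b" using strict_on_mono[OF stP tc(2)] by simp
  show "weak_on K S' c d"
    unfolding weak_on_def S'_simps(2)
  proof (intro ballI impI)
    fix q x assume q: "q \<in> K" "x \<in> {c..d}" "adj q (wlk S' x)"
    have qR: "q \<in> R" using q sub by blast
    show "g q \<le> x + 1 \<and> x \<le> g q + 1"
    proof (cases "\<alpha> < x \<and> x < \<beta>")
      case True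
      then show ?thesis using g_lip[OF qR S'_inner(1) q(3)] S'_inner(2)[of x] by auto
    next
      case False
      then have "wlk S' x = w x" using S'_simps(5)[of x] by auto
      then show ?thesis using weakD[OF qR] q by simp
    qed
  qed
  show "desc_on K S' c d"
    unfolding desc_on_def S'_simps(1,2)
  proof (intro ballI impI)
    fix q assume q: "q \<in> K" "g q < len S"
    have qR: "q \<in> R" using q sub by blast
    consider r' where "r' \<in> R" "adj q r'" "g q = Suc (g r')" | e where "e \<in> {c..d}" "adj q (w e)" "g q = Suc e"
      using deS qR q(2) unfolding desc_on_def by blast
    then show "(\<exists>r'\<in>K. adj q r' \<and> g q = Suc (g r')) \<or> (\<exists>e\<in>{c..d}. adj q (wlk S' e) \<and> g q = Suc e)"
    proof cases
      case 1
      show ?thesis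
      proof (cases "r' \<in> M")
        case True
        then have "r' = wlk S' (g r')" "g r' \<in> {c..d}"
          using M_eq[OF True] S'_simps(4)[of "g r'"] l by auto
        then show ?thesis using 1 by metis
      next
        case False
        then have "r' \<in> K" using comp_closed[OF y(1), of q r'] q(1) 1 unfolding K_def by blast
        then show ?thesis using 1 by blast
      qed
    next
      case 2
      then have "wlk S' e = w e" using out[OF q(1) 2(2)] S'_simps(5) by simp
      then show ?thesis using 2 by metis
    qed
  qed
qed

text \<open>Outside the lens, the robber threatens only positions where \<open>S\<close> and \<open>S'\<close> agree, so that the two cops
  act as a pair, or he stands on the tie, and then his level is exactly the threatened position.\<close>

lemma hybrid_safe:
  assumes i: "guarding J R \<tau> cs r" "J u = Some P" "J v = Some S" "J z = Some S'" "odd (v + z)"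
    and r: "r \<notin> lens R S \<beta> \<alpha> t" "adj r r'" "r' \<notin> R"
  shows "\<exists>i<4. cs i = r' \<or> adj (cs i) r'"
proof -
  have rR: "r \<in> R" using i(1) by (simp add: guarding_def)
  have l: "c \<le> \<alpha>" "\<alpha> + 1 < \<beta>" "\<beta> \<le> d" "d \<le> len S" using tie_facts(1,2) \<beta>d basic(11) by auto
  have "r' \<in> seg P a b \<union> seg S c d" using basic(2) rR r unfolding territory_def by blast
  then show ?thesis
  proof
    assume "r' \<in> seg P a b"
    then show ?thesis using strict_safe[OF i(1,2) basic(3) stP basic(12) r(2)] by blast
  next
    assume "r' \<in> seg S c d"
    then obtain e where e: "c \<le> e" "e \<le> d" "r' = w e" by (elim segE)
    have wk: "g r \<le> e + 1" "e \<le> g r + 1" using weakD[OF rR e(1,2)] r(2) e(3) by auto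
    note pp = pair_pos[OF i(1,3,4,5) S'_simps(2,3)]
    have lv: "1 \<le> g r" "g r \<le> len S" using basic(4) rR unfolding track_on_def by blast+
    have nb: "adj (w x) (w y)" "adj (wlk S' x) (wlk S' y)" if "y = Suc x \<or> x = Suc y" "x \<le> len S" "y \<le> len S" for x y
      using that track_adj[OF basic(4), of x] track_adj[OF basic(4), of y] track_adj[OF track_S', of x] track_adj[OF track_S', of y]
        S'_simps(1) adj_commute by auto
    show ?thesis
    proof (cases "\<alpha> < e \<and> e < \<beta>")
      case False
      then have e': "w e = wlk S' e" using S'_simps(5)[of e] by auto
      consider "e = g r" | "Suc e = g r" | "e = Suc (g r)" using wk by linarith
      then show ?thesis
      proof cases
        case 1
        then show ?thesis using pp e(3) e' by metis
      next
        case 2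
        then have "e = g r - 1" by simp
        then show ?thesis using pp e(3) e' by metis
      next
        case 3
        then have "adj (w (g r)) (w e)" "adj (wlk S' (g r)) (wlk S' e)" using nb[of e "g r"] lv e(2) l by auto
        then show ?thesis using pp e(3) e' by metis
      qed
    next
      case True
      have "r \<in> M"
      proof (rule ccontr)
        assume "r \<notin> M"
        then have "r \<in> lens R S \<beta> \<alpha> t"
          using rR r(2) e(3) True comp_self[of r "R - M"] unfolding lens_def by blast
        then show False using r(1) by simp
      qed
      then have gr: "g r = e" using M_chord True r(2) e(3) by blast
      have "adj (w (g r - 1)) (w (g r))" using nb(1)[of "g r" "g r - 1"] lv by simp
      then show ?thesis using pp e(3) gr by metis
    qed
  qed
qed

text \<open>Cops \<open>u\<close> and \<open>z\<close> have equal parity, so \<open>u\<close> cannot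
  be the partner of \<open>z\<close> on the tie. Instead \<open>z\<close> goes to \<open>S'\<close>,
  \<open>u\<close> leaves \<open>S\<close> and takes over \<open>P\<close> from \<open>i\<close>,
  and \<open>i\<close>, who has the right parity, joins \<open>z\<close>. Cop \<open>v\<close> stays
  on \<open>S\<close>, so that \<open>v\<close> and \<open>z\<close> hold the path
  meanwhile.\<close>

lemma B_tie:
  assumes A: "\<And>R'. R' \<subset> R \<Longrightarrow> winA R'" and B: "\<And>R'. R' \<subset> R \<Longrightarrow> winB R'"
    and ix: "i < 4" "u < 4" "v < 4" "z < 4" "distinct [i, u, v, z]" "odd (v + z)" "odd (u + v)" "odd (i + z)"
  shows "wins [i \<mapsto> P, u \<mapsto> S, v \<mapsto> S] R"
proof -
  have l: "d \<le> len S" "b \<le> len P" using basic(11,12) by auto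
  have good: "robber_loses cs r" if "guarding J R \<tau> cs r" "J v = Some S" "J z = Some S'" "r \<in> lens R S \<beta> \<alpha> t" for J \<tau> cs r
  proof -
    have "wins [v \<mapsto> S, z \<mapsto> S'] (comp_of (R - M) r)"
      using A[OF lens_region(1)[OF that(4)]] lens_region(2-4)[OF that(4)] ix unfolding winA_def by auto
    moreover have "[v \<mapsto> S, z \<mapsto> S'] \<subseteq>\<^sub>m J" using that by (auto simp: map_le_def)
    ultimately show ?thesis using robber_loses_restrict[OF that(1) comp_self] by blast
  qed
  \<comment> \<open>The final stage of the exchange; the earlier ones follow backwards from it. The
    robber is in the lens (state A), on the tie (caught by the pair) or outside (state B on a
    smaller set).\<close>
  have w4: "wins [u \<mapsto> P, v \<mapsto> S, z \<mapsto> S', i \<mapsto> S'] R"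
    unfolding wins_def
  proof (intro allI impI)
    fix \<tau> cs r assume guarding: "guarding [u \<mapsto> P, v \<mapsto> S, z \<mapsto> S', i \<mapsto> S'] R \<tau> cs r"
    have Jv: "[u \<mapsto> P, v \<mapsto> S, z \<mapsto> S', i \<mapsto> S'] v = Some S" "[u \<mapsto> P, v \<mapsto> S, z \<mapsto> S', i \<mapsto> S'] z = Some S'"
       "[u \<mapsto> P, v \<mapsto> S, z \<mapsto> S', i \<mapsto> S'] i = Some S'" using ix(5) by auto
    consider "r \<in> lens R S \<beta> \<alpha> t" | "r \<in> M" | "r \<in> R - M" "r \<notin> lens R S \<beta> \<alpha> t"
      using guarding by (auto simp: guarding_def)
    then show "robber_loses cs r"
    proof cases
      case 1
      then show ?thesis using good[OF guarding Jv(1,2)] by blast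
    next
      case 2
      then have "wlk S' (lev S' r) = r" using M_eq[OF 2] S'_simps(2) S'_simps(4)[of "g r"] by simp
      then show ?thesis using pair_on_path[OF guarding Jv(3,2) ix(8)] by simp
    next
      case 3
      have o: "odd (z + i)" using ix(8) by (simp add: add.commute)
      have "wins [u \<mapsto> P, z \<mapsto> S', i \<mapsto> S'] (comp_of (R - M) r)"
        using B[OF outer_region(1)[OF 3]] outer_region(2-5)[OF 3] ix(1,2,4,5) o unfolding winB_def by auto
      moreover have "[u \<mapsto> P, z \<mapsto> S', i \<mapsto> S'] \<subseteq>\<^sub>m [u \<mapsto> P, v \<mapsto> S, z \<mapsto> S', i \<mapsto> S']"
        using ix(5) by (auto simp: map_le_def)
      ultimately show ?thesis using robber_loses_restrict[OF guarding comp_self] by blast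
    qed
  qed
  let ?J3 = "[u \<mapsto> P, v \<mapsto> S, z \<mapsto> S']" and ?J1 = "[i \<mapsto> P, v \<mapsto> S, z \<mapsto> S']" and ?J0 = "[i \<mapsto> P, u \<mapsto> S, v \<mapsto> S]"
  note lk = ix(5)
  have w3: "wins ?J3 R"
  proof (rule wins_sync[where good = "\<lambda>r. r \<in> lens R S \<beta> \<alpha> t", OF _ track_S' ix(1)])
    show "tracks_on R ?J3" using basic(3,4) track_S' ix by (auto simp: tracks_on_def)
    show "?J3 i = None" using lk by simp
    show "\<exists>i<4. cs i = r' \<or> adj (cs i) r'"
      if "guarding ?J3 R \<tau> cs r" "r \<notin> lens R S \<beta> \<alpha> t" "adj r r'" "r' \<notin> R" for \<tau> cs r r'
      using hybrid_safe[OF that(1) _ _ _ ix(6) that(2-4), of u] lk by simp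
    show "robber_loses cs r" if "guarding ?J3 R \<tau> cs r" "r \<in> lens R S \<beta> \<alpha> t" for \<tau> cs r
      using good[OF that(1) _ _ that(2)] lk by simp
    show "wins (?J3(i \<mapsto> S')) R" using w4 .
  qed
  have w1: "wins ?J1 R"
  proof (rule wins_sync[where good = "\<lambda>r. r \<in> lens R S \<beta> \<alpha> t", OF _ basic(3) ix(2)])
    show "tracks_on R ?J1" using basic(3,4) track_S' ix by (auto simp: tracks_on_def)
    show "?J1 u = None" using lk by auto
    show "\<exists>i<4. cs i = r' \<or> adj (cs i) r'"
      if "guarding ?J1 R \<tau> cs r" "r \<notin> lens R S \<beta> \<alpha> t" "adj r r'" "r' \<notin> R" for \<tau> cs r r'
      using hybrid_safe[OF that(1) _ _ _ ix(6) that(2-4), of i] lk by simp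
    show "robber_loses cs r" if "guarding ?J1 R \<tau> cs r" "r \<in> lens R S \<beta> \<alpha> t" for \<tau> cs r
      using good[OF that(1) _ _ that(2)] lk by simp
    show "wins (?J1(u \<mapsto> P)) R"
      by (rule wins_weaken[OF w3]) (use lk in \<open>auto simp: map_le_def\<close>)
  qed
  show ?thesis
  proof (rule wins_add[OF _ track_S' ix(4) _ _ w1])
    show "tracks_on R ?J0" using basic(3,4) ix by (auto simp: tracks_on_def)
    show "?J0 z = None" using lk by auto
    show "?J1 \<subseteq>\<^sub>m ?J0(z \<mapsto> S')" using lk by (auto simp: map_le_def)
    show "\<exists>i<4. cs i = r' \<or> adj (cs i) r'" if guarding: "guarding ?J0 R \<tau> cs r" and r': "adj r r'" "r' \<notin> R" for \<tau> cs r r'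
    proof -
      have rR: "r \<in> R" using guarding by (simp add: guarding_def)
      have J: "?J0 i = Some P" "?J0 u = Some S" "?J0 v = Some S" using lk by auto
      have "r' \<in> seg P a b \<union> seg S c d" using basic(2) rR r' unfolding territory_def by blast
      then show ?thesis
      proof
        assume "r' \<in> seg P a b"
        then show ?thesis using strict_safe[OF guarding J(1) basic(3) stP basic(12) r'(1)] by blast
      next
        assume "r' \<in> seg S c d"
        then obtain e where e: "c \<le> e" "e \<le> d" "r' = w e" by (elim segE)
        then show ?thesis
          using weak_safe[OF guarding J(2,3) ix(7) basic(4), of e] weakD[OF rR e(1,2)] r'(1) l by simp
      qed
    qed
  qed
qed

end

context planar_game
begin

section \<open>Shrinking the territory\<close>

text \<open>Each parity has two cops; since \<open>j\<close> and \<open>k\<close> are opposite, so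
  are \<open>i\<close> and the fourth cop.\<close>

lemma exists_spare_opposite:
  assumes "distinct [i, j, k]" "i < 4" "j < 4" "k < 4" "odd (j + (k::nat))"
  shows "\<exists>z<4. z \<notin> {i, j, k} \<and> odd (i + z)"
proof -
  have "i \<in> {0,1,2,3}" "j \<in> {0,1,2,3}" "k \<in> {0,1,2,3}" using assms by auto
  then show ?thesis
    using assms(1,5)
    by (elim insertE emptyE; simp)
      (rule exI[of _ 0] exI[of _ 1] exI[of _ 2] exI[of _ 3], simp)+
qed

text \<open>If the paired side is not strict, some position is threatened from the level just below
  it, and a descent from that robber vertex gives a tie. Its end is chosen least, then its start
  greatest, then its lens smallest.\<close>

lemma B_step:
  assumes A: "\<And>R'. R' \<subseteq> R \<Longrightarrow> winA R'" and B: "\<And>R'. R' \<subset> R \<Longrightarrow> winB R'"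
  shows "winB R"
  unfolding winB_def
proof (intro allI impI)
  fix P a b S c d and i j k :: nat
  assume reg: "region R P a b S c d" and st: "strict_on R P a b" and wk: "weak_on R S c d" and de: "desc_on R S c d"
    and ix: "i < 4" "j < 4" "k < 4" "distinct [i, j, k]" "odd (j + k)"
  show "wins [i \<mapsto> P, j \<mapsto> S, k \<mapsto> S] R"
  proof (cases "strict_on R S c d")
    case True
    \<comment> \<open>One cop of the pair suffices. This is state A on the same \<open>R\<close>,
      which therefore has to be settled before state B.\<close>
    then have "wins [i \<mapsto> P, j \<mapsto> S] R"
      using A[of R] reg st ix unfolding winA_def by auto
    then show ?thesis
      by (rule wins_weaken) (use ix in \<open>auto simp: map_le_def\<close>)
  next
    case False
    \<comment> \<open>Weak and strict guarding differ exactly in threats to the position one above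
      the level.\<close>
    define viol where "viol e \<longleftrightarrow> c \<le> e \<and> e \<le> d \<and> (\<exists>r\<in>R. adj r (wlk S e) \<and> Suc (lev S r) = e)" for e
    obtain r0 e0 where "r0 \<in> R" "e0 \<in> {c..d}" "adj r0 (wlk S e0)" "lev S r0 \<noteq> e0" "lev S r0 \<noteq> Suc e0"
      using False unfolding strict_on_def by blast
    moreover then have "lev S r0 \<le> e0 + 1" "e0 \<le> lev S r0 + 1" using wk unfolding weak_on_def by auto
    ultimately have "viol e0" unfolding viol_def by (auto intro!: bexI[of _ r0])
    define \<beta> where "\<beta> = (LEAST e. viol e)"
    have v\<beta>: "viol \<beta>" unfolding \<beta>_def by (rule LeastI[of viol e0, OF \<open>viol e0\<close>])
    have min: "Suc (lev S r) \<noteq> e" if "c \<le> e" "e < \<beta>" "r \<in> R" "adj r (wlk S e)" for e r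
    proof
      assume "Suc (lev S r) = e"
      then have "viol e" using that v\<beta> unfolding viol_def by auto
      then show False using not_less_Least[of e viol] that(2) unfolding \<beta>_def by blast
    qed
    obtain r1 where r1: "r1 \<in> R" "adj r1 (wlk S \<beta>)" "Suc (lev S r1) = \<beta>" and \<beta>: "c \<le> \<beta>" "\<beta> \<le> d"
      using v\<beta> unfolding viol_def by blast
    have "d \<le> len S" using reg unfolding region_def bigon_def is_seg_def by simp
    then have "lev S r1 < len S" using r1(3) \<beta>(2) by linarith
    then obtain m s where s: "m < lev S r1" "s (lev S r1) = r1"
        "\<And>x. m < x \<Longrightarrow> x \<le> lev S r1 \<Longrightarrow> s x \<in> R \<and> lev S (s x) = x"
        "\<And>x. m \<le> x \<Longrightarrow> x < lev S r1 \<Longrightarrow> adj (s x) (s (Suc x))" "s m = wlk S m" "c \<le> m"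
      using descend[where K = R and M = "{}", OF de subset_refl _ r1(1)] by auto
    have "tie R S c \<beta> m (s(\<beta> := wlk S \<beta>))"
      unfolding tie_def
    proof (intro conjI allI impI)
      show "adj ((s(\<beta> := wlk S \<beta>)) x) ((s(\<beta> := wlk S \<beta>)) (Suc x))" if "m \<le> x" "x < \<beta>" for x
      proof (cases "x = lev S r1")
        case True
        then show ?thesis using s(2) r1 by auto
      next
        case False
        then have "x < lev S r1" "Suc x \<noteq> \<beta>" "x \<noteq> \<beta>" using that r1(3) by auto
        then show ?thesis using s(4)[of x] that(1) by simp
      qed
    qed (use s r1(3) in auto)
    then have ex: "\<exists>t. tie R S c \<beta> m t" by blast
    have bd: "\<forall>\<alpha>. (\<exists>t. tie R S c \<beta> \<alpha> t) \<longrightarrow> \<alpha> \<le> \<beta>" unfolding tie_def by auto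
    define \<alpha> where "\<alpha> = (GREATEST \<alpha>. \<exists>t. tie R S c \<beta> \<alpha> t)"
    have t1: "\<exists>t. tie R S c \<beta> \<alpha> t"
      unfolding \<alpha>_def using GreatestI_nat[of "\<lambda>\<alpha>. \<exists>t. tie R S c \<beta> \<alpha> t" m \<beta>] ex bd by blast
    have max: "\<alpha>' \<le> \<alpha>" if "tie R S c \<beta> \<alpha>' t" for \<alpha>' t
      unfolding \<alpha>_def using Greatest_le_nat[of "\<lambda>\<alpha>. \<exists>t. tie R S c \<beta> \<alpha> t" \<alpha>' \<beta>] that bd by blast
    obtain t where t: "tie R S c \<beta> \<alpha> t" "\<And>t'. tie R S c \<beta> \<alpha> t' \<Longrightarrow> card (lens R S \<beta> \<alpha> t) \<le> card (lens R S \<beta> \<alpha> t')"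
      using ex_has_least_nat[of "tie R S c \<beta> \<alpha>" _ "\<lambda>t. card (lens R S \<beta> \<alpha> t)"] t1 by blast
    interpret tie_min V adj p \<gamma> x0 R P a b S c d \<alpha> \<beta> t
      by unfold_locales (fact reg st wk de \<beta>(2) min max t)+
    obtain z where z: "z < 4" "z \<notin> {i, j, k}" "odd (i + z)"
      using exists_spare_opposite[OF ix(4,1,2,3,5)] by blast
    have A': "winA R'" if "R' \<subset> R" for R' using A that by blast
    show ?thesis
    \<comment> \<open>Whichever of \<open>j\<close> and \<open>k\<close> is opposite to
      \<open>z\<close> plays the cop who stays on \<open>S\<close>.\<close>
    proof (cases "odd (k + z)")
      case True
      then show ?thesis using B_tie[OF A' B, of i j k z] ix z by simp
    next
      case False
      then have "odd (j + z)" "odd (k + j)" using ix(5) by (auto simp: even_add)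
      then have "wins [i \<mapsto> P, k \<mapsto> S, j \<mapsto> S] R" using B_tie[OF A' B, of i k j z] ix z by auto
      moreover have "[i \<mapsto> P, k \<mapsto> S, j \<mapsto> S] = [i \<mapsto> P, j \<mapsto> S, k \<mapsto> S]" using ix(4) by (auto simp: fun_upd_twist)
      ultimately show ?thesis by simp
    qed
  qed
qed

text \<open>States A and E fall back on proper subsets only; state B also uses state A on the same
  set, which fixes the order within one step of the induction.\<close>

lemma wins_all: "R \<subseteq> V \<Longrightarrow> winA R \<and> winB R \<and> winE R"
proof (induction "card R" arbitrary: R rule: less_induct)
  case less
  have fin: "finite R" using less.prems finV finite_subset by blast
  have IH: "winA R' \<and> winB R' \<and> winE R'" if "R' \<subset> R" for R'
    using less.hyps[of R'] less.prems that psubset_card_mono[OF fin that] by blast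
  have A: "winA R" and E: "winE R"
    using A_step[of R] E_step[of R] IH by blast+
  have "winA R'" if "R' \<subseteq> R" for R'
    using that A IH by (cases "R' = R") auto
  then have "winB R"
    using B_step[of R] IH by blast
  then show ?case using A E by blast
qed

text \<open>Even cops on \<open>x0\<close> and odd ones on \<open>y\<close> realise two cops of each
  parity class, and cop 0 is already in sync on the edge. So play starts in state E on the component
  of the robber.\<close>

lemma cops_win_edge:
  assumes y: "adj x0 y" and r: "r \<in> V"
  shows "cops_win (\<lambda>i. if even i then x0 else y) r"
proof -
  let ?cs = "\<lambda>i::nat. if even i then x0 else y"
  consider "r = x0" | "r = y" | "r \<in> V - {x0, y}" using r by blast
  then show ?thesis
  proof cases
    case 1
    then show ?thesis by (intro cops_win_caught[of 0]) auto
  next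
    case 2
    then show ?thesis by (intro cops_win_caught[of 1]) auto
  next
    case 3
    have "territory V {}" using conV adjV2 unfolding territory_def by auto
    then have "territory (comp_of (V - {x0, y}) r) {x0, y}"
      using territory_comp(1)[of V "{}" "{x0, y}" r] 3 x0 adjV2[OF y] by simp
    moreover have parity_at: "parity_at x0 0" unfolding parity_at_def by (intro exI[of _ 0]) simp
    moreover have "winE (comp_of (V - {x0, y}) r)"
      using wins_all[of "comp_of (V - {x0, y}) r"] comp_sub[OF 3] by blast
    ultimately have w: "wins [0 \<mapsto> edge_track x0 y 0] (comp_of (V - {x0, y}) r)"
      using y unfolding winE_def by simp
    have "parities_ok 0 ?cs"
      unfolding parities_ok_def using parity_at parity_at_step[OF parity_at y] by (auto simp: parity_at_def)
    then have "guarding [0 \<mapsto> edge_track x0 y 0] (comp_of (V - {x0, y}) r) 0 ?cs r"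
      unfolding guarding_def in_sync_def edge_track_def by (auto intro!: exI[of _ 0])
    then have "robber_loses ?cs r" using w unfolding wins_def by blast
    then show ?thesis using cops_win_caught unfolding robber_loses_def by blast
  qed
qed

end

section \<open>Transfer to pair graphs; the one-vertex graph\<close>

theorem theorem9:
  fixes G :: "'a pair_pre_digraph"
  assumes "pair_graph G"
    and "Digraph_Component.connected (with_proj G)"
    and "planar G"
  shows "active_cop_number G \<le> 4"
proof -
  interpret pair_graph G by fact
  let ?V = "pverts G" and ?adj = "\<lambda>u v. (u, v) \<in> parcs G"
  have sym: "(v, u) \<in> parcs G" if "(u, v) \<in> parcs G" for u v
    using pair_sym_arcs that by (auto simp: symmetric_def dest: symD)
  interpret sg: sgraph ?V ?adj
  proof
    show "\<not> (u, u) \<in> parcs G" for u using pair_no_loops[of "(u, u)"] by auto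
  qed (use sym in \<open>auto intro: in_arcsD1 pair_finite_verts\<close>)
  \<comment> \<open>Connectedness refers to the symmetric closure, which here has the same
    arcs.\<close>
  have ms: "pverts (mk_symmetric (with_proj G)) = ?V" "parcs (mk_symmetric (with_proj G)) = parcs G"
    using sym by (auto simp: mk_symmetric_def)
  have sc: "?V \<noteq> {}" "\<And>u v. u \<in> ?V \<Longrightarrow> v \<in> ?V \<Longrightarrow> u \<rightarrow>\<^sup>*\<^bsub>with_proj (mk_symmetric (with_proj G))\<^esub> v"
    using assms(2) ms unfolding Digraph_Component.connected_def strongly_connected_def by auto
  have con: "sg.con ?V"
    unfolding sg.con_def
  proof (intro ballI)
    fix u v assume uv: "u \<in> ?V" "v \<in> ?V"
    have "(u, v) \<in> rtrancl_on ?V (parcs G)"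
      using sc(2)[OF uv] ms unfolding reachable_def by simp
    then show "sg.reach ?V u v"
    proof (induction rule: rtrancl_on_induct)
      case (step y z)
      then show ?case using sg.reach_trans sg.reach_step by blast
    qed simp
  qed
  obtain x0 where x0: "x0 \<in> ?V" using sc(1) by blast
  show ?thesis
  proof (cases "?V = {x0}")
    case True
    \<comment> \<open>A single vertex has no neighbour, so the cops of \<open>cop_game\<close> could
      not move; one cop captures at the placement.\<close>
    then have "active_cops_win G 1"
      using active_cops_win_card[of G] by simp
    then have "active_cop_number G \<le> 1"
      unfolding active_cop_number_def by (rule Least_le)
    then show ?thesis by simp
  next
    case False
    have nbr: "\<exists>u. (v, u) \<in> parcs G" if v: "v \<in> ?V" for v
    proof -
      obtain x y where "x \<in> {v}" "y \<in> ?V - {v}" "(x, y) \<in> parcs G"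
        using sg.con_boundary[OF con, of "{v}"] v False x0 by (metis empty_subsetI insert_not_empty insert_subset singletonD)
      then show ?thesis by blast
    qed
    interpret cg: cop_game ?V ?adj x0
      by unfold_locales (use x0 con nbr in auto)
    obtain p \<gamma> where d: "plane_drawing G p \<gamma>" using assms(3) unfolding planar_def by blast
    interpret pg: planar_game ?V ?adj p \<gamma> x0
    proof unfold_locales
      show "inj_on p ?V" using d unfolding plane_drawing_def by blast
      show "Path_Connected.arc (\<gamma> {u, v})" "{pathstart (\<gamma> {u, v}), pathfinish (\<gamma> {u, v})} = {p u, p v}"
        "path_image (\<gamma> {u, v}) \<inter> p ` ?V = {p u, p v}" if "(u, v) \<in> parcs G" for u v
        using d that unfolding plane_drawing_def by blast+
      show "path_image (\<gamma> {u, v}) \<inter> path_image (\<gamma> {x, y}) \<subseteq> p ` ({u, v} \<inter> {x, y})"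
        if "(u, v) \<in> parcs G" "(x, y) \<in> parcs G" "{u, v} \<noteq> {x, y}" for u v x y
        using d that unfolding plane_drawing_def by blast
    qed
    obtain y where y: "(x0, y) \<in> parcs G" using nbr[OF x0] by blast
    have "active_cops_win G 4"
    proof (rule active_cops_win_if_cops_win[OF cg.cop_game_axioms])
      show "(if even i then x0 else y) \<in> ?V" for i :: nat using x0 sg.adjV2[OF y] by simp
      show "cg.cops_win (\<lambda>i. if even i then x0 else y) r" if "r \<in> ?V" for r
        using pg.cops_win_edge[OF y that] .
    qed
    then show ?thesis
      unfolding active_cop_number_def by (rule Least_le)
  qed
qed

end
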